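(* Fix $\delta>0$. There is an estimator $\tilde\gamma$ of $\gamma$ based on $\{X_s\}_{s=0}^t$, and a polynomial function $\mathcal{L}$ of the logarithms of $\gamma^{-1}$, $\pi_\star^{-1}$, $\delta^{-1}$, and $n$, such that, if $$t>\frac{1}{\pi_\star\gamma\varepsilon^2}\,\mathcal{L},$$ then $$\left|\frac{\tilde\gamma}{\gamma}-1\right|<\varepsilon$$ with probability at least $1-\delta$.
   Context: $\{X_s\}$ is an ergodic and reversible Markov chain on a finite state space of size $n$, with transition matrix $P$ and stationary distribution $\pi$; $P$ is assumed to be positive definite. The matrix $P$ is not known to the observer, who sees only the trajectory of the chain up to time $t$; an estimator based on $\{X_s\}_{s=0}^t$ is a function of this observed trajectory. The spectral gap of the chain is $\gamma=1-\lambda_2$, where $\lambda_2$ is the second largest eigenvalue of $P$, and $\pi_\star=\min_x\pi(x)$. The number $\varepsilon>0$ is the desired relative accuracy of the estimate. *)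

theory Defs
  imports "HOL-Probability.Probability" "Jordan_Normal_Form.Char_Poly"
begin

unbundle no vec_syntax

text \<open>The state space is \<open>{..<n}\<close>.  Distributions on it and functions on it are vectors of
  dimension \<open>n\<close>.\<close>

definition stochastic_mat :: "nat \<Rightarrow> real mat \<Rightarrow> bool" where
  "stochastic_mat n P \<longleftrightarrow> P \<in> carrier_mat n n
     \<and> (\<forall>x<n. \<forall>y<n. 0 \<le> P $$ (x, y)) \<and> (\<forall>x<n. (\<Sum>y<n. P $$ (x, y)) = 1)"

definition irreducible_chain :: "nat \<Rightarrow> real mat \<Rightarrow> bool" where
  "irreducible_chain n P \<longleftrightarrow> (\<forall>x<n. \<forall>y<n. \<exists>k. 0 < (P ^\<^sub>m k) $$ (x, y))"

definition aperiodic_chain :: "nat \<Rightarrow> real mat \<Rightarrow> bool" where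
  "aperiodic_chain n P \<longleftrightarrow> (\<forall>x<n. Gcd {k. 1 \<le> k \<and> 0 < (P ^\<^sub>m k) $$ (x, x)} = (1::nat))"

definition ergodic_chain :: "nat \<Rightarrow> real mat \<Rightarrow> bool" where
  "ergodic_chain n P \<longleftrightarrow> irreducible_chain n P \<and> aperiodic_chain n P"

definition stationary_distribution :: "nat \<Rightarrow> real mat \<Rightarrow> real vec \<Rightarrow> bool" where
  "stationary_distribution n P \<pi> \<longleftrightarrow> \<pi> \<in> carrier_vec n
     \<and> (\<forall>x<n. 0 \<le> \<pi> $ x) \<and> (\<Sum>x<n. \<pi> $ x) = 1 \<and> P\<^sup>T *\<^sub>v \<pi> = \<pi>"

definition reversible_chain :: "nat \<Rightarrow> real mat \<Rightarrow> real vec \<Rightarrow> bool" where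
  "reversible_chain n P \<pi> \<longleftrightarrow> (\<forall>x<n. \<forall>y<n. \<pi> $ x * P $$ (x, y) = \<pi> $ y * P $$ (y, x))"

text \<open>Detailed balance makes \<open>P\<close> self-adjoint for the inner product
  \<open>\<langle>f, g\<rangle> = (\<Sum>x. \<pi>(x) f(x) g(x))\<close>, not for the Euclidean one; positive definiteness refers to
  the former.\<close>

definition positive_definite_chain :: "nat \<Rightarrow> real mat \<Rightarrow> real vec \<Rightarrow> bool" where
  "positive_definite_chain n P \<pi> \<longleftrightarrow>
     (\<forall>f \<in> carrier_vec n. f \<noteq> 0\<^sub>v n \<longrightarrow> 0 < (\<Sum>x<n. \<pi> $ x * f $ x * (P *\<^sub>v f) $ x))"

definition min_stationary :: "nat \<Rightarrow> real vec \<Rightarrow> real" where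
  "min_stationary n \<pi> = Min ((\<lambda>x. \<pi> $ x) ` {..<n})"

text \<open>Eigenvalues are listed in decreasing order with algebraic multiplicity, so index \<open>1\<close> is
  the second largest.  A reversible chain has \<open>n\<close> real eigenvalues, so the index is in range
  for \<open>n \<ge> 2\<close>.\<close>

definition eigenvalues_desc :: "real mat \<Rightarrow> real list" where
  "eigenvalues_desc P = rev (sorted_list_of_multiset (proots (char_poly P)))"

definition spectral_gap :: "real mat \<Rightarrow> real" where
  "spectral_gap P = 1 - eigenvalues_desc P ! 1"

text \<open>The law of \<open>X 0\<close> is arbitrary.\<close>

definition markov_chain :: "'w measure \<Rightarrow> nat \<Rightarrow> real mat \<Rightarrow> (nat \<Rightarrow> 'w \<Rightarrow> nat) \<Rightarrow> bool" where
  "markov_chain M n P X \<longleftrightarrow> prob_space M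
     \<and> (\<forall>s. X s \<in> M \<rightarrow>\<^sub>M count_space {..<n})
     \<and> (\<forall>t x. \<forall>y<n. \<P>(\<omega> in M. \<forall>s\<le>t. X s \<omega> = x s) > 0 \<longrightarrow>
          \<P>(\<omega> in M. X (Suc t) \<omega> = y \<bar> \<forall>s\<le>t. X s \<omega> = x s) = P $$ (x t, y))"

definition trajectory :: "(nat \<Rightarrow> 'w \<Rightarrow> nat) \<Rightarrow> nat \<Rightarrow> 'w \<Rightarrow> nat list" where
  "trajectory X t \<omega> = map (\<lambda>s. X s \<omega>) [0..<Suc t]"

end

theory Submission
  imports Defs
begin

text \<open>The estimator is the spectral gap of the empirical chain: the infimum over \<open>f\<close> of the ratio of
  the empirical energy \<open>(\<Sum>s<t. (f (X (s + 1)) - f (X s))\<^sup>2) / 2\<close> to the empirical variance of \<open>f\<close>.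

  It hardly ever overestimates, mixed or not: for a second eigenfunction \<open>g\<close>, summation by parts turns
  the empirical energy into \<open>\<gamma>\<close> times the empirical variance, up to a boundary term and
  martingales whose variance is again controlled by the empirical energy.

  It does not underestimate once \<open>t\<close> exceeds \<open>1 / (\<pi>\<^sub>* \<gamma>)\<close> up to logarithms.
  The Poisson equation and a self-bounding martingale estimate show that all visit counts are close to
  \<open>t \<pi>(x)\<close>.  Given the visit counts, the empirical energy form is a sum of rank one forms, and a
  matrix barrier argument (Klein's inequality for large powers, with the conditional means as
  compensator) bounds it below by its compensator minus
  \<open>ln (n / \<delta>) / (\<pi>\<^sub>* \<epsilon>)\<close> times the variance.\<close>

section \<open>Self-adjoint kernels on a weighted finite set\<close>

text \<open>The two error directions differ in kind. Against overestimation a single test function,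
  the second eigenfunction, is enough. Against underestimation the minimising \<open>f\<close>
  depends on the trajectory, so the energy must be controlled for all \<open>f\<close> at once; a
  net of test functions would pay a factor \<open>n\<close>, a trace pays \<open>ln n\<close>. An
  exponential barrier would call for trace inequalities between exponentials of noncommuting
  operators. Large powers need only convexity of one scalar function, at the price of a compensator
  discounted by \<open>1 - e\<close> and of a starting level \<open>\<kappa>\<close> that grows with
  the horizon. The growth is harmless because only the excess over \<open>\<kappa>\<close> enters
  the final bound.

  One transition contributes a form of norm at most \<open>2 / \<pi>\<^sub>*\<close>. The resulting
  loss, divided by \<open>\<epsilon>\<close>, has to stay below
  \<open>\<epsilon> \<gamma> t\<close>, which is the origin of \<open>\<epsilon>\<^sup>2\<close> in
  the sample size. Positive definiteness of \<open>P\<close> makes \<open>1 - \<gamma>\<close> the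
  contraction rate on mean-zero functions, so mixing is governed by the same
  \<open>\<gamma>\<close>.\<close>

definition app :: "nat \<Rightarrow> (nat \<Rightarrow> nat \<Rightarrow> real) \<Rightarrow> (nat \<Rightarrow> real) \<Rightarrow> nat \<Rightarrow> real" where
  "app n A f x = (\<Sum>y<n. A x y * f y)"

definition point :: "nat \<Rightarrow> nat \<Rightarrow> real" where
  "point x y = (if y = x then 1 else 0)"

lemma app_cong: "(\<And>y. y < n \<Longrightarrow> f y = g y) \<Longrightarrow> app n A f = app n A g"
  by (auto simp: app_def fun_eq_iff intro!: sum.cong)

lemma app_add: "app n A (\<lambda>x. f x + g x) = (\<lambda>x. app n A f x + app n A g x)"
  by (auto simp: app_def fun_eq_iff algebra_simps sum.distrib)

lemma app_scale: "app n A (\<lambda>x. c * f x) = (\<lambda>x. c * app n A f x)"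
  by (auto simp: app_def fun_eq_iff sum_distrib_left algebra_simps)

lemma app_diff: "app n A (\<lambda>x. f x - g x) = (\<lambda>x. app n A f x - app n A g x)"
  by (auto simp: app_def fun_eq_iff algebra_simps sum_subtractf)

lemma app_point: "y < n \<Longrightarrow> app n A (point y) x = A x y"
  by (simp add: app_def point_def if_distrib cong: if_cong)

locale weighted =
  fixes n :: nat and w :: "nat \<Rightarrow> real"
  assumes w_pos: "x < n \<Longrightarrow> 0 < w x"
begin

definition ip :: "(nat \<Rightarrow> real) \<Rightarrow> (nat \<Rightarrow> real) \<Rightarrow> real" where
  "ip f g = (\<Sum>x<n. w x * f x * g x)"

definition selfadj :: "(nat \<Rightarrow> nat \<Rightarrow> real) \<Rightarrow> bool" where
  "selfadj A \<longleftrightarrow> (\<forall>x<n. \<forall>y<n. w x * A x y = w y * A y x)"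

definition orthonormal :: "nat \<Rightarrow> (nat \<Rightarrow> nat \<Rightarrow> real) \<Rightarrow> bool" where
  "orthonormal k u \<longleftrightarrow> (\<forall>i<k. \<forall>j<k. ip (u i) (u j) = (if i = j then 1 else 0))"

definition eigenbasis :: "(nat \<Rightarrow> nat \<Rightarrow> real) \<Rightarrow> (nat \<Rightarrow> nat \<Rightarrow> real) \<Rightarrow> (nat \<Rightarrow> real) \<Rightarrow> bool" where
  "eigenbasis A u l \<longleftrightarrow> orthonormal n u \<and> (\<forall>i<n. \<forall>x<n. app n A (u i) x = l i * u i x)"

lemma ip_commute: "ip f g = ip g f"
  by (simp add: ip_def mult_ac)

lemma ip_cong: "(\<And>x. x < n \<Longrightarrow> f x = f' x) \<Longrightarrow> (\<And>x. x < n \<Longrightarrow> g x = g' x) \<Longrightarrow> ip f g = ip f' g'"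
  by (simp add: ip_def)

lemma ip_add_right: "ip f (\<lambda>x. g x + h x) = ip f g + ip f h"
  by (simp add: ip_def algebra_simps sum.distrib)

lemma ip_diff_right: "ip f (\<lambda>x. g x - h x) = ip f g - ip f h"
  by (simp add: ip_def algebra_simps sum_subtractf)

lemma ip_scale_right: "ip f (\<lambda>x. c * g x) = c * ip f g"
  by (simp add: ip_def algebra_simps sum_distrib_left)

lemma ip_sum_right: "ip f (\<lambda>x. \<Sum>i\<in>I. g i x) = (\<Sum>i\<in>I. ip f (g i))"
  unfolding ip_def by (subst sum.swap) (simp add: sum_distrib_left)

lemma ip_add_left: "ip (\<lambda>x. g x + h x) f = ip g f + ip h f"
  by (simp add: ip_commute[of _ f] ip_add_right)

lemma ip_diff_left: "ip (\<lambda>x. g x - h x) f = ip g f - ip h f"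
  by (simp add: ip_commute[of _ f] ip_diff_right)

lemma ip_scale_left: "ip (\<lambda>x. c * g x) f = c * ip g f"
  by (simp add: ip_commute[of _ f] ip_scale_right)

lemma ip_sum_left: "ip (\<lambda>x. \<Sum>i\<in>I. g i x) f = (\<Sum>i\<in>I. ip (g i) f)"
  by (simp add: ip_commute[of _ f] ip_sum_right)

lemma ip_nonneg: "0 \<le> ip f f"
  unfolding ip_def using w_pos by (intro sum_nonneg) (simp add: less_imp_le mult.assoc)

lemma ip_eq_0_imp: assumes "ip f f = 0" "x < n" shows "f x = 0"
proof -
  have "\<forall>x\<in>{..<n}. w x * f x * f x = 0"
    using assms(1) unfolding ip_def
    by (subst (asm) sum_nonneg_eq_0_iff) (use w_pos in \<open>auto simp: mult.assoc less_imp_le\<close>)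
  then have "w x * f x * f x = 0" using assms(2) by blast
  then show ?thesis using w_pos[OF assms(2)] by simp
qed

lemma ip_point: "x < n \<Longrightarrow> ip (point x) f = w x * f x"
proof -
  assume "x < n"
  have "ip (point x) f = (\<Sum>z<n. if z = x then w x * f x else 0)"
    unfolding ip_def point_def by (intro sum.cong) auto
  then show ?thesis using \<open>x < n\<close> by simp
qed

lemma weight_square_le_ip: assumes "x < n" shows "w x * (f x)\<^sup>2 \<le> ip f f"
proof -
  have "w x * f x * f x \<le> (\<Sum>z<n. w z * f z * f z)"
    using assms w_pos by (intro member_le_sum) (auto simp: mult.assoc less_imp_le)
  then show ?thesis by (simp add: ip_def power2_eq_square mult.assoc)
qed

lemma ip_app_left: assumes "selfadj A" shows "ip (app n A f) g = ip f (app n A g)"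
proof -
  have "ip (app n A f) g = (\<Sum>x<n. \<Sum>y<n. w x * A x y * f y * g x)"
    by (simp add: ip_def app_def sum_distrib_left sum_distrib_right mult_ac)
  also have "\<dots> = (\<Sum>x<n. \<Sum>y<n. w y * A y x * f y * g x)"
    using assms by (intro sum.cong refl) (auto simp: selfadj_def)
  also have "\<dots> = (\<Sum>y<n. \<Sum>x<n. w y * A y x * f y * g x)" by (rule sum.swap)
  also have "\<dots> = ip f (app n A g)"
    by (simp add: ip_def app_def sum_distrib_left sum_distrib_right mult_ac)
  finally show ?thesis .
qed

lemma Cauchy_Schwarz: "(ip f g)\<^sup>2 \<le> ip f f * ip g g"
proof (cases "ip g g = 0")
  case True
  then have "ip f g = 0" by (auto simp: ip_def[of f] dest: ip_eq_0_imp intro!: sum.neutral)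
  then show ?thesis using True by simp
next
  case False
  then have pos: "ip g g > 0" using ip_nonneg[of g] by linarith
  have "0 \<le> ip (\<lambda>x. ip g g * f x - ip f g * g x) (\<lambda>x. ip g g * f x - ip f g * g x)"
    by (rule ip_nonneg)
  also have "\<dots> = ip g g * (ip g g * ip f f - (ip f g)\<^sup>2)"
    by (simp only: ip_diff_left ip_diff_right ip_scale_left ip_scale_right ip_commute[of g f])
      (simp add: power2_eq_square algebra_simps)
  finally show ?thesis using pos by (simp add: zero_le_mult_iff mult.commute)
qed

subsection \<open>The spectral theorem\<close>

text \<open>What is left of \<open>point x\<close> after projecting out \<open>u\<close>.  The normalised squared norms of these residuals
  add up to \<open>n - k\<close>, which replaces dimension arguments.\<close>

definition residual :: "nat \<Rightarrow> (nat \<Rightarrow> nat \<Rightarrow> real) \<Rightarrow> nat \<Rightarrow> nat \<Rightarrow> real" where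
  "residual k u x = (\<lambda>z. point x z - (\<Sum>i<k. w x * u i x * u i z))"

lemma residual_orthogonal:
  assumes "orthonormal k u" "j < k" "x < n"
  shows "ip (u j) (residual k u x) = 0"
proof -
  have "ip (u j) (residual k u x) = w x * u j x - (\<Sum>i<k. w x * u i x * ip (u j) (u i))"
    by (simp add: residual_def ip_diff_right ip_sum_right ip_scale_right ip_commute[of "u j" "point x"]
        ip_point assms(3))
  also have "(\<Sum>i<k. w x * u i x * ip (u j) (u i)) = (\<Sum>i<k. if i = j then w x * u j x else 0)"
    using assms by (intro sum.cong) (auto simp: orthonormal_def)
  finally show ?thesis using assms by simp
qed

lemma residual_norm:
  assumes "orthonormal k u" "x < n"
  shows "ip (residual k u x) (residual k u x) = w x * (1 - (\<Sum>i<k. w x * (u i x)\<^sup>2))"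
proof -
  have "ip (residual k u x) (residual k u x)
      = ip (point x) (residual k u x) - (\<Sum>i<k. w x * u i x * ip (u i) (residual k u x))"
    by (subst (1) residual_def) (simp add: ip_diff_left ip_sum_left ip_scale_left)
  also have "\<dots> = w x * residual k u x x"
    using residual_orthogonal[OF assms(1)] assms(2) by (simp add: ip_point)
  also have "residual k u x x = 1 - (\<Sum>i<k. w x * (u i x)\<^sup>2)"
    by (simp add: residual_def point_def power2_eq_square mult.assoc)
  finally show ?thesis .
qed

lemma sum_residual:
  assumes "orthonormal k u"
  shows "(\<Sum>x<n. 1 - (\<Sum>i<k. w x * (u i x)\<^sup>2)) = real n - real k"
proof -
  have "(\<Sum>x<n. \<Sum>i<k. w x * (u i x)\<^sup>2) = (\<Sum>i<k. ip (u i) (u i))"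
    unfolding ip_def by (subst sum.swap) (simp add: power2_eq_square mult.assoc)
  also have "\<dots> = real k" using assms by (simp add: orthonormal_def)
  finally show ?thesis by (simp add: sum_subtractf)
qed

text \<open>The normalised squared norms are nonnegative and for \<open>k = n\<close> sum to zero,
  so every residual vanishes. This is completeness of an orthonormal family of size
  \<open>n\<close>.\<close>

lemma residual_full:
  assumes "orthonormal n u" "x < n" "z < n"
  shows "(\<Sum>i<n. w x * u i x * u i z) = point x z"
proof -
  have nn: "0 \<le> 1 - (\<Sum>i<n. w x * (u i x)\<^sup>2)" if "x < n" for x
    using residual_norm[OF assms(1) that] ip_nonneg[of "residual n u x"] w_pos[OF that]
    by (simp add: zero_le_mult_iff)
  have "1 - (\<Sum>i<n. w x * (u i x)\<^sup>2) = 0"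
    using sum_residual[OF assms(1)] nn assms(2)
      sum_nonneg_eq_0_iff[of "{..<n}" "\<lambda>x. 1 - (\<Sum>i<n. w x * (u i x)\<^sup>2)"] by simp
  then have "ip (residual n u x) (residual n u x) = 0"
    using residual_norm[OF assms(1,2)] by simp
  from ip_eq_0_imp[OF this assms(3)] show ?thesis by (simp add: residual_def)
qed

text \<open>The normalised squared norms sum to \<open>n - k > 0\<close>, so one of them is
  positive; its residual is a nonzero vector orthogonal to the family.\<close>

lemma residual_exists:
  assumes "orthonormal k u" "k < n"
  obtains x where "x < n" "ip (residual k u x) (residual k u x) > 0"
proof -
  have "\<exists>x<n. 1 - (\<Sum>i<k. w x * (u i x)\<^sup>2) > 0"
  proof (rule ccontr)
    assume "\<not> ?thesis"
    then have "(\<Sum>x<n. 1 - (\<Sum>i<k. w x * (u i x)\<^sup>2)) \<le> 0" by (intro sum_nonpos) (meson lessThan_iff not_less)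
    then show False using sum_residual[OF assms(1)] assms(2) by simp
  qed
  then obtain x where "x < n" "1 - (\<Sum>i<k. w x * (u i x)\<^sup>2) > 0" by auto
  then show ?thesis
    using that[of x] residual_norm[OF assms(1), of x] w_pos[of x] by simp
qed

text \<open>Functions live on all of \<open>nat\<close>. Requiring them to vanish from
  \<open>n\<close> on puts the sphere into a product of compact sets, and
  \<open>w x * (f x)\<^sup>2 \<le> 1\<close> supplies the intervals below \<open>n\<close>.\<close>

lemma compact_sphere:
  "compact {f. (\<forall>x\<ge>n. f x = 0) \<and> ip f f = 1 \<and> (\<forall>i<k. ip (u i) f = 0)}" (is "compact ?K")
proof -
  define B where "B x = (if x < n then {- (1 / sqrt (w x))..1 / sqrt (w x)} else {0::real})" for x
  have "compactin (product_topology (\<lambda>_. euclidean) UNIV) (Pi\<^sub>E UNIV B)"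
    by (subst compactin_PiE) (auto simp: B_def)
  then have "compact (Pi\<^sub>E UNIV B)" by (simp add: euclidean_product_topology)
  moreover have "closed ?K"
  proof -
    have cont: "continuous_on UNIV (\<lambda>f. f x)" for x :: nat
      by (rule continuous_on_product_coordinates)
    have "?K = {f. ip f f = 1} \<inter> (\<Inter>x\<in>{n..}. {f. f x = 0}) \<inter> (\<Inter>i\<in>{..<k}. {f. ip (u i) f = 0})"
      by auto
    also have "closed \<dots>"
      unfolding ip_def by (intro closed_Int closed_INT ballI closed_Collect_eq continuous_intros cont)
    finally show ?thesis .
  qed
  moreover have "?K \<subseteq> Pi\<^sub>E UNIV B"
  proof
    fix f assume f: "f \<in> ?K"
    have "\<bar>f x\<bar> \<le> 1 / sqrt (w x)" if "x < n" for x
    proof -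
      have "w x * (f x)\<^sup>2 \<le> 1" using weight_square_le_ip[OF that, of f] f by simp
      then have "(f x)\<^sup>2 \<le> (1 / sqrt (w x))\<^sup>2"
        using w_pos[OF that] by (simp add: power_divide field_simps)
      then show ?thesis using w_pos[OF that] by (simp add: abs_le_square_iff[symmetric])
    qed
    then have "f x \<in> B x" for x using f by (cases "x < n") (auto simp: B_def abs_le_iff minus_le_iff)
    then show "f \<in> Pi\<^sub>E UNIV B" by auto
  qed
  ultimately have "compact (Pi\<^sub>E UNIV B \<inter> ?K)" "Pi\<^sub>E UNIV B \<inter> ?K = ?K"
    by (auto intro: compact_Int_closed)
  then show ?thesis by simp
qed

text \<open>The new eigenvector maximises the quadratic form on the unit sphere of the orthogonal complement.\<close>

lemma next_eigenvector:
  assumes A: "selfadj A" and u: "orthonormal k u" and k: "k < n"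
    and ev: "\<forall>i<k. \<forall>x<n. app n A (u i) x = l i * u i x"
  shows "\<exists>v c. ip v v = 1 \<and> (\<forall>i<k. ip (u i) v = 0) \<and> (\<forall>x<n. app n A v x = c * v x)"
proof -
  let ?K = "{f. (\<forall>x\<ge>n. f x = 0) \<and> ip f f = 1 \<and> (\<forall>i<k. ip (u i) f = 0)}"
  let ?q = "\<lambda>f. ip f (app n A f)"
  have normalise: "\<exists>g\<in>?K. \<forall>x<n. g x = f x / sqrt (ip f f)"
    if "ip f f > 0" "\<forall>i<k. ip (u i) f = 0" for f
  proof
    let ?g = "\<lambda>x. if x < n then (1 / sqrt (ip f f)) * f x else 0"
    have right: "ip h ?g = (1 / sqrt (ip f f)) * ip h f" for h
    proof -
      have "ip h ?g = ip h (\<lambda>x. (1 / sqrt (ip f f)) * f x)" by (rule ip_cong) auto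
      then show ?thesis by (simp only: ip_scale_right)
    qed
    have "ip ?g ?g = (1 / sqrt (ip f f)) * ((1 / sqrt (ip f f)) * ip f f)"
      unfolding right ip_commute[of ?g f] ..
    also have "\<dots> = 1" using that(1) by simp
    finally have "ip ?g ?g = 1" .
    moreover have "\<forall>i<k. ip (u i) ?g = 0" unfolding right using that(2) by simp
    moreover have "\<forall>x\<ge>n. ?g x = 0" by simp
    ultimately show "?g \<in> ?K" by blast
    show "\<forall>x<n. ?g x = f x / sqrt (ip f f)" by simp
  qed
  obtain x where "x < n" "ip (residual k u x) (residual k u x) > 0"
    using residual_exists[OF u k] .
  then have "?K \<noteq> {}"
    using normalise[of "residual k u x"] residual_orthogonal[OF u] by blast
  moreover have "continuous_on ?K ?q"
    unfolding ip_def app_def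
    by (intro continuous_on_sum continuous_on_mult continuous_on_const
        continuous_on_subset[OF continuous_on_product_coordinates] subset_UNIV)
  ultimately have "\<exists>v\<in>?K. \<forall>f\<in>?K. ?q f \<le> ?q v"
    by (intro continuous_attains_sup compact_sphere)
  then obtain v where v: "v \<in> ?K" and vmax: "\<And>f. f \<in> ?K \<Longrightarrow> ?q f \<le> ?q v"
    by blast
  define c where "c = ?q v"
  \<comment> \<open>Homogeneity carries the maximality from the unit sphere to the whole complement,
    so perturbations of \<open>v\<close> can be tested without normalising them.\<close>
  have q_le: "?q f \<le> c * ip f f" if f: "\<forall>i<k. ip (u i) f = 0" for f
  proof (cases "ip f f = 0")
    case True
    have "f x = 0" if "x < n" for x using ip_eq_0_imp[OF True that] .
    then have "?q f = 0" unfolding ip_def by (intro sum.neutral) auto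
    then show ?thesis using True by simp
  next
    case False
    then have pos: "ip f f > 0" using ip_nonneg[of f] by linarith
    define a where "a = 1 / sqrt (ip f f)"
    have a: "a * a = 1 / ip f f" using pos by (simp add: a_def)
    obtain g where g: "g \<in> ?K" "\<forall>x<n. g x = a * f x"
      using normalise[OF pos f] by (auto simp: a_def)
    have "app n A g = app n A (\<lambda>x. a * f x)"
      using g(2) by (intro app_cong) auto
    then have "?q g = ip (\<lambda>x. a * f x) (\<lambda>x. a * app n A f x)"
      using g(2) unfolding app_scale by (intro ip_cong) auto
    also have "\<dots> = (a * a) * ?q f" by (simp add: ip_scale_left ip_scale_right)
    finally have "(1 / ip f f) * ?q f \<le> c" using vmax[OF g(1)] by (simp add: c_def a)
    then show ?thesis using pos by (simp add: pos_divide_le_eq)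
  qed
  define r where "r = (\<lambda>x. app n A v x - c * v x)"
  have ipuA: "ip (u i) (app n A v) = 0" if "i < k" for i
  proof -
    have "ip (u i) (app n A v) = ip (app n A (u i)) v" by (simp add: ip_app_left[OF A])
    also have "\<dots> = ip (\<lambda>x. l i * u i x) v" using ev that by (intro ip_cong) auto
    also have "\<dots> = 0" using v that by (simp add: ip_scale_left)
    finally show ?thesis .
  qed
  have ur: "ip (u i) r = 0" if "i < k" for i
    using ipuA[OF that] v that by (simp add: r_def ip_diff_right ip_scale_right)
  have vr: "ip v r = 0" using v by (simp add: r_def ip_diff_right ip_scale_right c_def)
  have vAr: "ip v (app n A r) = ip r r"
  proof -
    have "ip v (app n A r) = ip (app n A v) r" by (simp add: ip_app_left[OF A])
    also have "\<dots> = ip r r + c * ip v r"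
      by (subst (2) r_def) (simp add: ip_diff_left ip_scale_left)
    finally show ?thesis using vr by simp
  qed
  \<comment> \<open>Moving from \<open>v\<close> in the direction of its own defect \<open>r\<close>
    gains \<open>2 * s * ip r r\<close> to first order. For small \<open>s\<close> maximality
    excludes this unless \<open>r\<close> vanishes.\<close>
  have ineq: "2 * s * ip r r \<le> s\<^sup>2 * (c * ip r r - ip r (app n A r))" for s
  proof -
    let ?f = "\<lambda>x. v x + s * r x"
    have "?q ?f \<le> c * ip ?f ?f"
      using v ur by (intro q_le) (auto simp: ip_add_right ip_scale_right)
    moreover have "ip ?f ?f = 1 + s\<^sup>2 * ip r r"
      using v vr
      by (simp only: ip_add_left ip_add_right ip_scale_left ip_scale_right ip_commute[of r v])
        (simp add: power2_eq_square)
    moreover have "?q ?f = c + 2 * s * ip r r + s\<^sup>2 * ip r (app n A r)"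
      using vAr ip_app_left[OF A, of v r] ip_commute[of "app n A v" r]
      by (simp only: app_add app_scale ip_add_left ip_add_right ip_scale_left ip_scale_right c_def)
        (simp add: power2_eq_square algebra_simps)
    ultimately show ?thesis by (simp add: algebra_simps)
  qed
  have "ip r r = 0"
  proof (rule ccontr)
    assume "ip r r \<noteq> 0"
    then have pos: "ip r r > 0" using ip_nonneg[of r] by linarith
    define d where "d = \<bar>c * ip r r - ip r (app n A r)\<bar> + 1"
    define s where "s = ip r r / d"
    have d: "d > 0" "c * ip r r - ip r (app n A r) \<le> d" by (auto simp: d_def)
    have s: "s > 0" using pos d by (simp add: s_def)
    have "2 * s * ip r r \<le> s\<^sup>2 * d"
      using ineq[of s] mult_left_mono[OF d(2), of "s\<^sup>2"] by simp
    also have "\<dots> = s * ip r r" using d by (simp add: s_def power2_eq_square)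
    finally show False using s pos by simp
  qed
  then have "\<forall>x<n. app n A v x = c * v x" using ip_eq_0_imp[of r] by (auto simp: r_def)
  then show ?thesis using v by blast
qed

theorem spectral_theorem:
  assumes A: "selfadj A"
  shows "\<exists>u l. eigenbasis A u l"
proof -
  have "k \<le> n \<Longrightarrow> \<exists>u l. orthonormal k u \<and> (\<forall>i<k. \<forall>x<n. app n A (u i) x = l i * u i x)" for k
  proof (induction k)
    case 0
    then show ?case by (simp add: orthonormal_def)
  next
    case (Suc k)
    then obtain u l where u: "orthonormal k u" "\<forall>i<k. \<forall>x<n. app n A (u i) x = l i * u i x"
      by auto
    obtain v c where v: "ip v v = 1" "\<forall>i<k. ip (u i) v = 0" "\<forall>x<n. app n A v x = c * v x"
      using next_eigenvector[OF A u(1) _ u(2)] Suc.prems by auto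
    have "\<forall>i<k. ip v (u i) = 0" using v(2) ip_commute[of v] by metis
    then have "orthonormal (Suc k) (u(k := v))"
      using u(1) v(1,2) by (auto simp: orthonormal_def less_Suc_eq)
    moreover have "\<forall>i<Suc k. \<forall>x<n. app n A ((u(k := v)) i) x = (l(k := c)) i * (u(k := v)) i x"
      using u(2) v(3) by (auto simp: less_Suc_eq)
    ultimately show ?case by blast
  qed
  then show ?thesis unfolding eigenbasis_def by blast
qed

lemma expansion:
  assumes "orthonormal n u" "x < n"
  shows "f x = (\<Sum>i<n. ip (u i) f * u i x)"
proof -
  have "(\<Sum>i<n. ip (u i) f * u i x) = (\<Sum>i<n. \<Sum>z<n. f z * (w z * u i z * u i x))"
    by (auto simp: ip_def sum_distrib_right sum_distrib_left mult_ac intro!: sum.cong)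
  also have "\<dots> = (\<Sum>z<n. f z * (\<Sum>i<n. w z * u i z * u i x))"
    by (subst sum.swap) (simp add: sum_distrib_left)
  also have "\<dots> = (\<Sum>z<n. f z * point z x)"
    using residual_full[OF assms(1)] assms(2) by (intro sum.cong) auto
  also have "\<dots> = (\<Sum>z<n. if z = x then f x else 0)"
    by (intro sum.cong) (auto simp: point_def)
  finally show ?thesis using assms(2) by simp
qed

lemma Parseval:
  assumes "orthonormal n u"
  shows "ip f g = (\<Sum>i<n. ip (u i) f * ip (u i) g)"
proof -
  have "ip f g = ip (\<lambda>x. \<Sum>i<n. ip (u i) f * u i x) g"
    using expansion[OF assms, of _ f] by (intro ip_cong) auto
  then show ?thesis by (simp add: ip_sum_left ip_scale_left)
qed

lemma ip_eigen_funpow: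
  assumes "selfadj A" "eigenbasis A u l" "i < n"
  shows "ip (u i) ((app n A ^^ k) f) = l i ^ k * ip (u i) f"
proof (induction k)
  case (Suc k)
  have "ip (u i) ((app n A ^^ Suc k) f) = ip (app n A (u i)) ((app n A ^^ k) f)"
    by (simp add: ip_app_left[OF assms(1)])
  also have "\<dots> = ip (\<lambda>x. l i * u i x) ((app n A ^^ k) f)"
    using assms by (intro ip_cong) (auto simp: eigenbasis_def)
  finally show ?case using Suc by (simp add: ip_scale_left)
qed simp

lemma funpow_expansion:
  assumes "selfadj A" "eigenbasis A u l" "x < n"
  shows "(app n A ^^ k) f x = (\<Sum>i<n. l i ^ k * ip (u i) f * u i x)"
  using expansion[of u x "(app n A ^^ k) f"] assms ip_eigen_funpow[OF assms(1,2)]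
  by (simp add: eigenbasis_def)

lemma ip_funpow:
  assumes "selfadj A" "eigenbasis A u l"
  shows "ip g ((app n A ^^ k) f) = (\<Sum>i<n. l i ^ k * ip (u i) g * ip (u i) f)"
  using Parseval[of u g "(app n A ^^ k) f"] assms ip_eigen_funpow[OF assms(1,2)]
  by (simp add: eigenbasis_def mult_ac)

end

subsection \<open>Traces of powers\<close>

lemma app_kernel_add:
  "app n (\<lambda>x y. A x y + c * B x y) f = (\<lambda>x. app n A f x + c * app n B f x)"
  unfolding app_def distrib_right sum.distrib by (simp only: sum_distrib_left mult.assoc)

text \<open>Convexity of the power function: \<open>b\<close> times the tangent for \<open>N\<close>
  exceeds the tangent for \<open>Suc N\<close> by a nonnegative multiple of
  \<open>(b - a)\<^sup>2\<close>. The truncated exponent at \<open>N = 0\<close> is harmless because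
  its coefficient is \<open>0\<close>.\<close>

lemma power_tangent_le:
  fixes a b :: real
  assumes "0 \<le> a" "0 \<le> b"
  shows "a ^ N + real N * a ^ (N - 1) * (b - a) \<le> b ^ N"
proof (induction N)
  case (Suc N)
  show ?case
  proof (cases N)
    case (Suc m)
    have "a ^ Suc N + real (Suc N) * a ^ N * (b - a)
        = b * (a ^ N + real N * a ^ (N - 1) * (b - a)) - real N * a ^ m * (b - a)\<^sup>2"
      by (simp add: Suc algebra_simps power2_eq_square)
    also have "\<dots> \<le> b * b ^ N"
    proof -
      have "0 \<le> real N * a ^ m * (b - a)\<^sup>2" using assms(1) by simp
      then show ?thesis using mult_left_mono[OF Suc.IH assms(2)] by linarith
    qed
    finally show ?thesis by simp
  qed simp
qed simp

text \<open>Both powers are increasing, so \<open>a ^ i - b ^ i\<close> and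
  \<open>a ^ j - b ^ j\<close> never have opposite signs.\<close>

lemma power_rearrange_le:
  fixes a b :: real
  assumes "0 \<le> a" "0 \<le> b"
  shows "a ^ i * b ^ j + b ^ i * a ^ j \<le> a ^ (i + j) + b ^ (i + j)"
proof -
  have "0 \<le> (a ^ i - b ^ i) * (a ^ j - b ^ j)"
    using assms by (cases "a \<le> b") (auto simp: zero_le_mult_iff power_mono)
  then show ?thesis by (simp add: algebra_simps power_add)
qed

context weighted
begin

definition trpow :: "(nat \<Rightarrow> nat \<Rightarrow> real) \<Rightarrow> nat \<Rightarrow> real" where
  "trpow A k = (\<Sum>x<n. (app n A ^^ k) (point x) x)"

text \<open>The trace of \<open>A ^ k\<close> composed with \<open>D\<close>;
  \<open>\<lambda>z. D z x\<close> is the column of \<open>D\<close> at \<open>x\<close>. Up to a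
  factor it is the derivative of \<open>trpow\<close> in the direction \<open>D\<close>.\<close>

definition trmix :: "(nat \<Rightarrow> nat \<Rightarrow> real) \<Rightarrow> nat \<Rightarrow> (nat \<Rightarrow> nat \<Rightarrow> real) \<Rightarrow> real" where
  "trmix A k D = (\<Sum>x<n. (app n A ^^ k) (\<lambda>z. D z x) x)"

text \<open>The kernel of \<open>f \<mapsto> ip v f * v\<close>; the factor \<open>w y\<close> turns
  the plain sum in \<open>app\<close> into the weighted inner product.\<close>

definition rank1 :: "(nat \<Rightarrow> real) \<Rightarrow> nat \<Rightarrow> nat \<Rightarrow> real" where
  "rank1 v = (\<lambda>x y. v x * v y * w y)"

lemma trpow_eigen:
  assumes "selfadj A" "eigenbasis A u l"
  shows "trpow A k = (\<Sum>i<n. l i ^ k)"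
proof -
  have "trpow A k = (\<Sum>x<n. \<Sum>i<n. l i ^ k * (w x * u i x * u i x))"
    unfolding trpow_def
    by (intro sum.cong refl) (simp add: funpow_expansion[OF assms] ip_commute[of _ "point _"] ip_point
        mult_ac)
  also have "\<dots> = (\<Sum>i<n. l i ^ k * ip (u i) (u i))"
    by (subst sum.swap) (simp add: ip_def sum_distrib_left)
  also have "\<dots> = (\<Sum>i<n. l i ^ k)"
    using assms by (simp add: eigenbasis_def orthonormal_def)
  finally show ?thesis .
qed

lemma trmix_eigen:
  assumes "selfadj A" "eigenbasis A u l"
  shows "trmix A k D = (\<Sum>i<n. l i ^ k * ip (u i) (app n D (u i)))"
proof -
  have "trmix A k D = (\<Sum>x<n. \<Sum>i<n. l i ^ k * (ip (u i) (\<lambda>z. D z x) * u i x))"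
    unfolding trmix_def
    by (intro sum.cong refl) (simp add: funpow_expansion[OF assms] mult_ac)
  also have "\<dots> = (\<Sum>i<n. l i ^ k * (\<Sum>x<n. ip (u i) (\<lambda>z. D z x) * u i x))"
    by (subst sum.swap) (simp add: sum_distrib_left)
  also have "\<dots> = (\<Sum>i<n. l i ^ k * ip (u i) (app n D (u i)))"
  proof -
    have "(\<Sum>x<n. ip (u i) (\<lambda>z. D z x) * u i x) = ip (u i) (app n D (u i))" for i
    proof -
      have "(\<Sum>x<n. ip (u i) (\<lambda>z. D z x) * u i x) = (\<Sum>x<n. \<Sum>z<n. w z * u i z * (D z x * u i x))"
        by (simp add: ip_def sum_distrib_left sum_distrib_right mult_ac)
      also have "\<dots> = ip (u i) (app n D (u i))"
        by (subst sum.swap) (simp add: ip_def app_def sum_distrib_left mult_ac)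
      finally show ?thesis .
    qed
    then show ?thesis by simp
  qed
  finally show ?thesis .
qed

lemma trmix_diff:
  assumes "selfadj A"
  shows "trmix A k (\<lambda>x y. D x y - D' x y) = trmix A k D - trmix A k D'"
proof -
  obtain u l where "eigenbasis A u l" using spectral_theorem[OF assms] by blast
  moreover have "app n (\<lambda>x y. D x y - D' x y) f = (\<lambda>x. app n D f x - app n D' f x)" for f
    by (auto simp: app_def algebra_simps sum_subtractf)
  ultimately show ?thesis
    by (simp add: trmix_eigen[OF assms] ip_diff_right algebra_simps sum_subtractf)
qed

lemma trmix_scale:
  assumes "selfadj A"
  shows "trmix A k (\<lambda>x y. c * D x y) = c * trmix A k D"
proof -
  obtain u l where "eigenbasis A u l" using spectral_theorem[OF assms] by blast
  moreover have "app n (\<lambda>x y. c * D x y) f = (\<lambda>x. c * app n D f x)" for f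
    by (auto simp: app_def sum_distrib_left mult.assoc)
  ultimately show ?thesis
    by (simp add: trmix_eigen[OF assms] ip_scale_right sum_distrib_left mult_ac)
qed

lemma trmix_sum:
  assumes "selfadj A"
  shows "trmix A k (\<lambda>x y. \<Sum>z\<in>I. q z * D z x y) = (\<Sum>z\<in>I. q z * trmix A k (D z))"
proof -
  obtain u l where u: "eigenbasis A u l" using spectral_theorem[OF assms] by blast
  have "app n (\<lambda>x y. \<Sum>z\<in>I. q z * D z x y) f = (\<lambda>x. \<Sum>z\<in>I. q z * app n (D z) f x)" for f
  proof
    fix x
    have "app n (\<lambda>x y. \<Sum>z\<in>I. q z * D z x y) f x = (\<Sum>y<n. \<Sum>z\<in>I. q z * (D z x y * f y))"
      by (simp add: app_def sum_distrib_left sum_distrib_right mult_ac)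
    also have "\<dots> = (\<Sum>z\<in>I. q z * app n (D z) f x)"
      by (subst sum.swap) (simp add: app_def sum_distrib_left mult_ac)
    finally show "app n (\<lambda>x y. \<Sum>z\<in>I. q z * D z x y) f x = (\<Sum>z\<in>I. q z * app n (D z) f x)" .
  qed
  then have "trmix A k (\<lambda>x y. \<Sum>z\<in>I. q z * D z x y)
      = (\<Sum>i<n. \<Sum>z\<in>I. q z * (l i ^ k * ip (u i) (app n (D z) (u i))))"
    by (simp add: trmix_eigen[OF assms u] ip_sum_right ip_scale_right sum_distrib_left mult_ac)
  also have "\<dots> = (\<Sum>z\<in>I. q z * trmix A k (D z))"
    by (subst sum.swap) (simp add: trmix_eigen[OF assms u] sum_distrib_left)
  finally show ?thesis .
qed

lemma app_rank1: "app n (rank1 v) f = (\<lambda>x. ip v f * v x)"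
  by (auto simp: app_def rank1_def ip_def sum_distrib_left sum_distrib_right mult_ac)

lemma selfadj_rank1: "selfadj (rank1 v)"
  by (auto simp: selfadj_def rank1_def)

text \<open>It turns the derivative of the trace in a rank one direction into a quadratic form, the
  quantity that \<open>rank1_update_form\<close> compares for two operators.\<close>

lemma trmix_rank1:
  assumes "selfadj A"
  shows "trmix A k (rank1 v) = ip v ((app n A ^^ k) v)"
proof -
  obtain u l where "eigenbasis A u l" using spectral_theorem[OF assms] by blast
  then have u: "eigenbasis A u l" .
  show ?thesis
    by (simp only: trmix_eigen[OF assms u] ip_funpow[OF assms u] app_rank1 ip_scale_right)
      (simp add: ip_commute[of v "u i" for i] mult_ac)
qed

lemma eigenvalue_ge:
  assumes "eigenbasis A u l" "\<And>f. c * ip f f \<le> ip f (app n A f)" "i < n"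
  shows "c \<le> l i"
proof -
  have "ip (u i) (app n A (u i)) = ip (u i) (\<lambda>x. l i * u i x)"
    using assms by (intro ip_cong) (auto simp: eigenbasis_def)
  also have "\<dots> = l i" using assms by (simp add: ip_scale_right eigenbasis_def orthonormal_def)
  finally show ?thesis
    using assms(2)[of "u i"] assms(1,3) by (simp add: eigenbasis_def orthonormal_def)
qed

text \<open>Klein's inequality for the convex function \<open>\<lambda>x. x ^ N\<close>: in eigenbases of \<open>A\<close> and \<open>B\<close> it
  is an average of \<open>power_tangent_le\<close> against the doubly stochastic matrix of squared
  overlaps.\<close>

lemma Klein_inequality:
  assumes A: "selfadj A" "\<And>f. 0 \<le> ip f (app n A f)"
    and B: "selfadj B" "\<And>f. 0 \<le> ip f (app n B f)"
  shows "trpow A N + real N * trmix A (N - 1) (\<lambda>x y. B x y - A x y) \<le> trpow B N"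
proof -
  obtain u l where u: "eigenbasis A u l" using spectral_theorem[OF A(1)] by blast
  obtain v m where v: "eigenbasis B v m" using spectral_theorem[OF B(1)] by blast
  have on: "orthonormal n u" "orthonormal n v" using u v by (auto simp: eigenbasis_def)
  have l: "0 \<le> l i" if "i < n" for i using eigenvalue_ge[OF u, of 0] A(2) that by simp
  have m: "0 \<le> m i" if "i < n" for i using eigenvalue_ge[OF v, of 0] B(2) that by simp
  define c where "c i j = (ip (v j) (u i))\<^sup>2" for i j
  have row: "(\<Sum>j<n. c i j) = 1" if "i < n" for i
    using Parseval[OF on(2), of "u i" "u i"] on(1) that
    by (simp add: c_def power2_eq_square orthonormal_def)
  have col: "(\<Sum>i<n. c i j) = 1" if "j < n" for j
    using Parseval[OF on(1), of "v j" "v j"] on(2) that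
    by (simp add: c_def power2_eq_square orthonormal_def ip_commute[of "v j" "u i" for i])
  have uBu: "ip (u i) (app n B (u i)) = (\<Sum>j<n. m j * c i j)" for i
    using ip_funpow[OF B(1) v, of "u i" 1 "u i"] by (simp add: c_def power2_eq_square mult_ac)
  have uAu: "ip (u i) (app n A (u i)) = l i" if "i < n" for i
  proof -
    have "ip (u i) (app n A (u i)) = (\<Sum>j<n. l j * ip (u j) (u i) * ip (u j) (u i))"
      using ip_funpow[OF A(1) u, of "u i" 1 "u i"] by simp
    also have "\<dots> = (\<Sum>j<n. if j = i then l i else 0)"
      using on(1) that by (intro sum.cong) (auto simp: orthonormal_def)
    finally show ?thesis using that by simp
  qed
  have "trpow A N + real N * trmix A (N - 1) (\<lambda>x y. B x y - A x y)
      = (\<Sum>i<n. l i ^ N + real N * (l i ^ (N - 1) * ((\<Sum>j<n. m j * c i j) - l i)))"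
    by (simp add: trpow_eigen[OF A(1) u] trmix_diff[OF A(1)] trmix_eigen[OF A(1) u] uBu uAu
        sum_distrib_left sum.distrib sum_subtractf right_diff_distrib)
  also have "\<dots> = (\<Sum>i<n. \<Sum>j<n. c i j * (l i ^ N + real N * l i ^ (N - 1) * (m j - l i)))"
  proof (intro sum.cong refl)
    fix i assume "i \<in> {..<n}"
    then have r: "(\<Sum>j<n. c i j) = 1" using row by simp
    have "(\<Sum>j<n. c i j * (l i ^ N + real N * l i ^ (N - 1) * (m j - l i)))
      = (\<Sum>j<n. c i j) * (l i ^ N - real N * l i ^ (N - 1) * l i)
        + real N * l i ^ (N - 1) * (\<Sum>j<n. m j * c i j)"
      unfolding sum_distrib_left sum_distrib_right sum.distrib[symmetric]
      by (intro sum.cong refl) (simp add: algebra_simps)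
    then show "l i ^ N + real N * (l i ^ (N - 1) * ((\<Sum>j<n. m j * c i j) - l i))
        = (\<Sum>j<n. c i j * (l i ^ N + real N * l i ^ (N - 1) * (m j - l i)))"
      by (simp add: r algebra_simps)
  qed
  also have "\<dots> \<le> (\<Sum>i<n. \<Sum>j<n. c i j * m j ^ N)"
    using power_tangent_le l m by (intro sum_mono mult_left_mono) (auto simp: c_def)
  also have "\<dots> = (\<Sum>j<n. (\<Sum>i<n. c i j) * m j ^ N)"
    by (subst sum.swap) (simp add: sum_distrib_right)
  also have "\<dots> = trpow B N" by (simp add: col trpow_eigen[OF B(1) v])
  finally show ?thesis .
qed

text \<open>With nonnegative eigenvalues the \<open>N\<close>-th power of each of them is at most
  the trace, so a trace bound is a bound on the largest eigenvalue.\<close>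

lemma form_le_of_trpow_le:
  assumes A: "selfadj A" "\<And>f. 0 \<le> ip f (app n A f)"
    and N: "0 < N" and C: "0 \<le> C" "trpow A N \<le> C ^ N"
  shows "ip f (app n A f) \<le> C * ip f f"
proof -
  obtain u l where u: "eigenbasis A u l" using spectral_theorem[OF A(1)] by blast
  have l: "0 \<le> l i" if "i < n" for i using eigenvalue_ge[OF u, of 0] A(2) that by simp
  have lC: "l i \<le> C" if "i < n" for i
  proof -
    have "l i ^ N \<le> (\<Sum>i<n. l i ^ N)" using l that by (intro member_le_sum) auto
    then have "l i ^ N \<le> C ^ N" using C(2) by (simp add: trpow_eigen[OF A(1) u])
    then show ?thesis using N C(1) power_le_imp_le_base[of "l i" "N - 1" C] by simp
  qed
  have "ip f (app n A f) = (\<Sum>i<n. l i * (ip (u i) f * ip (u i) f))"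
    using ip_funpow[OF A(1) u, of f 1 f] by (simp add: mult_ac)
  also have "\<dots> \<le> (\<Sum>i<n. C * (ip (u i) f * ip (u i) f))"
    using lC by (intro sum_mono mult_right_mono) auto
  also have "\<dots> = C * ip f f"
    using Parseval[of u f f] u by (simp add: eigenbasis_def sum_distrib_left)
  finally show ?thesis .
qed

text \<open>Chebyshev's correlation inequality for the spectral measure of \<open>v\<close>:
  \<open>l ^ i\<close> and \<open>l ^ j\<close> are both increasing on the nonnegative spectrum,
  hence positively correlated.\<close>

lemma ip_funpow_mult_le:
  assumes A: "selfadj A" "\<And>f. 0 \<le> ip f (app n A f)"
  shows "ip v ((app n A ^^ i) v) * ip v ((app n A ^^ j) v) \<le> ip v v * ip v ((app n A ^^ (i + j)) v)"
proof -
  obtain u l where u: "eigenbasis A u l" using spectral_theorem[OF A(1)] by blast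
  have l: "0 \<le> l i" if "i < n" for i using eigenvalue_ge[OF u, of 0] A(2) that by simp
  define s where "s k = ip (u k) v * ip (u k) v" for k
  have s: "0 \<le> s k" for k by (simp add: s_def)
  have a: "ip v ((app n A ^^ i) v) = (\<Sum>k<n. l k ^ i * s k)" for i
    using ip_funpow[OF A(1) u, of v i v] by (simp add: s_def mult_ac)
  have a0: "ip v v = (\<Sum>k<n. s k)" using a[of 0] by simp
  have prod: "(\<Sum>k<n. f k * s k) * (\<Sum>m<n. g m * s m) = (\<Sum>k<n. \<Sum>m<n. s k * s m * (f k * g m))"
    for f g :: "nat \<Rightarrow> real"
    unfolding sum_product by (intro sum.cong refl) (simp add: mult_ac)
  have swap: "(\<Sum>k<n. \<Sum>m<n. s k * s m * h m k) = (\<Sum>k<n. \<Sum>m<n. s k * s m * h k m)" for h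
    by (subst sum.swap) (intro sum.cong refl, simp)
  have "2 * ((\<Sum>k<n. l k ^ i * s k) * (\<Sum>k<n. l k ^ j * s k))
      = (\<Sum>k<n. \<Sum>m<n. s k * s m * (l k ^ i * l m ^ j + l m ^ i * l k ^ j))"
    using swap[of "\<lambda>k m. l k ^ i * l m ^ j"]
    by (simp add: prod distrib_left sum.distrib)
  also have "\<dots> \<le> (\<Sum>k<n. \<Sum>m<n. s k * s m * (l k ^ (i + j) + l m ^ (i + j)))"
    using l s power_rearrange_le by (intro sum_mono mult_left_mono) auto
  also have "\<dots> = 2 * ((\<Sum>k<n. s k) * (\<Sum>k<n. l k ^ (i + j) * s k))"
    using swap[of "\<lambda>k m. l k ^ (i + j)"] prod[of "\<lambda>_. 1" "\<lambda>m. l m ^ (i + j)"]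
    by (simp add: distrib_left sum.distrib)
  finally show ?thesis by (simp add: a a0)
qed

text \<open>Expanding one factor \<open>A = B + rank1 v\<close> at a time expresses \<open>A ^ q\<close> through powers of \<open>B\<close>.\<close>

lemma rank1_update_form:
  assumes A: "selfadj A" and B: "selfadj B"
    and AB: "\<And>f x. x < n \<Longrightarrow> app n A f x = app n B f x + ip v f * v x"
    and psd: "\<And>f. 0 \<le> ip f (app n B f)" and c: "0 < c" "\<And>f. c * ip f f \<le> ip f (app n A f)"
    and R: "ip v v \<le> R" and e: "real q * R \<le> e * c"
  shows "(1 - e) * ip v ((app n A ^^ q) v) \<le> ip v ((app n B ^^ q) v)"
proof -
  define a where "a i = ip v ((app n A ^^ i) v)" for i
  define b where "b i = ip v ((app n B ^^ i) v)" for i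
  \<comment> \<open>A general \<open>j\<close> is needed for the induction: self-adjointness moves
    each split-off factor \<open>B\<close> to the left argument, which raises \<open>j\<close> by
    one.\<close>
  have expand: "ip ((app n B ^^ j) v) ((app n A ^^ i) v) = b (j + i) + (\<Sum>k<i. b (j + k) * a (i - 1 - k))"
    for i j
  proof (induction i arbitrary: j)
    case 0
    show ?case by (simp add: b_def ip_commute)
  next
    case (Suc i)
    let ?f = "(app n B ^^ j) v" and ?g = "(app n A ^^ i) v"
    have "ip ?f ((app n A ^^ Suc i) v) = ip ?f (\<lambda>x. app n B ?g x + ip v ?g * v x)"
      using AB by (intro ip_cong) auto
    also have "\<dots> = ip ((app n B ^^ Suc j) v) ?g + a i * b j"
      by (simp add: ip_add_right ip_scale_right ip_app_left[OF B] a_def b_def ip_commute[of ?f v])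
    also have "\<dots> = b (j + Suc i) + (\<Sum>k<Suc i. b (j + k) * a (Suc i - 1 - k))"
      unfolding Suc.IH sum.lessThan_Suc_shift by simp
    finally show ?case .
  qed
  have expand0: "a q = b q + (\<Sum>k<q. b k * a (q - 1 - k))" for q
    using expand[of 0 q] by (simp add: a_def)
  obtain u l where u: "eigenbasis A u l" using spectral_theorem[OF A] by blast
  have l: "c \<le> l i" if "i < n" for i using eigenvalue_ge[OF u] c(2) that by simp
  have psdA: "0 \<le> ip f (app n A f)" for f
    using c(2)[of f] c(1) ip_nonneg[of f] by (meson less_imp_le mult_nonneg_nonneg order_trans)
  have a_eq: "a i = (\<Sum>k<n. l k ^ i * (ip (u k) v * ip (u k) v))" for i
    unfolding a_def using ip_funpow[OF A u, of v i v] by (simp add: mult_ac)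
  have a_nonneg: "0 \<le> a i" for i
  proof -
    have "0 \<le> l k" if "k < n" for k using l[OF that] c(1) by simp
    then show ?thesis unfolding a_eq by (intro sum_nonneg) simp
  qed
  obtain u' l' where u': "eigenbasis B u' l'" using spectral_theorem[OF B] by blast
  have l': "0 \<le> l' i" if "i < n" for i using eigenvalue_ge[OF u', of 0] psd that by simp
  have b_nonneg: "0 \<le> b i" for i
    unfolding b_def ip_funpow[OF B u'] mult.assoc using l'
    by (intro sum_nonneg mult_nonneg_nonneg[OF zero_le_power]) auto
  have ba: "b i \<le> a i" for i
    unfolding expand0[of i] using a_nonneg b_nonneg by (simp add: sum_nonneg)
  have a_Suc: "c * a i \<le> a (Suc i)" for i
  proof -
    have "0 \<le> l k" if "k < n" for k using l[OF that] c(1) by simp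
    then have "(c * l k ^ i) * (ip (u k) v * ip (u k) v) \<le> l k ^ Suc i * (ip (u k) v * ip (u k) v)"
      if "k < n" for k
      using l[OF that] that by (intro mult_right_mono) (auto intro: mult_right_mono)
    then show ?thesis unfolding a_eq sum_distrib_left mult.assoc[symmetric] by (intro sum_mono) auto
  qed
  have "a q - b q \<le> e * a q"
  proof (cases q)
    case 0
    then have "a q = b q" by (simp add: a_def b_def)
    moreover have "0 \<le> e" using e c(1) 0 by (simp add: zero_le_mult_iff)
    ultimately show ?thesis using a_nonneg[of q] by simp
  next
    case (Suc m)
    \<comment> \<open>There are \<open>q\<close> error terms, each at most \<open>R * a m\<close> by
      the correlation inequality. Since \<open>q * R \<le> e * c\<close> and
      \<open>c * a m \<le> a (Suc m)\<close>, together they amount to at most a fraction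
      \<open>e\<close> of \<open>a q\<close>.\<close>
    have "a q - b q = (\<Sum>k<q. b k * a (m - k))" using expand0[of q] Suc by simp
    also have "\<dots> \<le> (\<Sum>k<q. R * a m)"
    proof (intro sum_mono)
      fix k assume "k \<in> {..<q}"
      then have "b k * a (m - k) \<le> a k * a (m - k)" using ba a_nonneg by (intro mult_right_mono) auto
      also have "\<dots> \<le> ip v v * a m"
        using ip_funpow_mult_le[OF A psdA, of v k "m - k"] \<open>k \<in> _\<close> Suc by (simp add: a_def)
      also have "\<dots> \<le> R * a m" using R a_nonneg by (intro mult_right_mono) auto
      finally show "b k * a (m - k) \<le> R * a m" .
    qed
    also have "\<dots> = (real q * R) * a m" by simp
    also have "\<dots> \<le> (e * c) * a m" using e a_nonneg by (intro mult_right_mono) auto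
    also have "\<dots> = e * (c * a m)" by simp
    also have "\<dots> \<le> e * a q"
    proof -
      have "0 \<le> R" using R ip_nonneg[of v] by linarith
      then have "0 \<le> e * c" using e by (meson mult_nonneg_nonneg of_nat_0_le_iff order_trans)
      then have "0 \<le> e" using c(1) by (simp add: zero_le_mult_iff)
      then show ?thesis using a_Suc[of m] Suc by (intro mult_left_mono) auto
    qed
    finally show ?thesis .
  qed
  then show ?thesis by (simp add: a_def b_def algebra_simps)
qed

text \<open>Shift by the mean of the rank one updates first, then subtract one of them: Klein's inequality
  is used once for each of the two steps, and \<open>rank1_update_form\<close> makes up for evaluating
  the derivative at the wrong point.\<close>

lemma trpow_supermartingale_step:
  fixes v :: "nat \<Rightarrow> nat \<Rightarrow> real" and q :: "nat \<Rightarrow> real"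
  assumes W: "selfadj W" "\<And>f. c * ip f f \<le> ip f (app n W f)"
    and q: "\<And>z. z \<in> I \<Longrightarrow> 0 \<le> q z" "(\<Sum>z\<in>I. q z) = 1"
    and v: "\<And>z. z \<in> I \<Longrightarrow> ip (v z) (v z) \<le> R"
    and R: "0 < R" "R \<le> c" and e: "e \<le> 1" "real N * R \<le> e * c"
  defines "K \<equiv> \<lambda>x y. W x y + (1 - e) * (\<Sum>z\<in>I. q z * rank1 (v z) x y)"
  shows "(\<Sum>z\<in>I. q z * trpow (\<lambda>x y. K x y - rank1 (v z) x y) N) \<le> trpow W N"
proof -
  let ?M = "\<lambda>x y. \<Sum>z\<in>I. q z * rank1 (v z) x y"
  have c: "0 < c" using R by linarith
  have app_M: "app n ?M f = (\<lambda>x. \<Sum>z\<in>I. q z * (ip (v z) f * v z x))" for f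
  proof
    fix x
    have "app n ?M f x = (\<Sum>y<n. \<Sum>z\<in>I. q z * (rank1 (v z) x y * f y))"
      by (simp add: app_def sum_distrib_left sum_distrib_right mult_ac)
    also have "\<dots> = (\<Sum>z\<in>I. q z * app n (rank1 (v z)) f x)"
      by (subst sum.swap) (simp add: app_def sum_distrib_left mult_ac)
    finally show "app n ?M f x = (\<Sum>z\<in>I. q z * (ip (v z) f * v z x))" by (simp add: app_rank1)
  qed
  have app_K: "app n K f = (\<lambda>x. app n W f x + (1 - e) * app n ?M f x)" for f
    unfolding K_def by (rule app_kernel_add)
  have form_M: "0 \<le> ip f (app n ?M f)" for f
  proof -
    have "ip f (app n ?M f) = (\<Sum>z\<in>I. q z * (ip (v z) f * ip (v z) f))"
      by (simp add: app_M ip_sum_right ip_scale_right ip_commute[of f])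
    then show ?thesis using q by (simp add: sum_nonneg)
  qed
  have form_K: "c * ip f f \<le> ip f (app n K f)" for f
  proof -
    have "0 \<le> (1 - e) * ip f (app n ?M f)" using form_M[of f] e(1) by (intro mult_nonneg_nonneg) auto
    then show ?thesis using W(2)[of f] by (simp only: app_K ip_add_right ip_scale_right)
  qed
  have psd_K: "0 \<le> ip f (app n K f)" and psd_W: "0 \<le> ip f (app n W f)" for f
    using form_K[of f] W(2)[of f] c ip_nonneg[of f] mult_nonneg_nonneg[of c "ip f f"] by linarith+
  have selfadj_K: "selfadj K"
  proof -
    have "w x * rank1 (v z) x y = w y * rank1 (v z) y x" if "x < n" "y < n" for x y z
      using selfadj_rank1[of "v z"] that by (simp add: selfadj_def)
    then have "w x * ?M x y = w y * ?M y x" if "x < n" "y < n" for x y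
      using that by (auto simp: sum_distrib_left mult.left_commute[of _ "q _"] intro!: sum.cong)
    then show ?thesis using W(1)
      by (simp add: selfadj_def K_def distrib_left mult.left_commute[of _ "1 - e"])
  qed
  have step: "trpow (\<lambda>x y. K x y - rank1 (v z) x y) N
      \<le> trpow K N - real N * ((1 - e) * trmix K (N - 1) (rank1 (v z)))" if z: "z \<in> I" for z
  proof -
    let ?W = "\<lambda>x y. K x y - rank1 (v z) x y"
    have app_W: "app n ?W f = (\<lambda>x. app n K f x - ip (v z) f * v z x)" for f
      using app_rank1[of "v z" f] by (auto simp: app_def left_diff_distrib sum_subtractf fun_eq_iff)
    have sW: "selfadj ?W"
      using selfadj_K selfadj_rank1[of "v z"] by (simp add: selfadj_def right_diff_distrib)
    have pW: "0 \<le> ip f (app n ?W f)" for f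
    proof -
      have "(ip (v z) f)\<^sup>2 \<le> ip (v z) (v z) * ip f f" by (rule Cauchy_Schwarz)
      also have "\<dots> \<le> c * ip f f" using v[OF z] R ip_nonneg by (intro mult_right_mono) auto
      also have "\<dots> \<le> ip f (app n K f)" by (rule form_K)
      finally show ?thesis
        by (simp add: app_W ip_diff_right ip_scale_right ip_commute[of f] power2_eq_square)
    qed
    have "trpow ?W N + real N * trmix ?W (N - 1) (rank1 (v z)) \<le> trpow K N"
      using Klein_inequality[OF sW pW selfadj_K psd_K, of N] by simp
    \<comment> \<open>Klein's inequality has produced the derivative at the operator after the
      subtraction, which varies with \<open>z\<close>. Replacing it by the derivative at
      \<open>K\<close> makes averaging over \<open>z\<close> possible and costs the factor
      \<open>1 - e\<close>.\<close>
    moreover have "(1 - e) * ip (v z) ((app n K ^^ (N - 1)) (v z)) \<le> ip (v z) ((app n ?W ^^ (N - 1)) (v z))"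
    proof (rule rank1_update_form[OF selfadj_K sW _ pW c form_K v[OF z]])
      show "real (N - 1) * R \<le> e * c"
        using e(2) R(1) mult_right_mono[of "real (N - 1)" "real N" R] by linarith
    qed (simp add: app_W)
    then have "real N * ((1 - e) * trmix K (N - 1) (rank1 (v z)))
        \<le> real N * trmix ?W (N - 1) (rank1 (v z))"
      by (intro mult_left_mono) (simp_all add: trmix_rank1[OF selfadj_K] trmix_rank1[OF sW])
    ultimately show ?thesis by linarith
  qed
  have "(\<Sum>z\<in>I. q z * trpow (\<lambda>x y. K x y - rank1 (v z) x y) N)
      \<le> (\<Sum>z\<in>I. q z * (trpow K N - real N * ((1 - e) * trmix K (N - 1) (rank1 (v z)))))"
    using step q(1) by (intro sum_mono mult_left_mono) auto
  also have "\<dots> = (\<Sum>z\<in>I. q z) * trpow K N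
      - real N * ((1 - e) * (\<Sum>z\<in>I. q z * trmix K (N - 1) (rank1 (v z))))"
    by (simp add: right_diff_distrib sum_subtractf sum_distrib_left sum_distrib_right mult_ac)
  \<comment> \<open>The shift from \<open>W\<close> to \<open>K\<close> is \<open>1 - e\<close>
    times the mean update, so the averaged loss is precisely the tangent term at \<open>K\<close> in
    the direction \<open>W - K\<close>. The second use of Klein's inequality ends the
    estimate.\<close>
  also have "\<dots> = trpow K N + real N * trmix K (N - 1) (\<lambda>x y. W x y - K x y)"
  proof -
    have "(\<lambda>x y. W x y - K x y) = (\<lambda>x y. - (1 - e) * (\<Sum>z\<in>I. q z * rank1 (v z) x y))"
      by (simp add: K_def fun_eq_iff algebra_simps)
    then have eq: "trmix K (N - 1) (\<lambda>x y. W x y - K x y)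
        = - (1 - e) * (\<Sum>z\<in>I. q z * trmix K (N - 1) (rank1 (v z)))"
      by (simp only: trmix_scale[OF selfadj_K] trmix_sum[OF selfadj_K])
    show ?thesis unfolding eq q(2) by (simp add: algebra_simps)
  qed
  also have "\<dots> \<le> trpow W N" by (rule Klein_inequality[OF selfadj_K psd_K W(1) psd_W])
  finally show ?thesis .
qed

end

section \<open>Path laws of Markov chains\<close>

definition paths :: "nat \<Rightarrow> nat \<Rightarrow> nat list set" where
  "paths n t = {xs. length xs = Suc t \<and> set xs \<subseteq> {..<n}}"

text \<open>A path in \<open>paths n t\<close> has \<open>t\<close> transitions. A statistic of
  states alone, such as a visit count, is read off at the departure states and so omits the last
  state.\<close>

definition pathsum :: "(nat \<Rightarrow> nat \<Rightarrow> real) \<Rightarrow> nat list \<Rightarrow> real" where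
  "pathsum u xs = (\<Sum>s<length xs - 1. u (xs ! s) (xs ! Suc s))"

lemma finite_paths [simp]: "finite (paths n t)"
  using finite_lists_length_eq[of "{..<n}" "Suc t"] by (simp add: paths_def conj_commute)

lemma paths_nth: "xs \<in> paths n t \<Longrightarrow> s \<le> t \<Longrightarrow> xs ! s < n"
  using nth_mem[of s xs] by (auto simp: paths_def simp del: nth_mem)

lemma paths_last: "xs \<in> paths n t \<Longrightarrow> last xs < n"
  using last_in_set[of xs] by (cases "xs = []") (auto simp: paths_def simp del: last_in_set)

lemma paths_Suc: "paths n (Suc t) = (\<lambda>(xs, y). xs @ [y]) ` (paths n t \<times> {..<n})"
proof (intro equalityI subsetI)
  fix zs assume "zs \<in> paths n (Suc t)"
  then have "zs = butlast zs @ [last zs]" "butlast zs \<in> paths n t" "last zs < n"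
    using in_set_butlastD[of _ zs] paths_last[of zs n] append_butlast_last_id[of zs]
    by (cases "zs = []"; force simp: paths_def simp del: append_butlast_last_id)+
  then show "zs \<in> (\<lambda>(xs, y). xs @ [y]) ` (paths n t \<times> {..<n})"
    by (intro image_eqI[of _ _ "(butlast zs, last zs)"]) auto
qed (auto simp: paths_def)

lemma pathsum_Nil_single [simp]: "pathsum u [x] = 0"
  by (simp add: pathsum_def)

lemma pathsum_snoc: "xs \<noteq> [] \<Longrightarrow> pathsum u (xs @ [y]) = pathsum u xs + u (last xs) y"
proof -
  assume "xs \<noteq> []"
  then obtain k where k: "length xs = Suc k" by (cases xs) auto
  have "pathsum u (xs @ [y]) = (\<Sum>s<k. u ((xs @ [y]) ! s) ((xs @ [y]) ! Suc s))
      + u ((xs @ [y]) ! k) ((xs @ [y]) ! Suc k)"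
    by (simp add: pathsum_def k)
  also have "(\<Sum>s<k. u ((xs @ [y]) ! s) ((xs @ [y]) ! Suc s)) = pathsum u xs"
    unfolding pathsum_def by (intro sum.cong) (auto simp: nth_append k)
  also have "(xs @ [y]) ! k = last xs"
    using \<open>xs \<noteq> []\<close> by (simp add: nth_append last_conv_nth k)
  also have "(xs @ [y]) ! Suc k = y" using k by (simp add: nth_append)
  finally show ?thesis .
qed

lemma pathsum_add: "pathsum (\<lambda>x y. u x y + v x y) xs = pathsum u xs + pathsum v xs"
  by (simp add: pathsum_def sum.distrib)

lemma pathsum_diff: "pathsum (\<lambda>x y. u x y - v x y) xs = pathsum u xs - pathsum v xs"
  by (simp add: pathsum_def sum_subtractf)

lemma pathsum_scale: "pathsum (\<lambda>x y. c * u x y) xs = c * pathsum u xs"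
  by (simp add: pathsum_def sum_distrib_left)

text \<open>For negative \<open>u\<close> the reciprocal of the Taylor bound for
  \<open>exp (- u)\<close> is used. As arbitrarily negative \<open>u\<close> are covered, the moment
  bounds below ask for upper bounds on increments only.\<close>

lemma exp_le_quadratic:
  fixes u :: real
  assumes "u \<le> 1"
  shows "exp u \<le> 1 + u + u\<^sup>2"
proof (cases "0 \<le> u")
  case True
  then show ?thesis using exp_bound assms by blast
next
  case False
  define v where "v = - u"
  have v: "0 < v" using False by (simp add: v_def)
  have "0 < 1 + v + v\<^sup>2 / 2" using v by (simp add: add_pos_nonneg)
  moreover have "1 + v + v\<^sup>2 / 2 \<le> exp v" using v by (intro exp_lower_Taylor_quadratic) simp
  ultimately have "1 / exp v \<le> 1 / (1 + v + v\<^sup>2 / 2)" by (intro frac_le) auto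
  then have "exp u \<le> 1 / (1 + v + v\<^sup>2 / 2)" by (simp add: v_def exp_minus field_simps)
  also have "\<dots> \<le> 1 - v + v\<^sup>2"
  proof -
    have "(1 - v + v\<^sup>2) * (1 + v + v\<^sup>2 / 2) = 1 + v\<^sup>2 / 2 + v ^ 3 / 2 + v ^ 4 / 2"
      by (simp add: field_simps power2_eq_square power3_eq_cube power4_eq_xxxx)
    also have "\<dots> \<ge> 1" using v by simp
    finally show ?thesis using \<open>0 < 1 + v + v\<^sup>2 / 2\<close> by (simp add: divide_le_eq)
  qed
  finally show ?thesis by (simp add: v_def)
qed

section \<open>Path weights, supermartingales and exponential tail bounds\<close>

locale stochastic =
  fixes n :: nat and p :: "nat \<Rightarrow> nat \<Rightarrow> real"
  assumes p_nonneg: "x < n \<Longrightarrow> y < n \<Longrightarrow> 0 \<le> p x y"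
    and p_sum: "x < n \<Longrightarrow> (\<Sum>y<n. p x y) = 1"

text \<open>\<open>Q\<close> weighs finite paths of all lengths at once, with an arbitrary law of
  the first state. Probabilities thereby become finite sums, and measure theory enters only when
  \<open>Q\<close> is instantiated.\<close>

locale path_law = stochastic +
  fixes Q :: "nat list \<Rightarrow> real"
  assumes Q_nonneg: "0 \<le> Q xs"
    and Q_start: "(\<Sum>x<n. Q [x]) = 1"
    and Q_step: "xs \<in> paths n t \<Longrightarrow> y < n \<Longrightarrow> Q (xs @ [y]) = Q xs * p (last xs) y"
begin

definition pr :: "nat \<Rightarrow> (nat list \<Rightarrow> bool) \<Rightarrow> real" where
  "pr t A = (\<Sum>xs | xs \<in> paths n t \<and> A xs. Q xs)"

lemma sum_paths_Suc:
  "(\<Sum>zs\<in>paths n (Suc t). Q zs * F zs)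
    = (\<Sum>xs\<in>paths n t. Q xs * (\<Sum>y<n. p (last xs) y * F (xs @ [y])))"
proof -
  have "(\<Sum>zs\<in>paths n (Suc t). Q zs * F zs)
      = (\<Sum>(xs, y)\<in>paths n t \<times> {..<n}. Q (xs @ [y]) * F (xs @ [y]))"
    unfolding paths_Suc by (subst sum.reindex) (auto simp: inj_on_def case_prod_beta)
  also have "\<dots> = (\<Sum>xs\<in>paths n t. \<Sum>y<n. Q xs * p (last xs) y * F (xs @ [y]))"
    unfolding sum.cartesian_product[symmetric] by (intro sum.cong refl) (simp add: Q_step)
  finally show ?thesis by (simp add: sum_distrib_left mult.assoc)
qed

lemma sum_paths_0: "(\<Sum>zs\<in>paths n 0. F zs) = (\<Sum>x<n. F [x])"
proof -
  have "paths n 0 = (\<lambda>x. [x]) ` {..<n}" by (auto simp: paths_def length_Suc_conv)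
  then show ?thesis by (simp add: sum.reindex inj_on_def)
qed

lemma Q_total: "(\<Sum>xs\<in>paths n t. Q xs) = 1"
proof (induction t)
  case 0
  then show ?case using Q_start by (simp add: sum_paths_0)
next
  case (Suc t)
  have "(\<Sum>y<n. p (last xs) y) = 1" if "xs \<in> paths n t" for xs
    using p_sum[OF paths_last[OF that]] .
  then show ?case using sum_paths_Suc[where t = t and F = "\<lambda>_. 1"] Suc by simp
qed

text \<open>The drift condition is demanded only before time \<open>t\<close>, because the matrix
  barrier is kept positive definite only up to a horizon fixed in advance.\<close>

lemma supermartingale:
  assumes "\<And>s xs. s < t \<Longrightarrow> xs \<in> paths n s \<Longrightarrow> (\<Sum>y<n. p (last xs) y * F (xs @ [y])) \<le> F xs"
    and "\<And>x. x < n \<Longrightarrow> F [x] \<le> C"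
  shows "(\<Sum>xs\<in>paths n t. Q xs * F xs) \<le> C"
  using assms(1)
proof (induction t)
  case 0
  have "(\<Sum>x<n. Q [x] * F [x]) \<le> (\<Sum>x<n. Q [x] * C)"
    using assms(2) Q_nonneg by (intro sum_mono mult_left_mono) auto
  then show ?case using Q_start by (simp add: sum_paths_0 flip: sum_distrib_right)
next
  case (Suc t)
  have "(\<Sum>zs\<in>paths n (Suc t). Q zs * F zs) \<le> (\<Sum>xs\<in>paths n t. Q xs * F xs)"
    unfolding sum_paths_Suc using Suc.prems Q_nonneg by (intro sum_mono mult_left_mono) auto
  also have "\<dots> \<le> C" by (rule Suc.IH, rule Suc.prems) auto
  finally show ?case .
qed

lemma pr_mono: "(\<And>xs. xs \<in> paths n t \<Longrightarrow> A xs \<Longrightarrow> B xs) \<Longrightarrow> pr t A \<le> pr t B"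
  unfolding pr_def using Q_nonneg by (intro sum_mono2) auto

lemma pr_not: "pr t (\<lambda>xs. \<not> A xs) = 1 - pr t A"
proof -
  have "pr t A + pr t (\<lambda>xs. \<not> A xs) = (\<Sum>xs\<in>paths n t. Q xs)"
    unfolding pr_def by (subst sum.union_disjoint[symmetric]) (auto intro!: sum.cong)
  then show ?thesis by (simp add: Q_total)
qed

lemma pr_or: "pr t (\<lambda>xs. A xs \<or> B xs) \<le> pr t A + pr t B"
proof -
  have "pr t (\<lambda>xs. A xs \<or> B xs) = sum Q ({xs \<in> paths n t. A xs} \<union> {xs \<in> paths n t. B xs})"
    unfolding pr_def by (intro sum.cong) auto
  also have "\<dots> \<le> pr t A + pr t B"
    unfolding pr_def using Q_nonneg by (subst sum_Un) (auto intro: sum_nonneg)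
  finally show ?thesis .
qed

lemma pr_ex:
  assumes "finite I"
  shows "pr t (\<lambda>xs. \<exists>i\<in>I. A i xs) \<le> (\<Sum>i\<in>I. pr t (A i))"
  using assms
proof (induction I rule: finite_induct)
  case (insert i I)
  have "pr t (\<lambda>xs. \<exists>i\<in>insert i I. A i xs) \<le> pr t (A i) + pr t (\<lambda>xs. \<exists>i\<in>I. A i xs)"
    using pr_or[of t "A i" "\<lambda>xs. \<exists>i\<in>I. A i xs"] by simp
  then show ?case using insert by simp
qed (simp add: pr_def)

lemma pr_Markov_inequality:
  assumes "(\<Sum>xs\<in>paths n t. Q xs * F xs) \<le> C" "\<And>xs. xs \<in> paths n t \<Longrightarrow> 0 \<le> F xs" "0 < c"
  shows "pr t (\<lambda>xs. c \<le> F xs) \<le> C / c"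
proof -
  have "c * pr t (\<lambda>xs. c \<le> F xs) = (\<Sum>xs | xs \<in> paths n t \<and> c \<le> F xs. Q xs * c)"
    unfolding pr_def by (simp add: sum_distrib_left mult.commute)
  also have "\<dots> \<le> (\<Sum>xs | xs \<in> paths n t \<and> c \<le> F xs. Q xs * F xs)"
    using Q_nonneg by (intro sum_mono mult_left_mono) auto
  also have "\<dots> \<le> (\<Sum>xs\<in>paths n t. Q xs * F xs)"
    using assms(2) Q_nonneg by (intro sum_mono2) auto
  also have "\<dots> \<le> C" by (rule assms(1))
  finally show ?thesis using assms(3) by (simp add: le_divide_eq mult.commute)
qed

lemma pr_exponential:
  assumes "\<And>x. x < n \<Longrightarrow> (\<Sum>y<n. p x y * exp (u x y)) \<le> 1"
  shows "pr t (\<lambda>xs. a \<le> pathsum u xs) \<le> exp (- a)"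
proof -
  have "(\<Sum>xs\<in>paths n t. Q xs * exp (pathsum u xs)) \<le> 1"
  proof (rule supermartingale)
    fix s xs assume xs: "xs \<in> paths n s"
    then have ne: "xs \<noteq> []" and l: "last xs < n"
      using paths_last[OF xs] by (auto simp: paths_def)
    have "(\<Sum>y<n. p (last xs) y * exp (pathsum u (xs @ [y])))
        = exp (pathsum u xs) * (\<Sum>y<n. p (last xs) y * exp (u (last xs) y))"
      by (simp add: pathsum_snoc[OF ne] exp_add sum_distrib_left mult_ac)
    also have "\<dots> \<le> exp (pathsum u xs)" using assms[OF l] by simp
    finally show "(\<Sum>y<n. p (last xs) y * exp (pathsum u (xs @ [y]))) \<le> exp (pathsum u xs)" .
  qed simp
  from pr_Markov_inequality[OF this, of "exp a"]
  show ?thesis by (simp add: exp_minus inverse_eq_divide)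
qed

text \<open>From \<open>exp u \<le> 1 + u + u\<^sup>2\<close> and \<open>1 + k \<le> exp k\<close>.
  The compensator \<open>k\<close> is accumulated along the path instead of being bounded
  beforehand, which is what permits self-bounding arguments.\<close>

lemma pr_Bernstein:
  assumes u: "\<And>x y. x < n \<Longrightarrow> y < n \<Longrightarrow> u x y \<le> 1"
    and m: "\<And>x. x < n \<Longrightarrow> (\<Sum>y<n. p x y * u x y) + (\<Sum>y<n. p x y * (u x y)\<^sup>2) \<le> k x"
  shows "pr t (\<lambda>xs. a \<le> pathsum (\<lambda>x y. u x y - k x) xs) \<le> exp (- a)"
proof (rule pr_exponential)
  fix x assume x: "x < n"
  have "(\<Sum>y<n. p x y * exp (u x y - k x)) = exp (- k x) * (\<Sum>y<n. p x y * exp (u x y))"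
    by (simp add: exp_diff exp_minus divide_inverse sum_distrib_left mult_ac)
  also have "(\<Sum>y<n. p x y * exp (u x y)) \<le> (\<Sum>y<n. p x y * (1 + u x y + (u x y)\<^sup>2))"
    using exp_le_quadratic u x p_nonneg by (intro sum_mono mult_left_mono) auto
  also have "\<dots> = 1 + ((\<Sum>y<n. p x y * u x y) + (\<Sum>y<n. p x y * (u x y)\<^sup>2))"
    by (simp add: distrib_left sum.distrib p_sum[OF x])
  also have "\<dots> \<le> 1 + k x" using m[OF x] by simp
  also have "\<dots> \<le> exp (k x)" by (rule exp_ge_add_one_self)
  finally have "(\<Sum>y<n. p x y * exp (u x y - k x)) \<le> exp (- k x) * exp (k x)" by simp
  then show "(\<Sum>y<n. p x y * exp (u x y - k x)) \<le> 1" by (simp add: exp_minus)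
qed

end

section \<open>Reversible chains\<close>

locale reversible = stochastic n p + weighted n \<pi> for n p and \<pi> :: "nat \<Rightarrow> real" +
  assumes pi_sum: "(\<Sum>x<n. \<pi> x) = 1"
    and detailed_balance: "x < n \<Longrightarrow> y < n \<Longrightarrow> \<pi> x * p x y = \<pi> y * p y x"
begin

text \<open>The carre du champ operator; its mean under \<open>\<pi>\<close> is the Dirichlet
  form.\<close>

definition carre :: "(nat \<Rightarrow> real) \<Rightarrow> nat \<Rightarrow> real" where
  "carre f x = (\<Sum>y<n. p x y * (f y - f x)\<^sup>2) / 2"

definition energy :: "(nat \<Rightarrow> real) \<Rightarrow> real" where
  "energy f = (\<Sum>x<n. \<pi> x * carre f x)"

definition mean :: "(nat \<Rightarrow> real) \<Rightarrow> real" where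
  "mean f = (\<Sum>x<n. \<pi> x * f x)"

lemma selfadj_p: "selfadj p"
  using detailed_balance by (auto simp: selfadj_def)

lemma carre_nonneg: "x < n \<Longrightarrow> 0 \<le> carre f x"
  by (auto simp: carre_def p_nonneg intro!: sum_nonneg mult_nonneg_nonneg)

lemma two_carre: "(\<Sum>y<n. p x y * (f y - f x)\<^sup>2) = 2 * carre f x"
  by (simp add: carre_def)

lemma app_const: "x < n \<Longrightarrow> app n p (\<lambda>_. c) x = c"
  using p_sum[of x] by (simp add: app_def flip: sum_distrib_right)

lemma mean_eq_ip: "mean f = ip (\<lambda>_. 1) f"
  by (simp add: mean_def ip_def)

lemma mean_app: "mean (app n p f) = mean f"
proof -
  have "mean (app n p f) = ip (app n p (\<lambda>_. 1)) f"
    by (simp add: mean_eq_ip ip_app_left[OF selfadj_p])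
  also have "\<dots> = ip (\<lambda>_. 1) f" using app_const[of _ 1] by (intro ip_cong) auto
  finally show ?thesis by (simp add: mean_eq_ip)
qed

lemma mean_funpow: "mean ((app n p ^^ k) f) = mean f"
  by (induction k) (simp_all add: mean_app)

lemma energy_eq: "energy f = ip f f - ip f (app n p f)"
proof -
  have "2 * energy f = (\<Sum>x<n. \<Sum>y<n. \<pi> x * p x y * (f y - f x)\<^sup>2)"
    by (simp add: energy_def sum_distrib_left mult.assoc mult.left_commute[of 2] flip: two_carre)
  also have "\<dots> = (\<Sum>x<n. \<pi> x * (app n p (\<lambda>y. f y * f y) x + f x * f x * app n p (\<lambda>_. 1) x
      - 2 * f x * app n p f x))"
    by (intro sum.cong refl)
      (simp add: app_def sum_distrib_left sum.distrib[symmetric] sum_subtractf[symmetric] power2_eq_square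
        algebra_simps)
  also have "\<dots> = mean (app n p (\<lambda>y. f y * f y)) + mean (\<lambda>y. f y * f y) - 2 * ip f (app n p f)"
    using app_const[of _ 1]
    by (simp add: mean_def ip_def sum_distrib_left sum.distrib[symmetric] sum_subtractf[symmetric]
        algebra_simps)
  also have "\<dots> = 2 * (ip f f - ip f (app n p f))"
    by (simp add: mean_app) (simp add: mean_def ip_def mult.assoc)
  finally show ?thesis by simp
qed

text \<open>The conditional mean minimises the mean square deviation, so centring at
  \<open>f x\<close> instead can only increase it. Conditional variances of martingale increments
  are thus bounded by local energies.\<close>

lemma second_moment_centred_le:
  assumes "x < n"
  shows "(\<Sum>y<n. p x y * (f y - app n p f x)\<^sup>2) \<le> 2 * carre f x"
proof -
  let ?d = "app n p f x - f x"
  have d: "(\<Sum>y<n. p x y * (f y - f x)) = ?d"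
    using p_sum[OF assms] by (simp add: app_def right_diff_distrib sum_subtractf flip: sum_distrib_right)
  have "(\<Sum>y<n. p x y * (f y - app n p f x)\<^sup>2)
      = (\<Sum>y<n. p x y * (f y - f x)\<^sup>2 - 2 * ?d * (p x y * (f y - f x)) + ?d\<^sup>2 * p x y)"
    by (intro sum.cong refl) (simp add: power2_eq_square algebra_simps)
  also have "\<dots> = 2 * carre f x - 2 * ?d * (\<Sum>y<n. p x y * (f y - f x)) + ?d\<^sup>2 * (\<Sum>y<n. p x y)"
    unfolding two_carre[symmetric] sum_distrib_left sum.distrib sum_subtractf ..
  also have "\<dots> = 2 * carre f x - ?d\<^sup>2"
    unfolding d p_sum[OF assms] by (simp add: power2_eq_square)
  finally show ?thesis by simp
qed

lemma sum_centred: "x < n \<Longrightarrow> (\<Sum>y<n. p x y * (f y - app n p f x)) = 0"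
  using p_sum[of x] by (simp add: right_diff_distrib sum_subtractf app_def flip: sum_distrib_right)

lemma abs_app_le:
  assumes "\<And>y. y < n \<Longrightarrow> \<bar>f y\<bar> \<le> c" "x < n"
  shows "\<bar>app n p f x\<bar> \<le> c"
proof -
  have "\<bar>app n p f x\<bar> \<le> (\<Sum>y<n. \<bar>p x y * f y\<bar>)" unfolding app_def by (rule sum_abs)
  also have "\<dots> \<le> (\<Sum>y<n. p x y * c)"
    using assms p_nonneg by (intro sum_mono) (auto simp: abs_mult intro: mult_left_mono)
  also have "\<dots> = c" using p_sum[OF assms(2)] by (simp flip: sum_distrib_right)
  finally show ?thesis .
qed

end

section \<open>Mean-zero contraction and the Poisson equation\<close>

locale gapped = reversible n p \<pi> for n p \<pi> +
  fixes \<gamma> :: real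
  assumes gap_pos: "0 < \<gamma>" and gap_less_1: "\<gamma> < 1"
    and Poincare: "mean f = 0 \<Longrightarrow> \<gamma> * ip f f \<le> energy f"
    and form_nonneg: "0 \<le> ip f (app n p f)"
begin

text \<open>The nonnegative form is tested at \<open>b f - P f\<close> with
  \<open>b = 1 - \<gamma>\<close>; the Poincare inequality for \<open>f\<close> and for
  \<open>P f\<close> then leaves \<open>b * a \<le> b * (b\<^sup>2 * ip f f)\<close>. Nonnegativity
  of the form takes the place of a bound on eigenvalues near \<open>-1\<close>.\<close>

lemma contraction:
  assumes "mean f = 0"
  shows "ip (app n p f) (app n p f) \<le> (1 - \<gamma>)\<^sup>2 * ip f f"
proof -
  define b where "b = 1 - \<gamma>"
  have b: "0 < b" using gap_less_1 by (simp add: b_def)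
  have q: "ip h (app n p h) \<le> b * ip h h" if "mean h = 0" for h
    using Poincare[OF that] by (simp add: energy_eq b_def algebra_simps)
  let ?g = "app n p f"
  define a where "a = ip ?g ?g"
  have "0 \<le> ip (\<lambda>x. b * f x - ?g x) (app n p (\<lambda>x. b * f x - ?g x))" by (rule form_nonneg)
  also have "\<dots> = b\<^sup>2 * ip f ?g - 2 * b * a + ip ?g (app n p ?g)"
    using ip_app_left[OF selfadj_p, of f ?g]
    by (simp add: app_diff app_scale ip_diff_left ip_diff_right ip_scale_left ip_scale_right a_def
        power2_eq_square algebra_simps)
  also have "\<dots> \<le> b\<^sup>2 * (b * ip f f) - 2 * b * a + b * a"
    using q[OF assms] q[of ?g] assms b
    by (intro add_mono diff_mono mult_left_mono) (auto simp: mean_app a_def)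
  finally have "b * a \<le> b * (b\<^sup>2 * ip f f)" by (simp add: algebra_simps)
  then show ?thesis using b by (simp add: a_def b_def)
qed

lemma contraction_funpow:
  assumes "mean f = 0"
  shows "ip ((app n p ^^ k) f) ((app n p ^^ k) f) \<le> ((1 - \<gamma>) ^ k)\<^sup>2 * ip f f"
proof (induction k)
  case (Suc k)
  have "ip ((app n p ^^ Suc k) f) ((app n p ^^ Suc k) f)
      \<le> (1 - \<gamma>)\<^sup>2 * ip ((app n p ^^ k) f) ((app n p ^^ k) f)"
    using contraction[of "(app n p ^^ k) f"] assms by (simp add: mean_funpow)
  also have "\<dots> \<le> (1 - \<gamma>)\<^sup>2 * (((1 - \<gamma>) ^ k)\<^sup>2 * ip f f)" by (intro mult_left_mono Suc) auto
  finally show ?case by (simp add: power_mult_distrib mult.assoc)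
qed simp

text \<open>The solution of the Poisson equation is \<open>(\<Sum>k. P ^ k b)\<close>.  Its first \<open>ln (1 / m) / \<gamma>\<close> terms
  are bounded by one; by then the \<open>L\<^sup>2\<close> contraction has paid for passing to the
  supremum norm.\<close>

lemma Poisson_equation:
  assumes x: "x < n" and m: "0 < m" "m \<le> 1" "\<And>y. y < n \<Longrightarrow> m \<le> \<pi> y"
  shows "\<exists>h. (\<forall>y<n. h y - app n p h y = point x y - \<pi> x) \<and>
    (\<forall>y<n. \<bar>h y\<bar> \<le> (ln (1 / m) + 2) / \<gamma>) \<and> energy h \<le> \<pi> x / \<gamma>"
proof -
  define b where "b y = point x y - \<pi> x" for y
  define B where "B k = (app n p ^^ k) b" for k
  define r where "r = 1 - \<gamma>"
  have r: "0 < r" "r < 1" using gap_pos gap_less_1 by (auto simp: r_def)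
  have pi_x: "0 < \<pi> x" "\<pi> x \<le> 1"
    using w_pos[OF x] pi_sum member_le_sum[of x "{..<n}" \<pi>] x w_pos by (auto simp: less_imp_le)
  have b1: "\<bar>b y\<bar> \<le> 1" for y using pi_x by (auto simp: b_def point_def)
  have mb: "mean b = 0"
  proof -
    have "mean b = ip (point x) (\<lambda>_. 1) - \<pi> x * (\<Sum>y<n. \<pi> y)"
      by (simp add: mean_def ip_def b_def right_diff_distrib sum_subtractf sum_distrib_left mult.commute)
    then show ?thesis by (simp add: ip_point[OF x] pi_sum)
  qed
  have B1: "\<bar>B k y\<bar> \<le> 1" if "y < n" for k y
    using that
  proof (induction k arbitrary: y)
    case (Suc k)
    then show ?case using abs_app_le[of "B k" 1 y] by (simp add: B_def)
  qed (simp add: B_def b1)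
  have ipb: "ip b b \<le> 1"
  proof -
    have "b y * b y \<le> 1" for y using b1[of y] abs_square_le_1[of "b y"] by (simp add: power2_eq_square)
    then have "ip b b \<le> (\<Sum>y<n. \<pi> y * 1)"
      unfolding ip_def mult.assoc using w_pos
      by (intro sum_mono mult_left_mono) (auto simp: less_imp_le)
    then show ?thesis using pi_sum by simp
  qed
  have B2: "\<bar>B k y\<bar> \<le> r ^ k / sqrt m" if "y < n" for k y
  proof -
    have "m * (B k y)\<^sup>2 \<le> \<pi> y * (B k y)\<^sup>2" using m(3)[OF that] by (intro mult_right_mono) auto
    also have "\<dots> \<le> ip (B k) (B k)" by (rule weight_square_le_ip[OF that])
    also have "\<dots> \<le> (r ^ k)\<^sup>2 * ip b b" unfolding B_def r_def by (rule contraction_funpow[OF mb])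
    also have "\<dots> \<le> (r ^ k)\<^sup>2" using mult_left_mono[OF ipb, of "(r ^ k)\<^sup>2"] by simp
    finally have "(B k y)\<^sup>2 \<le> (r ^ k / sqrt m)\<^sup>2" using m(1) by (simp add: power_divide field_simps)
    then have "\<bar>B k y\<bar> \<le> \<bar>r ^ k / sqrt m\<bar>" by (simp only: abs_le_square_iff)
    then show ?thesis using r m(1) by simp
  qed
  have sumB: "summable (\<lambda>k. \<bar>B k y\<bar>)" if "y < n" for y
    using B2[OF that] r
    by (intro summable_comparison_test'[OF summable_divide[OF summable_geometric[of r], of "sqrt m"], of 0]) auto
  define h where "h y = (\<Sum>k. B k y)" for y
  have sums_h: "(\<lambda>k. B k y) sums h y" if "y < n" for y
    unfolding h_def by (rule summable_sums[OF summable_rabs_cancel[OF sumB[OF that]]])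
  have eq: "h y - app n p h y = point x y - \<pi> x" if "y < n" for y
  proof -
    have "(\<lambda>k. B (Suc k) y) sums app n p h y"
    proof -
      have "(\<lambda>k. app n p (B k) y) sums app n p h y"
        unfolding app_def by (intro sums_sum sums_mult sums_h) simp
      then show ?thesis by (simp add: B_def)
    qed
    moreover have "(\<lambda>k. B (Suc k) y) sums (h y - B 0 y)"
      using sums_h[OF that] sums_Suc_iff[of "\<lambda>k. B k y" "h y - B 0 y"] by simp
    ultimately have "app n p h y = h y - B 0 y" by (rule sums_unique2)
    then show ?thesis by (simp add: B_def b_def)
  qed
  have mh: "mean h = 0"
  proof -
    have "(\<lambda>k. mean (B k)) sums mean h" unfolding mean_def
      by (intro sums_sum sums_mult sums_h) simp
    moreover have "(\<lambda>k. mean (B k)) = (\<lambda>_. 0)" by (simp add: B_def mean_funpow mb)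
    ultimately have "(\<lambda>_. 0) sums mean h" by simp
    then show ?thesis by (rule sums_unique2[OF _ sums_zero])
  qed
  have energy_h: "energy h = \<pi> x * h x"
  proof -
    have "energy h = ip h (\<lambda>y. h y - app n p h y)" by (simp add: energy_eq ip_diff_right)
    also have "\<dots> = ip h (\<lambda>y. point x y - \<pi> x * 1)" unfolding mult_1_right by (intro ip_cong refl eq)
    also have "\<dots> = \<pi> x * h x - \<pi> x * ip h (\<lambda>_. 1)"
      by (simp only: ip_diff_right ip_scale_right ip_commute[of h "point x"] ip_point[OF x])
    also have "ip h (\<lambda>_. 1) = 0" using mh unfolding mean_eq_ip by (subst ip_commute)
    finally show ?thesis by simp
  qed
  \<comment> \<open>The energy of \<open>h\<close> is \<open>\<pi> x * h x\<close>, and the Poincare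
    inequality, restricted to the single state \<open>x\<close>, makes this self-bounding. The
    energy bound therefore carries no logarithm, unlike the supremum bound.\<close>
  have "\<gamma> * (h x * h x) \<le> h x"
  proof -
    have "\<pi> x * (\<gamma> * (h x * h x)) \<le> \<gamma> * ip h h"
      using weight_square_le_ip[OF x, of h] gap_pos by (simp add: power2_eq_square mult_ac)
    also have "\<dots> \<le> \<pi> x * h x" using Poincare[OF mh] energy_h by simp
    finally show ?thesis using pi_x by simp
  qed
  then have "h x \<le> 1 / \<gamma>"
  proof (cases "0 < h x")
    case True
    then show ?thesis using \<open>\<gamma> * (h x * h x) \<le> h x\<close> gap_pos by (simp add: le_divide_eq mult_ac)
  next
    case False
    then show ?thesis using gap_pos by (smt (verit) divide_pos_pos)
  qed
  then have "energy h \<le> \<pi> x / \<gamma>" using pi_x gap_pos by (simp add: energy_h field_simps)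
  moreover have "\<bar>h y\<bar> \<le> (ln (1 / m) + 2) / \<gamma>" if y: "y < n" for y
  proof -
    \<comment> \<open>Chosen so that \<open>r ^ T \<le> m \<le> sqrt m\<close>, after which the
      remaining series is geometric with sum at most \<open>1 / \<gamma>\<close>. That tail and the
      rounding of \<open>T\<close> account for the \<open>2\<close> in the bound, since
      \<open>1 \<le> 1 / \<gamma>\<close>.\<close>
    define T where "T = nat \<lceil>ln (1 / m) / \<gamma>\<rceil>"
    have lnm: "0 \<le> ln (1 / m)" using m(1,2) by (intro ln_ge_zero) simp
    have T: "ln (1 / m) / \<gamma> \<le> real T" "real T \<le> ln (1 / m) / \<gamma> + 1"
    proof -
      show "ln (1 / m) / \<gamma> \<le> real T" unfolding T_def by (rule real_nat_ceiling_ge)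
      have "0 \<le> ln (1 / m) / \<gamma>" by (rule divide_nonneg_pos[OF lnm gap_pos])
      then have "0 \<le> \<lceil>ln (1 / m) / \<gamma>\<rceil>" by (simp only: zero_le_ceiling)
      then have "real T = of_int \<lceil>ln (1 / m) / \<gamma>\<rceil>" unfolding T_def by (rule of_nat_nat)
      then show "real T \<le> ln (1 / m) / \<gamma> + 1"
        using of_int_ceiling_le_add_one[of "ln (1 / m) / \<gamma>"] by (simp only:)
    qed
    have "r ^ T \<le> exp (- \<gamma>) ^ T" using r exp_ge_add_one_self[of "- \<gamma>"]
      by (intro power_mono) (auto simp: r_def)
    also have "\<dots> = exp (real T * - \<gamma>)" by (rule exp_of_nat_mult[symmetric])
    also have "\<dots> \<le> exp (- ln (1 / m))" using T(1) gap_pos by (simp add: pos_divide_le_eq)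
    also have "\<dots> = m" using m(1,2) by (simp add: ln_div)
    also have "\<dots> \<le> sqrt m" using m(1,2) mult_left_le[of m m] by (intro real_le_rsqrt) (simp add: power2_eq_square)
    finally have rT: "r ^ T \<le> sqrt m" .
    have sh: "summable (\<lambda>k. \<bar>B (k + T) y\<bar>)" using sumB[OF y] by (rule summable_ignore_initial_segment)
    have "\<bar>h y\<bar> \<le> (\<Sum>k. \<bar>B k y\<bar>)" unfolding h_def by (rule summable_rabs[OF sumB[OF y]])
    also have "\<dots> = (\<Sum>k. \<bar>B (k + T) y\<bar>) + (\<Sum>k<T. \<bar>B k y\<bar>)"
      by (rule suminf_split_initial_segment[OF sumB[OF y]])
    finally have split: "\<bar>h y\<bar> \<le> (\<Sum>k. \<bar>B (k + T) y\<bar>) + (\<Sum>k<T. \<bar>B k y\<bar>)" .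
    have "\<bar>B (k + T) y\<bar> \<le> r ^ k" for k
    proof -
      have "\<bar>B (k + T) y\<bar> \<le> r ^ k * (r ^ T / sqrt m)" using B2[OF y, of "k + T"] by (simp add: power_add)
      also have "\<dots> \<le> r ^ k * 1" using rT m(1) r by (intro mult_left_mono) auto
      finally show ?thesis by simp
    qed
    then have "(\<Sum>k. \<bar>B (k + T) y\<bar>) \<le> (\<Sum>k. r ^ k)"
      using r by (intro suminf_le[OF _ sh] summable_geometric) simp_all
    also have "\<dots> = 1 / (1 - r)" using r by (intro suminf_geometric) simp
    also have "\<dots> = 1 / \<gamma>" by (simp add: r_def)
    finally have tail: "(\<Sum>k. \<bar>B (k + T) y\<bar>) \<le> 1 / \<gamma>" .
    have head: "(\<Sum>k<T. \<bar>B k y\<bar>) \<le> real T"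
    proof -
      have "(\<Sum>k<T. \<bar>B k y\<bar>) \<le> (\<Sum>k<T. 1)" by (rule sum_mono) (rule B1[OF y])
      then show ?thesis by simp
    qed
    have "1 \<le> 1 / \<gamma>" using gap_pos gap_less_1 by simp
    then have "\<bar>h y\<bar> \<le> ln (1 / m) / \<gamma> + 2 * (1 / \<gamma>)" using split tail head T(2) by linarith
    then show ?thesis by (simp add: add_divide_distrib)
  qed
  ultimately show ?thesis using eq by (intro exI[of _ h]) simp
qed

end

section \<open>Concentration along the path\<close>

definition visits :: "nat \<Rightarrow> nat list \<Rightarrow> real" where
  "visits x = pathsum (\<lambda>a b. point x a)"

definition emp_energy :: "(nat \<Rightarrow> real) \<Rightarrow> nat list \<Rightarrow> real" where
  "emp_energy f xs = pathsum (\<lambda>a b. (f b - f a)\<^sup>2) xs / 2"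

lemma pathsum_cong:
  assumes "xs \<in> paths n t" "\<And>a b. a < n \<Longrightarrow> b < n \<Longrightarrow> u a b = v a b"
  shows "pathsum u xs = pathsum v xs"
  unfolding pathsum_def using assms(1) paths_nth[OF assms(1)]
  by (intro sum.cong refl assms(2)) (auto simp: paths_def)

lemma pathsum_mono:
  assumes "xs \<in> paths n t" "\<And>a b. a < n \<Longrightarrow> b < n \<Longrightarrow> u a b \<le> v a b"
  shows "pathsum u xs \<le> pathsum v xs"
  unfolding pathsum_def using assms(1) paths_nth[OF assms(1)]
  by (intro sum_mono assms(2)) (auto simp: paths_def)

lemma pathsum_nonneg: "(\<And>a b. 0 \<le> u a b) \<Longrightarrow> 0 \<le> pathsum u xs"
  unfolding pathsum_def by (intro sum_nonneg) auto

lemma pathsum_const: "xs \<in> paths n t \<Longrightarrow> pathsum (\<lambda>_ _. c) xs = real t * c"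
  by (simp add: pathsum_def paths_def)

lemma pathsum_telescope:
  assumes "xs \<in> paths n t"
  shows "pathsum (\<lambda>a b. f b - f a) xs = f (xs ! t) - f (xs ! 0)"
  using assms sum_lessThan_telescope[of "\<lambda>s. f (xs ! s)" t] by (simp add: pathsum_def paths_def)

lemma visits_nonneg: "0 \<le> visits x xs"
  unfolding visits_def by (intro pathsum_nonneg) (simp add: point_def)

lemma pathsum_visits:
  assumes "xs \<in> paths n t"
  shows "pathsum (\<lambda>a b. F a) xs = (\<Sum>x<n. visits x xs * F x)"
proof -
  have "pathsum (\<lambda>a b. F a) xs = pathsum (\<lambda>a b. \<Sum>x<n. point x a * F x) xs"
  proof (rule pathsum_cong[OF assms])
    fix a b assume "a < n"
    have "(\<Sum>x<n. point x a * F x) = (\<Sum>x<n. if x = a then F a else 0)"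
      by (intro sum.cong) (auto simp: point_def)
    then show "F a = (\<Sum>x<n. point x a * F x)" using \<open>a < n\<close> by simp
  qed
  also have "\<dots> = (\<Sum>x<n. visits x xs * F x)"
    unfolding pathsum_def visits_def sum_distrib_right by (rule sum.swap)
  finally show ?thesis .
qed

locale reversible_path = reversible n p \<pi> + path_law n p Q for n p \<pi> Q
begin

text \<open>The sign \<open>\<sigma>\<close> serves both tails. The variance term stays a sum of
  \<open>carre h\<close> along the path, so it can later be expressed through the visit
  counts.\<close>

lemma pr_martingale:
  assumes "\<And>x y. x < n \<Longrightarrow> y < n \<Longrightarrow> \<theta> * \<bar>h y - app n p h x\<bar> \<le> 1" "0 \<le> \<theta>" "\<sigma>\<^sup>2 = 1"
  shows "pr t (\<lambda>xs. a \<le> pathsum (\<lambda>x y. \<sigma> * \<theta> * (h y - app n p h x) - 2 * \<theta>\<^sup>2 * carre h x) xs) \<le> exp (- a)"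
proof (rule pr_Bernstein)
  fix x y assume xy: "x < n" "y < n"
  have "\<bar>\<sigma>\<bar> = 1" using assms(3) by (metis power2_eq_1_iff abs_1 abs_minus_cancel)
  then have "\<sigma> * \<theta> * (h y - app n p h x) \<le> \<theta> * \<bar>h y - app n p h x\<bar>"
    using assms(2) abs_ge_self[of "\<sigma> * \<theta> * (h y - app n p h x)"] by (simp add: abs_mult)
  then show "\<sigma> * \<theta> * (h y - app n p h x) \<le> 1" using assms(1)[OF xy] by linarith
next
  fix x assume x: "x < n"
  have "(\<Sum>y<n. p x y * (\<sigma> * \<theta> * (h y - app n p h x))) = \<sigma> * \<theta> * (\<Sum>y<n. p x y * (h y - app n p h x))"
    by (simp add: sum_distrib_left mult_ac)
  moreover have "(\<Sum>y<n. p x y * (\<sigma> * \<theta> * (h y - app n p h x))\<^sup>2)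
      = \<theta>\<^sup>2 * (\<Sum>y<n. p x y * (h y - app n p h x)\<^sup>2)"
    by (simp add: sum_distrib_left mult_ac power_mult_distrib assms(3))
  moreover have "\<theta>\<^sup>2 * (\<Sum>y<n. p x y * (h y - app n p h x)\<^sup>2) \<le> \<theta>\<^sup>2 * (2 * carre h x)"
    by (intro mult_left_mono second_moment_centred_le x) simp
  ultimately show "(\<Sum>y<n. p x y * (\<sigma> * \<theta> * (h y - app n p h x)))
      + (\<Sum>y<n. p x y * (\<sigma> * \<theta> * (h y - app n p h x))\<^sup>2) \<le> 2 * \<theta>\<^sup>2 * carre h x"
    by (simp add: sum_centred[OF x] mult.left_commute)
qed

end

subsection \<open>The empirical energy form\<close>

context reversible_path
begin

text \<open>The Riesz representer of \<open>f \<mapsto> f y - f x\<close> for \<open>ip\<close>: a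
  transition from \<open>x\<close> to \<open>y\<close> adds the form of
  \<open>rank1 (jump x y)\<close> to twice the empirical energy.\<close>

definition jump :: "nat \<Rightarrow> nat \<Rightarrow> nat \<Rightarrow> real" where
  "jump x y = (\<lambda>z. point y z / \<pi> y - point x z / \<pi> x)"

lemma ip_jump: "x < n \<Longrightarrow> y < n \<Longrightarrow> ip (jump x y) f = f y - f x"
proof -
  assume xy: "x < n" "y < n"
  have "jump x y = (\<lambda>z. (1 / \<pi> y) * point y z - (1 / \<pi> x) * point x z)" by (simp add: jump_def)
  then have "ip (jump x y) f = (1 / \<pi> y) * (\<pi> y * f y) - (1 / \<pi> x) * (\<pi> x * f x)"
    by (simp only: ip_diff_left ip_scale_left ip_point xy)
  then show ?thesis using w_pos[OF xy(1)] w_pos[OF xy(2)] by simp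
qed

text \<open>Applying the representer to itself gives \<open>1 / \<pi> x + 1 / \<pi> y\<close> for
  distinct states. This is how the minimal stationary weight enters the matrix bound.\<close>

lemma ip_jump_self_le:
  assumes "x < n" "y < n" "0 < m" "\<And>z. z < n \<Longrightarrow> m \<le> \<pi> z"
  shows "ip (jump x y) (jump x y) \<le> 2 / m"
proof -
  have "1 / \<pi> x \<le> 1 / m" "1 / \<pi> y \<le> 1 / m" using assms by (auto intro: frac_le)
  moreover have "0 < 1 / \<pi> x" "0 < 1 / \<pi> y" using assms w_pos by auto
  moreover have "ip (jump x y) (jump x y) = jump x y y - jump x y x" by (rule ip_jump[OF assms(1,2)])
  ultimately show ?thesis using assms(3) by (cases "x = y") (auto simp: jump_def point_def)
qed

text \<open>\<open>point x y\<close> is the identity kernel. An eigenvalue well above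
  \<open>\<kappa>\<close> signals a function whose observed energy falls short of its discounted
  conditional mean, so bounding the barrier from above bounds the empirical energy from
  below.\<close>

definition barrier :: "real \<Rightarrow> real \<Rightarrow> nat list \<Rightarrow> nat \<Rightarrow> nat \<Rightarrow> real" where
  "barrier \<kappa> e xs = (\<lambda>x y. \<kappa> * point x y
     + pathsum (\<lambda>a b. (1 - e) * (\<Sum>z<n. p a z * rank1 (jump a z) x y) - rank1 (jump a b) x y) xs)"

lemma barrier_snoc:
  "xs \<noteq> [] \<Longrightarrow> barrier \<kappa> e (xs @ [b]) = (\<lambda>x y. (barrier \<kappa> e xs x y
     + (1 - e) * (\<Sum>z<n. p (last xs) z * rank1 (jump (last xs) z) x y)) - rank1 (jump (last xs) b) x y)"
  by (simp add: barrier_def pathsum_snoc fun_eq_iff)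

lemma selfadj_barrier: "selfadj (barrier \<kappa> e xs)"
proof -
  have r: "\<pi> x * rank1 (jump a z) x y = \<pi> y * rank1 (jump a z) y x" for a x y z
    by (simp add: rank1_def)
  have "\<pi> x * ((1 - e) * (\<Sum>z<n. p a z * rank1 (jump a z) x y) - rank1 (jump a b) x y)
      = \<pi> y * ((1 - e) * (\<Sum>z<n. p a z * rank1 (jump a z) y x) - rank1 (jump a b) y x)" for a b x y
  proof -
    have "\<pi> x * (\<Sum>z<n. p a z * rank1 (jump a z) x y) = \<pi> y * (\<Sum>z<n. p a z * rank1 (jump a z) y x)"
      unfolding sum_distrib_left by (intro sum.cong refl) (simp add: r mult.left_commute[of "\<pi> _"])
    then show ?thesis by (simp add: right_diff_distrib r mult.left_commute[of "\<pi> _" "1 - e"])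
  qed
  then have "\<pi> x * pathsum (\<lambda>a b. (1 - e) * (\<Sum>z<n. p a z * rank1 (jump a z) x y) - rank1 (jump a b) x y) xs
      = \<pi> y * pathsum (\<lambda>a b. (1 - e) * (\<Sum>z<n. p a z * rank1 (jump a z) y x) - rank1 (jump a b) y x) xs"
    for x y by (simp only: pathsum_scale[symmetric])
  moreover have "\<pi> x * point x y = \<pi> y * point y x" for x y by (auto simp: point_def)
  ultimately show ?thesis
    unfolding selfadj_def barrier_def by (simp add: distrib_left mult.left_commute[of "\<pi> _" \<kappa>])
qed

lemma barrier_form:
  assumes "xs \<in> paths n t"
  shows "ip f (app n (barrier \<kappa> e xs) f)
    = \<kappa> * ip f f + pathsum (\<lambda>a b. 2 * (1 - e) * carre f a - (f b - f a)\<^sup>2) xs"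
  using assms
proof (induction t arbitrary: xs)
  case 0
  then obtain a where xs: "xs = [a]" by (auto simp: paths_def length_Suc_conv)
  have "app n (barrier \<kappa> e xs) f x = \<kappa> * f x" if "x < n" for x
  proof -
    have "app n (barrier \<kappa> e xs) f x = (\<Sum>y<n. if y = x then \<kappa> * f x else 0)"
      unfolding app_def barrier_def xs by (intro sum.cong) (auto simp: point_def)
    then show ?thesis using that by simp
  qed
  then have "ip f (app n (barrier \<kappa> e xs) f) = ip f (\<lambda>x. \<kappa> * f x)" by (intro ip_cong) auto
  then show ?case by (simp add: ip_scale_right xs)
next
  case (Suc t)
  then obtain ys b where xs: "xs = ys @ [b]" and ys: "ys \<in> paths n t" and b: "b < n"
    by (auto simp: paths_Suc)
  define a where "a = last ys"
  have a: "a < n" using paths_last[OF ys] by (simp add: a_def)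
  have ne: "ys \<noteq> []" using ys by (auto simp: paths_def)
  let ?M = "\<lambda>x y. \<Sum>z<n. p a z * rank1 (jump a z) x y"
  have "app n ?M f = (\<lambda>x. \<Sum>z<n. p a z * (ip (jump a z) f * jump a z x))"
  proof
    fix x
    have "app n ?M f x = (\<Sum>y<n. \<Sum>z<n. p a z * (rank1 (jump a z) x y * f y))"
      by (simp add: app_def sum_distrib_left sum_distrib_right mult_ac)
    also have "\<dots> = (\<Sum>z<n. p a z * app n (rank1 (jump a z)) f x)"
      by (subst sum.swap) (simp add: app_def sum_distrib_left mult_ac)
    finally show "app n ?M f x = (\<Sum>z<n. p a z * (ip (jump a z) f * jump a z x))"
      by (simp add: app_rank1)
  qed
  then have "ip f (app n ?M f) = (\<Sum>z<n. p a z * (ip (jump a z) f * ip (jump a z) f))"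
    by (simp add: ip_sum_right ip_scale_right ip_commute[of f])
  also have "\<dots> = 2 * carre f a"
    unfolding two_carre[symmetric] using a
    by (intro sum.cong refl) (simp add: ip_jump power2_eq_square)
  finally have M: "ip f (app n ?M f) = 2 * carre f a" .
  have r: "ip f (app n (rank1 (jump a b)) f) = (f b - f a)\<^sup>2"
    by (simp add: app_rank1 ip_scale_right ip_commute[of f] ip_jump a b power2_eq_square)
  have "app n (barrier \<kappa> e xs) f
      = (\<lambda>x. (app n (barrier \<kappa> e ys) f x + (1 - e) * app n ?M f x) - app n (rank1 (jump a b)) f x)"
    unfolding xs barrier_snoc[OF ne] a_def[symmetric]
    using app_kernel_add[of n "\<lambda>x y. barrier \<kappa> e ys x y + (1 - e) * ?M x y" "- 1" "rank1 (jump a b)" f]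
      app_kernel_add[of n "barrier \<kappa> e ys" "1 - e" ?M f]
    by simp
  then have "ip f (app n (barrier \<kappa> e xs) f)
      = ip f (app n (barrier \<kappa> e ys) f) + (1 - e) * (2 * carre f a) - (f b - f a)\<^sup>2"
    by (simp only: ip_diff_right ip_add_right ip_scale_right M r)
  then show ?case
    unfolding Suc.IH[OF ys] xs pathsum_snoc[OF ne] a_def[symmetric] by simp
qed

text \<open>The barrier starts at \<open>\<kappa>\<close>, which is taken so large that it stays positive definite along the whole
  path; the trace of its \<open>N\<close>-th power is then a supermartingale, and a large \<open>N\<close> turns it into a bound on
  the largest eigenvalue.\<close>

lemma pr_emp_energy_ge:
  assumes n: "0 < n" and m: "0 < m" "\<And>z. z < n \<Longrightarrow> m \<le> \<pi> z"
    and e: "0 < e" "e \<le> 1" and \<Lambda>: "0 < \<Lambda>"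
  shows "pr t (\<lambda>xs. \<not> (\<forall>f. (1 - e) * (\<Sum>x<n. visits x xs * carre f x)
      - 8 * (\<Lambda> + ln (real n)) / (m * e) * ip f f \<le> emp_energy f xs)) \<le> exp (- \<Lambda>)"
proof -
  define R where "R = 2 / m"
  define \<Lambda>' where "\<Lambda>' = \<Lambda> + ln (real n)"
  have \<Lambda>': "0 < \<Lambda>'" using \<Lambda> n by (simp add: \<Lambda>'_def add_pos_nonneg)
  \<comment> \<open>\<open>N \<ge> t\<close> keeps the barrier positive definite for
    \<open>t\<close> transitions, and \<open>N \<ge> \<Lambda>'\<close> allows
    \<open>exp (\<Lambda>' / N) \<le> 1 + 2 * \<Lambda>' / N\<close>.\<close>
  define N where "N = nat \<lceil>real t + \<Lambda>' + 1\<rceil>"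
  have N: "real t + \<Lambda>' + 1 \<le> real N" unfolding N_def by (rule real_nat_ceiling_ge)
  then have N1: "1 \<le> real N" "\<Lambda>' \<le> real N" "real t \<le> real N" using \<Lambda>' by linarith+
  \<comment> \<open>This makes \<open>N * R \<le> e * c\<close>, the condition of
    \<open>trpow_supermartingale_step\<close>. Starting at \<open>2 * c\<close> leaves
    \<open>c\<close> to spare: a transition lowers the form by at most \<open>R\<close>, and
    \<open>t * R \<le> N * R \<le> c\<close>.\<close>
  define c where "c = real N * R / e"
  define \<kappa> where "\<kappa> = 2 * c"
  have R: "0 < R" using m by (simp add: R_def)
  have cR: "real N * R \<le> c" using R e N1 by (simp add: c_def le_divide_eq mult_left_le)
  have c: "0 < c" using R N1 e by (simp add: c_def)
  have form_ge: "c * ip f f \<le> ip f (app n (barrier \<kappa> e xs) f)" if xs: "xs \<in> paths n s" "s \<le> t" for f xs s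
  proof -
    have "pathsum (\<lambda>_ _. - (R * ip f f)) xs \<le> pathsum (\<lambda>a b. 2 * (1 - e) * carre f a - (f b - f a)\<^sup>2) xs"
    proof (rule pathsum_mono[OF xs(1)])
      fix a b assume ab: "a < n" "b < n"
      have "(f b - f a)\<^sup>2 \<le> ip (jump a b) (jump a b) * ip f f"
        using Cauchy_Schwarz[of "jump a b" f] by (simp add: ip_jump ab)
      also have "\<dots> \<le> R * ip f f" unfolding R_def
        by (intro mult_right_mono ip_jump_self_le ab m ip_nonneg)
      finally have "(f b - f a)\<^sup>2 \<le> R * ip f f" .
      show "- (R * ip f f) \<le> 2 * (1 - e) * carre f a - (f b - f a)\<^sup>2"
      proof -
        have "0 \<le> 2 * (1 - e) * carre f a" using carre_nonneg[OF ab(1)] e by (intro mult_nonneg_nonneg) auto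
        then show ?thesis using \<open>(f b - f a)\<^sup>2 \<le> R * ip f f\<close> by linarith
      qed
    qed
    moreover have "real s * (R * ip f f) \<le> c * ip f f"
    proof -
      have "real s * R \<le> real N * R" using xs(2) N1 R by (intro mult_right_mono) auto
      then show ?thesis using cR ip_nonneg[of f] by (simp add: mult.assoc[symmetric] mult_right_mono)
    qed
    ultimately show ?thesis
      by (simp add: barrier_form[OF xs(1)] pathsum_const[OF xs(1)] \<kappa>_def)
  qed
  have mart: "(\<Sum>xs\<in>paths n t. Q xs * trpow (barrier \<kappa> e xs) N) \<le> real n * \<kappa> ^ N"
  proof (rule supermartingale)
    fix s xs assume s: "s < t" and xs: "xs \<in> paths n s"
    have ne: "xs \<noteq> []" using xs by (auto simp: paths_def)
    have l: "last xs < n" by (rule paths_last[OF xs])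
    have "R \<le> c" using cR N1(1) R mult_right_mono[of 1 "real N" R] by linarith
    then show "(\<Sum>y<n. p (last xs) y * trpow (barrier \<kappa> e (xs @ [y])) N) \<le> trpow (barrier \<kappa> e xs) N"
      unfolding barrier_snoc[OF ne]
      using trpow_supermartingale_step[where W = "barrier \<kappa> e xs" and c = c and I = "{..<n}" and
          q = "p (last xs)" and v = "jump (last xs)" and R = R and e = e and N = N]
        selfadj_barrier form_ge[OF xs] s p_nonneg[OF l] p_sum[OF l] ip_jump_self_le[OF l _ m] R e
      by (simp add: R_def c_def)
  next
    fix x assume "x < n"
    have iter: "(app n (barrier \<kappa> e [x]) ^^ k) f z = \<kappa> ^ k * f z" if "z < n" for k f z
      using that
    proof (induction k arbitrary: z)
      case (Suc k)
      have "(app n (barrier \<kappa> e [x]) ^^ Suc k) f z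
          = (\<Sum>y<n. if y = z then \<kappa> * (\<kappa> ^ k * f z) else 0)"
      proof -
        have "(app n (barrier \<kappa> e [x]) ^^ Suc k) f z
            = (\<Sum>y<n. barrier \<kappa> e [x] z y * (app n (barrier \<kappa> e [x]) ^^ k) f y)"
          by (simp only: funpow.simps o_apply app_def)
        also have "\<dots> = (\<Sum>y<n. barrier \<kappa> e [x] z y * (\<kappa> ^ k * f y))"
          using Suc.IH by (intro sum.cong refl) simp
        also have "\<dots> = (\<Sum>y<n. if y = z then \<kappa> * (\<kappa> ^ k * f z) else 0)"
          by (intro sum.cong) (auto simp: point_def barrier_def)
        finally show ?thesis .
      qed
      then show ?case using Suc.prems by simp
    qed simp
    show "trpow (barrier \<kappa> e [x]) N \<le> real n * \<kappa> ^ N"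
      unfolding trpow_def by (simp add: iter point_def)
  qed
  have psd: "0 \<le> ip f (app n (barrier \<kappa> e xs) f)" if "xs \<in> paths n t" for f xs
    using form_ge[OF that order_refl, of f] c ip_nonneg[of f] mult_nonneg_nonneg[of c "ip f f"] by linarith
  have "pr t (\<lambda>xs. real n * \<kappa> ^ N * exp \<Lambda> \<le> trpow (barrier \<kappa> e xs) N)
      \<le> real n * \<kappa> ^ N / (real n * \<kappa> ^ N * exp \<Lambda>)"
  proof (rule pr_Markov_inequality[OF mart])
    fix xs assume xs: "xs \<in> paths n t"
    obtain u l where u: "eigenbasis (barrier \<kappa> e xs) u l" using spectral_theorem[OF selfadj_barrier] by blast
    have "0 \<le> l i" if "i < n" for i using eigenvalue_ge[OF u, of 0] psd[OF xs] that by simp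
    then show "0 \<le> trpow (barrier \<kappa> e xs) N"
      by (auto simp: trpow_eigen[OF selfadj_barrier u] intro!: sum_nonneg)
  qed (use n c in \<open>simp add: \<kappa>_def\<close>)
  also have "\<dots> = exp (- \<Lambda>)" using n c by (simp add: \<kappa>_def exp_minus inverse_eq_divide)
  finally have tail: "pr t (\<lambda>xs. real n * \<kappa> ^ N * exp \<Lambda> \<le> trpow (barrier \<kappa> e xs) N) \<le> exp (- \<Lambda>)" .
  \<comment> \<open>An upper bound for the \<open>N\<close>-th root of
    \<open>n * \<kappa> ^ N * exp \<Lambda>\<close>. Its excess over \<open>\<kappa>\<close> is
    \<open>2 * \<kappa> * \<Lambda>' / N = 4 * R * \<Lambda>' / e\<close>, from which
    \<open>N\<close>, and with it the horizon, has cancelled.\<close>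
  define C where "C = \<kappa> * (1 + 2 * \<Lambda>' / real N)"
  have "exp (\<Lambda>' / real N) \<le> 1 + \<Lambda>' / real N + (\<Lambda>' / real N)\<^sup>2"
    using N1 \<Lambda>' by (intro exp_le_quadratic) simp
  also have "(\<Lambda>' / real N)\<^sup>2 \<le> \<Lambda>' / real N"
    unfolding power2_eq_square using N1 \<Lambda>' by (intro mult_left_le) auto
  finally have "exp (\<Lambda>' / real N) \<le> 1 + 2 * \<Lambda>' / real N" by simp
  then have "exp (\<Lambda>' / real N) ^ N \<le> (1 + 2 * \<Lambda>' / real N) ^ N" by (intro power_mono) auto
  moreover have "exp (\<Lambda>' / real N) ^ N = real n * exp \<Lambda>"
    using N1(1) n by (simp add: exp_of_nat_mult[symmetric] \<Lambda>'_def exp_add)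
  ultimately have "real n * exp \<Lambda> \<le> (1 + 2 * \<Lambda>' / real N) ^ N" by simp
  moreover have "0 \<le> \<kappa> ^ N" using c by (simp add: \<kappa>_def)
  ultimately have "\<kappa> ^ N * (real n * exp \<Lambda>) \<le> \<kappa> ^ N * (1 + 2 * \<Lambda>' / real N) ^ N"
    by (rule mult_left_mono)
  then have Cn: "real n * \<kappa> ^ N * exp \<Lambda> \<le> C ^ N"
    by (simp only: C_def power_mult_distrib mult_ac)
  have "C - \<kappa> = 8 * \<Lambda>' / (m * e)"
    using N1(1) m e by (simp add: C_def \<kappa>_def c_def R_def field_simps)
  then have C_eq: "C = \<kappa> + 8 * \<Lambda>' / (m * e)" by linarith
  have C0: "0 \<le> C" using c \<Lambda>' m e by (simp add: C_eq \<kappa>_def)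
  have "pr t (\<lambda>xs. \<not> (\<forall>f. (1 - e) * (\<Sum>x<n. visits x xs * carre f x)
      - 8 * (\<Lambda> + ln (real n)) / (m * e) * ip f f \<le> emp_energy f xs))
      \<le> pr t (\<lambda>xs. real n * \<kappa> ^ N * exp \<Lambda> \<le> trpow (barrier \<kappa> e xs) N)"
  proof (rule pr_mono, rule ccontr)
    fix xs
    assume xs: "xs \<in> paths n t" and
      bad: "\<not> (\<forall>f. (1 - e) * (\<Sum>x<n. visits x xs * carre f x)
        - 8 * (\<Lambda> + ln (real n)) / (m * e) * ip f f \<le> emp_energy f xs)"
    assume "\<not> real n * \<kappa> ^ N * exp \<Lambda> \<le> trpow (barrier \<kappa> e xs) N"
    then have "trpow (barrier \<kappa> e xs) N \<le> C ^ N" using Cn by linarith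
    moreover have "0 < N" using N1(1) by simp
    ultimately have le: "ip f (app n (barrier \<kappa> e xs) f) \<le> C * ip f f" for f
      using form_le_of_trpow_le[OF selfadj_barrier psd[OF xs] _ C0] by blast
    have "(1 - e) * (\<Sum>x<n. visits x xs * carre f x) - 8 * \<Lambda>' / (m * e) * ip f f \<le> emp_energy f xs" for f
    proof -
      have "pathsum (\<lambda>a b. 2 * (1 - e) * carre f a - (f b - f a)\<^sup>2) xs \<le> 8 * \<Lambda>' / (m * e) * ip f f"
        using le[of f] by (simp add: barrier_form[OF xs] C_eq distrib_right)
      then have "2 * ((1 - e) * (\<Sum>x<n. visits x xs * carre f x)) - 2 * emp_energy f xs
          \<le> 8 * \<Lambda>' / (m * e) * ip f f"
        by (simp only: pathsum_diff pathsum_scale pathsum_visits[OF xs] emp_energy_def mult.assoc)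
      moreover have "0 \<le> 8 * \<Lambda>' / (m * e) * ip f f" using \<Lambda>' m e ip_nonneg[of f] by simp
      ultimately show ?thesis by linarith
    qed
    then show False using bad by (simp add: \<Lambda>'_def)
  qed
  then show ?thesis using tail by linarith
qed

end

subsection \<open>Visits and the second eigenfunction\<close>

locale gapped_path = gapped n p \<pi> \<gamma> + path_law n p Q for n p \<pi> \<gamma> Q
begin

sublocale reversible_path n p \<pi> Q ..

text \<open>The quadratic variation of the martingale attached to one state involves the visits to all states;
  bounding the maximal relative excess \<open>\<beta>\<close> by itself closes the loop.\<close>

lemma pr_visits:
  assumes m: "0 < m" "m \<le> 1" "\<And>z. z < n \<Longrightarrow> m \<le> \<pi> z"
    and \<eta>: "0 < \<eta>" "\<eta> \<le> 1" and \<Lambda>: "1 \<le> \<Lambda>"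
    and t: "64 * (ln (1 / m) + 2) * \<Lambda> \<le> \<gamma> * real t * m * \<eta>\<^sup>2"
  shows "pr t (\<lambda>xs. \<not> (\<forall>x<n. \<bar>visits x xs - real t * \<pi> x\<bar> \<le> \<eta> * (real t * \<pi> x)))
    \<le> 2 * real n * exp (- \<Lambda>)"
proof -
  define D where "D = ln (1 / m) + 2"
  have D: "2 \<le> D" using m by (simp add: D_def)
  \<comment> \<open>With increments of size at most \<open>2 * D / \<gamma>\<close> the exponent is
    at most \<open>\<eta> / 4\<close>, and the variance term, of relative size
    \<open>2 * \<theta> * \<beta> / \<gamma>\<close>, becomes
    \<open>\<eta> * \<beta> / (4 * D) \<le> \<eta> * \<beta> / 8\<close>.\<close>
  define \<theta> where "\<theta> = \<gamma> * \<eta> / (8 * D)"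
  have \<theta>: "0 < \<theta>" using \<eta> D gap_pos by (simp add: \<theta>_def)
  have tpos: "0 < real t"
  proof -
    have "0 < 64 * D * \<Lambda>" using D \<Lambda> by simp
    then have "\<gamma> * real t * m * \<eta>\<^sup>2 > 0" using t unfolding D_def by linarith
    then show ?thesis by (cases "t = 0") auto
  qed
  obtain h where h: "\<And>x y. x < n \<Longrightarrow> y < n \<Longrightarrow> h x y - app n p (h x) y = point x y - \<pi> x"
    "\<And>x y. x < n \<Longrightarrow> y < n \<Longrightarrow> \<bar>h x y\<bar> \<le> D / \<gamma>" "\<And>x. x < n \<Longrightarrow> energy (h x) \<le> \<pi> x / \<gamma>"
  proof -
    have "\<forall>x. \<exists>h. x < n \<longrightarrow> (\<forall>y<n. h y - app n p h y = point x y - \<pi> x) \<and>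
        (\<forall>y<n. \<bar>h y\<bar> \<le> D / \<gamma>) \<and> energy h \<le> \<pi> x / \<gamma>"
      using Poisson_equation[OF _ m] unfolding D_def by blast
    then obtain h where "\<forall>x. x < n \<longrightarrow> (\<forall>y<n. h x y - app n p (h x) y = point x y - \<pi> x) \<and>
        (\<forall>y<n. \<bar>h x y\<bar> \<le> D / \<gamma>) \<and> energy (h x) \<le> \<pi> x / \<gamma>" by metis
    then show ?thesis by (intro that[of h]) auto
  qed
  define E where "E \<sigma> x xs = (\<Lambda> \<le> pathsum (\<lambda>y z. \<sigma> * \<theta> * (h x z - app n p (h x) y)
      - 2 * \<theta>\<^sup>2 * carre (h x) y) xs)" for \<sigma> x xs
  have E: "pr t (E \<sigma> x) \<le> exp (- \<Lambda>)" if "x < n" "\<sigma>\<^sup>2 = 1" for \<sigma> x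
    unfolding E_def
  proof (rule pr_martingale)
    fix y z assume yz: "y < n" "z < n"
    have "\<bar>h x z - app n p (h x) y\<bar> \<le> D / \<gamma> + D / \<gamma>"
      using h(2)[OF that(1)] yz abs_app_le[of "h x" "D / \<gamma>" y]
      by (intro order_trans[OF abs_triangle_ineq4] add_mono) auto
    then have "\<theta> * \<bar>h x z - app n p (h x) y\<bar> \<le> \<theta> * (D / \<gamma> + D / \<gamma>)"
      using \<theta> by (intro mult_left_mono) auto
    also have "\<dots> = \<eta> / 4" using D gap_pos by (simp add: \<theta>_def field_simps)
    finally show "\<theta> * \<bar>h x z - app n p (h x) y\<bar> \<le> 1" using \<eta> by simp
  qed (use \<theta> that in auto)
  have "pr t (\<lambda>xs. \<exists>x\<in>{..<n}. E 1 x xs \<or> E (- 1) x xs) \<le> (\<Sum>x<n. pr t (\<lambda>xs. E 1 x xs \<or> E (- 1) x xs))"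
    by (rule pr_ex) simp
  also have "\<dots> \<le> (\<Sum>x<n. 2 * exp (- \<Lambda>))"
  proof (rule sum_mono)
    fix x assume "x \<in> {..<n}"
    then show "pr t (\<lambda>xs. E 1 x xs \<or> E (- 1) x xs) \<le> 2 * exp (- \<Lambda>)"
      using pr_or[of t "E 1 x" "E (- 1) x"] E[of x 1] E[of x "- 1"] by simp
  qed
  finally have tail: "pr t (\<lambda>xs. \<exists>x\<in>{..<n}. E 1 x xs \<or> E (- 1) x xs) \<le> 2 * real n * exp (- \<Lambda>)"
    by simp
  have "pr t (\<lambda>xs. \<not> (\<forall>x<n. \<bar>visits x xs - real t * \<pi> x\<bar> \<le> \<eta> * (real t * \<pi> x)))
      \<le> pr t (\<lambda>xs. \<exists>x\<in>{..<n}. E 1 x xs \<or> E (- 1) x xs)"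
  proof (rule pr_mono, rule ccontr)
    fix xs
    assume xs: "xs \<in> paths n t"
      and bad: "\<not> (\<forall>x<n. \<bar>visits x xs - real t * \<pi> x\<bar> \<le> \<eta> * (real t * \<pi> x))"
      and good: "\<not> (\<exists>x\<in>{..<n}. E 1 x xs \<or> E (- 1) x xs)"
    have n: "0 < n" using paths_last[OF xs] by simp
    define \<beta> where "\<beta> = Max ((\<lambda>x. visits x xs / (real t * \<pi> x)) ` {..<n})"
    have \<beta>: "visits x xs \<le> \<beta> * (real t * \<pi> x)" if "x < n" for x
    proof -
      have "visits x xs / (real t * \<pi> x) \<le> \<beta>" unfolding \<beta>_def using that by (intro Max_ge) auto
      then show ?thesis using tpos w_pos[OF that] by (simp add: pos_divide_le_eq)
    qed
    have \<beta>0: "0 \<le> \<beta>"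
      using \<beta>[OF n] visits_nonneg[of 0 xs] tpos w_pos[OF n]
      by (smt (verit) mult_neg_pos mult_pos_pos)
    \<comment> \<open>Three contributions: \<open>\<eta> / 8\<close> from the tail level
      \<open>\<Lambda> / \<theta>\<close>, \<open>\<eta> / 8\<close> from the boundary values of
      \<open>h\<close>, and \<open>\<eta> * \<beta> / 8\<close> from the quadratic
      variation.\<close>
    have dev: "\<bar>visits x xs - real t * \<pi> x\<bar> \<le> (\<eta> / 4 + \<eta> * \<beta> / 8) * (real t * \<pi> x)" if x: "x < n" for x
    proof -
      define S where "S = pathsum (\<lambda>y z. h x z - app n p (h x) y) xs"
      define A where "A = (\<Sum>y<n. visits y xs * carre (h x) y)"
      have split: "pathsum (\<lambda>y z. \<sigma> * \<theta> * (h x z - app n p (h x) y) - 2 * \<theta>\<^sup>2 * carre (h x) y) xs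
          = \<sigma> * \<theta> * S - 2 * \<theta>\<^sup>2 * A" for \<sigma>
        by (simp only: pathsum_diff pathsum_scale S_def A_def pathsum_visits[OF xs])
      have "\<not> E 1 x xs" "\<not> E (- 1) x xs" using good x by auto
      then have "\<theta> * S - 2 * \<theta>\<^sup>2 * A < \<Lambda>" "- \<theta> * S - 2 * \<theta>\<^sup>2 * A < \<Lambda>"
        unfolding E_def split by auto
      then have "\<theta> * \<bar>S\<bar> \<le> \<theta> * (\<Lambda> / \<theta> + 2 * \<theta> * A)"
        using \<theta> by (simp add: abs_if distrib_left power2_eq_square mult_ac)
      then have S: "\<bar>S\<bar> \<le> \<Lambda> / \<theta> + 2 * \<theta> * A" using \<theta> by simp
      have "A \<le> (\<Sum>y<n. \<beta> * (real t * \<pi> y) * carre (h x) y)"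
        unfolding A_def using \<beta> carre_nonneg by (intro sum_mono mult_right_mono) auto
      also have "\<dots> = \<beta> * real t * energy (h x)" by (simp add: energy_def sum_distrib_left mult_ac)
      also have "\<dots> \<le> \<beta> * real t * (\<pi> x / \<gamma>)"
        using h(3)[OF x] \<beta>0 by (intro mult_left_mono) auto
      finally have "2 * \<theta> * A \<le> 2 * \<theta> * (\<beta> * real t * (\<pi> x / \<gamma>))"
        using \<theta> by (intro mult_left_mono) auto
      also have "\<dots> = (\<eta> * \<beta> / 4) * (real t * \<pi> x) / D"
        using gap_pos D by (simp add: \<theta>_def field_simps)
      also have "\<dots> \<le> (\<eta> * \<beta> / 4) * (real t * \<pi> x) / 2"
        using D \<eta> \<beta>0 w_pos[OF x] by (intro divide_left_mono) auto
      finally have A: "2 * \<theta> * A \<le> (\<eta> * \<beta> / 8) * (real t * \<pi> x)" by simp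
      have "64 * D * \<Lambda> \<le> \<gamma> * real t * \<pi> x * \<eta>\<^sup>2"
        using t m(3)[OF x] gap_pos unfolding D_def[symmetric]
        by (elim order_trans) (intro mult_left_mono mult_right_mono, auto)
      then have T: "D * \<Lambda> / \<gamma> \<le> real t * \<pi> x * \<eta>\<^sup>2 / 64" using gap_pos by (simp add: field_simps)
      have "\<Lambda> / \<theta> = 8 / \<eta> * (D * \<Lambda> / \<gamma>)" by (simp add: \<theta>_def mult_ac)
      also have "\<dots> \<le> 8 / \<eta> * (real t * \<pi> x * \<eta>\<^sup>2 / 64)" using T \<eta> by (intro mult_left_mono) auto
      also have "\<dots> = \<eta> / 8 * (real t * \<pi> x)" using \<eta> by (simp add: power2_eq_square)
      finally have L: "\<Lambda> / \<theta> \<le> \<eta> / 8 * (real t * \<pi> x)" .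
      have "D / \<gamma> * 1 \<le> D / \<gamma> * \<Lambda>" using D gap_pos \<Lambda> by (intro mult_left_mono) auto
      then have "D / \<gamma> \<le> D * \<Lambda> / \<gamma>" by simp
      then have "2 * (D / \<gamma>) \<le> 2 * (real t * \<pi> x * \<eta>\<^sup>2 / 64)" using T by linarith
      also have "\<dots> \<le> \<eta> / 8 * (real t * \<pi> x)"
      proof -
        have "\<eta>\<^sup>2 \<le> \<eta>" using \<eta> by (simp add: power2_eq_square mult_left_le)
        then have "real t * \<pi> x * \<eta>\<^sup>2 \<le> real t * \<pi> x * \<eta>"
          using tpos w_pos[OF x] by (intro mult_left_mono) auto
        moreover have "0 \<le> real t * \<pi> x * \<eta>" using tpos w_pos[OF x] \<eta> by simp
        ultimately have "2 * (real t * \<pi> x * \<eta>\<^sup>2 / 64) \<le> real t * \<pi> x * \<eta> / 8" by linarith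
        then show ?thesis by (simp add: mult_ac)
      qed
      finally have B: "2 * (D / \<gamma>) \<le> \<eta> / 8 * (real t * \<pi> x)" .
      \<comment> \<open>The increment \<open>h z - P h y\<close> splits into
        \<open>h z - h y\<close>, which telescopes, and \<open>h y - P h y\<close>, which the
        Poisson equation turns into the centred visit indicator.\<close>
      have "S = pathsum (\<lambda>y z. h x z - h x y) xs + pathsum (\<lambda>y z. point x y - \<pi> x) xs"
        unfolding S_def pathsum_add[symmetric] by (rule pathsum_cong[OF xs]) (simp add: h(1)[OF x, symmetric])
      also have "\<dots> = (h x (xs ! t) - h x (xs ! 0)) + (visits x xs - real t * \<pi> x)"
        unfolding pathsum_telescope[OF xs] unfolding pathsum_diff pathsum_const[OF xs] visits_def ..
      finally have "\<bar>visits x xs - real t * \<pi> x\<bar> \<le> \<bar>S\<bar> + \<bar>h x (xs ! t)\<bar> + \<bar>h x (xs ! 0)\<bar>" by linarith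
      also have "\<dots> \<le> \<bar>S\<bar> + 2 * (D / \<gamma>)"
        using h(2)[OF x paths_nth[OF xs, of t]] h(2)[OF x paths_nth[OF xs, of 0]] by simp
      also have "\<dots> \<le> (\<eta> / 8 * (real t * \<pi> x) + (\<eta> * \<beta> / 8) * (real t * \<pi> x)) + \<eta> / 8 * (real t * \<pi> x)"
        using S L A B by linarith
      finally show ?thesis by (simp add: algebra_simps)
    qed
    \<comment> \<open>At the state attaining the maximum the deviation bound becomes an inequality
      for \<open>\<beta>\<close> alone. It forces \<open>\<beta> \<le> 2\<close>, after which the
      bound is at most \<open>\<eta>\<close> for every state.\<close>
    have "\<beta> \<in> (\<lambda>x. visits x xs / (real t * \<pi> x)) ` {..<n}"
      unfolding \<beta>_def using n by (intro Max_in) auto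
    then obtain x where x: "x < n" "\<beta> = visits x xs / (real t * \<pi> x)" by auto
    have tx: "0 < real t * \<pi> x" using tpos w_pos[OF x(1)] by simp
    have "visits x xs \<le> (1 + \<eta> / 4 + \<eta> * \<beta> / 8) * (real t * \<pi> x)"
      using dev[OF x(1)] by (simp add: algebra_simps)
    then have "\<beta> \<le> 1 + \<eta> / 4 + \<eta> * \<beta> / 8" using tx by (simp add: x(2) pos_divide_le_eq)
    also have "\<eta> * \<beta> \<le> 1 * \<beta>" using \<eta> \<beta>0 by (intro mult_right_mono) auto
    finally have \<beta>2: "\<beta> \<le> 2" using \<eta> by simp
    have "\<bar>visits x xs - real t * \<pi> x\<bar> \<le> \<eta> * (real t * \<pi> x)" if x: "x < n" for x
    proof -
      have "\<eta> * \<beta> \<le> \<eta> * 2" using \<beta>2 \<eta> by (intro mult_left_mono) auto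
      then have "\<eta> / 4 + \<eta> * \<beta> / 8 \<le> \<eta>" using \<eta> by linarith
      then have "(\<eta> / 4 + \<eta> * \<beta> / 8) * (real t * \<pi> x) \<le> \<eta> * (real t * \<pi> x)"
        using tpos w_pos[OF x] by (intro mult_right_mono) auto
      then show ?thesis using dev[OF x] by linarith
    qed
    then show False using bad by blast
  qed
  then show ?thesis using tail by linarith
qed

end

section \<open>The empirical spectral gap\<close>

text \<open>It is \<open>t\<close> times the variance under the empirical distribution of the
  departure states. \<open>emp_energy\<close> is unnormalised as well, so \<open>t\<close> cancels
  in the quotient.\<close>

definition emp_var :: "(nat \<Rightarrow> real) \<Rightarrow> nat list \<Rightarrow> real" where
  "emp_var f xs = pathsum (\<lambda>a b. (f a)\<^sup>2) xs - (pathsum (\<lambda>a b. f a) xs)\<^sup>2 / real (length xs - 1)"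

text \<open>If no \<open>f\<close> has positive variance, \<open>Inf\<close> is taken over the empty
  set and its value is arbitrary. For \<open>n \<ge> 2\<close> some state is then never left,
  \<open>emp_min n xs = 0\<close>, and for \<open>\<delta> < 1\<close> the guard of
  \<open>gap_estimator\<close> fails.\<close>

definition emp_gap :: "nat list \<Rightarrow> real" where
  "emp_gap xs = Inf {emp_energy f xs / emp_var f xs |f. 0 < emp_var f xs}"

definition emp_min :: "nat \<Rightarrow> nat list \<Rightarrow> real" where
  "emp_min n xs = Min ((\<lambda>x. visits x xs) ` {..<n})"

text \<open>Short trajectories may miss a bottleneck; the threshold makes the estimator return \<open>0\<close>, which has
  relative error \<open>1\<close>, unless the trajectory itself certifies that it does not overestimate.\<close>

definition gap_estimator :: "real \<Rightarrow> nat \<Rightarrow> nat list \<Rightarrow> real" where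
  "gap_estimator \<delta> n xs =
    (if 1536 * ln (8 * real n / \<delta>) \<le> emp_min n xs * emp_gap xs then emp_gap xs else 0)"

lemma pathsum_square_shift:
  assumes "xs \<in> paths n t" "0 < t"
  shows "pathsum (\<lambda>a b. (f a - c)\<^sup>2) xs
    = emp_var f xs + real t * (pathsum (\<lambda>a b. f a) xs / real t - c)\<^sup>2"
proof -
  have "pathsum (\<lambda>a b. (f a - c)\<^sup>2) xs = pathsum (\<lambda>a b. (f a)\<^sup>2 - 2 * c * f a + c\<^sup>2) xs"
    by (rule pathsum_cong[OF assms(1)]) (simp add: power2_diff)
  also have "\<dots> = pathsum (\<lambda>a b. (f a)\<^sup>2) xs - 2 * c * pathsum (\<lambda>a b. f a) xs + real t * c\<^sup>2"
    by (simp only: pathsum_add pathsum_diff pathsum_scale pathsum_const[OF assms(1)])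
  finally have expand: "pathsum (\<lambda>a b. (f a - c)\<^sup>2) xs
    = pathsum (\<lambda>a b. (f a)\<^sup>2) xs - 2 * c * pathsum (\<lambda>a b. f a) xs + real t * c\<^sup>2" .
  show ?thesis unfolding expand emp_var_def
    using assms by (simp add: paths_def power2_eq_square field_simps)
qed

lemma emp_var_le:
  assumes "xs \<in> paths n t" "0 < t"
  shows "emp_var f xs \<le> (\<Sum>x<n. visits x xs * (f x - c)\<^sup>2)"
  using pathsum_square_shift[OF assms, of f c] pathsum_visits[OF assms(1), of "\<lambda>x. (f x - c)\<^sup>2"] by simp

lemma emp_min_le: "x < n \<Longrightarrow> emp_min n xs \<le> visits x xs"
  unfolding emp_min_def by (intro Min_le) auto

lemma le_emp_min: "0 < n \<Longrightarrow> (\<And>x. x < n \<Longrightarrow> c \<le> visits x xs) \<Longrightarrow> c \<le> emp_min n xs"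
  unfolding emp_min_def by (subst Min_ge_iff) auto

text \<open>The states \<open>a\<close> and \<open>b\<close> suffice: each is left at least
  \<open>emp_min n xs\<close> times, and two numbers at distance \<open>1\<close> have squares
  summing to at least \<open>1 / 2\<close>, wherever the mean lies.\<close>

lemma emp_min_le_emp_var:
  assumes xs: "xs \<in> paths n t" "0 < t" and ab: "a < n" "b < n" "g b - g a = 1"
  shows "emp_min n xs / 2 \<le> emp_var g xs"
proof -
  define c where "c = pathsum (\<lambda>a b. g a) xs / real t"
  have "0 < n" using ab by simp
  then have min0: "0 \<le> emp_min n xs" by (rule le_emp_min) (rule visits_nonneg)
  have "emp_var g xs = (\<Sum>x<n. visits x xs * (g x - c)\<^sup>2)"
    using pathsum_square_shift[OF xs, of g c] pathsum_visits[OF xs(1), of "\<lambda>x. (g x - c)\<^sup>2"]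
    by (simp add: c_def)
  also have "\<dots> \<ge> (\<Sum>x\<in>{a, b}. visits x xs * (g x - c)\<^sup>2)"
    using ab visits_nonneg by (intro sum_mono2) auto
  also have "(\<Sum>x\<in>{a, b}. visits x xs * (g x - c)\<^sup>2) \<ge> (\<Sum>x\<in>{a, b}. emp_min n xs * (g x - c)\<^sup>2)"
    using emp_min_le ab by (intro sum_mono mult_right_mono) auto
  also have "(\<Sum>x\<in>{a, b}. emp_min n xs * (g x - c)\<^sup>2) = emp_min n xs * ((g a - c)\<^sup>2 + (g b - c)\<^sup>2)"
    using ab by (subst sum.insert) (auto simp: distrib_left)
  also have "\<dots> \<ge> emp_min n xs * (1 / 2)"
  proof (rule mult_left_mono[OF _ min0])
    have "(g a - c)\<^sup>2 + (g b - c)\<^sup>2 = 2 * (g a - c + 1 / 2)\<^sup>2 + 1 / 2"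
      using ab(3) by (simp add: eq_diff_eq diff_eq_eq power2_eq_square) (simp add: algebra_simps)
    then show "1 / 2 \<le> (g a - c)\<^sup>2 + (g b - c)\<^sup>2" by simp
  qed
  finally show ?thesis by simp
qed

lemma emp_energy_nonneg: "0 \<le> emp_energy f xs"
  unfolding emp_energy_def by (simp add: pathsum_nonneg)

lemma emp_gap_le:
  assumes "0 < emp_var f xs"
  shows "emp_gap xs \<le> emp_energy f xs / emp_var f xs"
  unfolding emp_gap_def using assms
  by (intro cInf_lower bdd_belowI[of _ 0]) (auto simp: emp_energy_nonneg)

lemma le_emp_gap:
  assumes "0 < emp_var g xs" "\<And>f. 0 < emp_var f xs \<Longrightarrow> c * emp_var f xs \<le> emp_energy f xs"
  shows "c \<le> emp_gap xs"
  unfolding emp_gap_def using assms by (intro cInf_greatest) (auto simp: le_divide_eq)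

section \<open>Accuracy of the empirical spectral gap\<close>

context gapped_path
begin

lemma pr_eigenfunction:
  assumes g: "\<And>x. x < n \<Longrightarrow> app n p g x = (1 - \<gamma>) * g x" "\<And>x. x < n \<Longrightarrow> \<bar>g x\<bar> \<le> 1"
      "\<And>x y. x < n \<Longrightarrow> y < n \<Longrightarrow> \<bar>g y - g x\<bar> \<le> 1"
    and \<theta>: "0 < \<theta>" "\<theta> \<le> 1 / 4" and \<Lambda>: "1 \<le> \<Lambda>"
  shows "pr t (\<lambda>xs. \<not> (0 < t \<longrightarrow> (1 - 16 * \<theta>) * emp_energy g xs \<le> \<gamma> * emp_var g xs + 3 * \<Lambda> / \<theta>))
    \<le> 4 * exp (- \<Lambda>)"
proof -
  define \<xi> where "\<xi> x y = g y - (1 - \<gamma>) * g x" for x y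
  \<comment> \<open>Subtracting the observed squared increment gives the exponent the drift
    \<open>- 8 * \<theta>\<^sup>2 * carre g x\<close>, which pays for its second moment. The
    martingale is thus normalised by the empirical energy itself, with zero compensator in
    \<open>pr_Bernstein\<close>.\<close>
  define E where "E a \<sigma> xs = (\<Lambda> \<le> pathsum (\<lambda>x y. \<sigma> * \<theta> * (a x * \<xi> x y) - 4 * \<theta>\<^sup>2 * (g y - g x)\<^sup>2) xs)"
    for a \<sigma> xs
  have E: "pr t (E a \<sigma>) \<le> exp (- \<Lambda>)" if a: "\<And>x. x < n \<Longrightarrow> \<bar>a x\<bar> \<le> 1" and \<sigma>: "\<bar>\<sigma>\<bar> = 1" for a \<sigma>
  proof -
    let ?u = "\<lambda>x y. \<sigma> * \<theta> * (a x * \<xi> x y) - 4 * \<theta>\<^sup>2 * (g y - g x)\<^sup>2"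
    have "pr t (\<lambda>xs. \<Lambda> \<le> pathsum (\<lambda>x y. ?u x y - 0) xs) \<le> exp (- \<Lambda>)"
    proof (rule pr_Bernstein)
      fix x y assume xy: "x < n" "y < n"
      have "\<bar>\<xi> x y\<bar> \<le> \<bar>g y\<bar> + (1 - \<gamma>) * \<bar>g x\<bar>"
        unfolding \<xi>_def using gap_less_1 abs_triangle_ineq4[of "g y" "(1 - \<gamma>) * g x"]
        by (simp add: abs_mult)
      also have "\<dots> \<le> 1 + 1 * 1"
        using g(2) xy gap_pos gap_less_1 by (intro add_mono mult_mono) auto
      finally have \<xi>2: "\<bar>\<xi> x y\<bar> \<le> 2" by simp
      have "\<sigma> * \<theta> * (a x * \<xi> x y) \<le> \<theta> * (\<bar>a x\<bar> * \<bar>\<xi> x y\<bar>)"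
        using abs_ge_self[of "\<sigma> * \<theta> * (a x * \<xi> x y)"] \<sigma> \<theta>(1) by (simp add: abs_mult)
      also have "\<dots> \<le> 1 / 4 * (1 * 2)"
        using \<theta> a[OF xy(1)] \<xi>2 by (intro mult_mono) auto
      finally have "\<sigma> * \<theta> * (a x * \<xi> x y) \<le> 1 / 4 * (1 * 2)" .
      moreover have "0 \<le> 4 * \<theta>\<^sup>2 * (g y - g x)\<^sup>2" by simp
      ultimately show "?u x y \<le> 1" by linarith
    next
      fix x assume x: "x < n"
      have centred: "(\<Sum>y<n. p x y * \<xi> x y) = 0"
        using sum_centred[OF x, of g] by (simp add: g(1)[OF x] \<xi>_def)
      have "(\<Sum>y<n. p x y * ?u x y) = \<sigma> * \<theta> * a x * (\<Sum>y<n. p x y * \<xi> x y)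
          - 4 * \<theta>\<^sup>2 * (\<Sum>y<n. p x y * (g y - g x)\<^sup>2)"
        unfolding sum_distrib_left sum_subtractf[symmetric]
        by (intro sum.cong refl) (simp add: algebra_simps)
      then have first: "(\<Sum>y<n. p x y * ?u x y) = - 8 * \<theta>\<^sup>2 * carre g x"
        by (simp add: centred two_carre)
      have "(\<Sum>y<n. p x y * (?u x y)\<^sup>2) \<le> (\<Sum>y<n. p x y * (2 * \<theta>\<^sup>2 * (\<xi> x y)\<^sup>2 + 2 * \<theta>\<^sup>2 * (g y - g x)\<^sup>2))"
      proof (intro sum_mono mult_left_mono)
        fix y assume "y \<in> {..<n}"
        then have y: "y < n" by simp
        have sq: "(r - s)\<^sup>2 \<le> 2 * r\<^sup>2 + 2 * s\<^sup>2" for r s :: real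
          using zero_le_power2[of "r + s"] by (simp add: power2_sum power2_diff)
        have "(a x * \<xi> x y)\<^sup>2 \<le> (\<xi> x y)\<^sup>2"
          using a[OF x] by (simp add: power_mult_distrib mult_left_le_one_le abs_square_le_1)
        then have 1: "(\<sigma> * \<theta> * (a x * \<xi> x y))\<^sup>2 \<le> \<theta>\<^sup>2 * (\<xi> x y)\<^sup>2"
          using \<sigma> by (simp add: power_mult_distrib abs_square_eq_1[THEN iffD2] mult_left_mono)
        have "(4 * \<theta>\<^sup>2 * (g y - g x)\<^sup>2)\<^sup>2 = (16 * \<theta>\<^sup>2) * (\<theta>\<^sup>2 * (g y - g x)\<^sup>2 * (g y - g x)\<^sup>2)"
          by (simp add: power2_eq_square)
        also have "\<dots> \<le> 1 * (\<theta>\<^sup>2 * (g y - g x)\<^sup>2 * 1)"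
        proof (intro mult_mono)
          show "16 * \<theta>\<^sup>2 \<le> 1" using \<theta> power_mono[of \<theta> "1 / 4" 2] by (simp add: power2_eq_square)
          show "(g y - g x)\<^sup>2 \<le> 1" using g(3)[OF x y] by (simp add: abs_square_le_1)
        qed auto
        finally have 2: "(4 * \<theta>\<^sup>2 * (g y - g x)\<^sup>2)\<^sup>2 \<le> \<theta>\<^sup>2 * (g y - g x)\<^sup>2" by simp
        show "(?u x y)\<^sup>2 \<le> 2 * \<theta>\<^sup>2 * (\<xi> x y)\<^sup>2 + 2 * \<theta>\<^sup>2 * (g y - g x)\<^sup>2"
          using sq[of "\<sigma> * \<theta> * (a x * \<xi> x y)" "4 * \<theta>\<^sup>2 * (g y - g x)\<^sup>2"] 1 2 by linarith
      qed (simp add: p_nonneg x)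
      also have "\<dots> = 2 * \<theta>\<^sup>2 * (\<Sum>y<n. p x y * (\<xi> x y)\<^sup>2) + 2 * \<theta>\<^sup>2 * (\<Sum>y<n. p x y * (g y - g x)\<^sup>2)"
        unfolding sum_distrib_left sum.distrib[symmetric] by (intro sum.cong refl) (simp add: algebra_simps)
      also have "\<dots> \<le> 2 * \<theta>\<^sup>2 * (2 * carre g x) + 2 * \<theta>\<^sup>2 * (2 * carre g x)"
        using second_moment_centred_le[OF x, of g]
        by (intro add_mono mult_left_mono) (simp_all add: two_carre g(1)[OF x] \<xi>_def)
      also have "\<dots> = 8 * \<theta>\<^sup>2 * carre g x" by simp
      finally show "(\<Sum>y<n. p x y * ?u x y) + (\<Sum>y<n. p x y * (?u x y)\<^sup>2) \<le> 0"
        unfolding first by simp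
    qed
    then show ?thesis by (simp add: E_def[abs_def])
  qed
  \<comment> \<open>The empirical mean \<open>c\<close> depends on the whole path, so
    \<open>(g x - c) * \<xi> x y\<close> is no martingale increment. The weights \<open>g\<close>
    and \<open>1\<close> are treated separately and combined pathwise afterwards.\<close>
  let ?bad = "\<lambda>xs. (E (\<lambda>_. 1) 1 xs \<or> E (\<lambda>_. 1) (- 1) xs) \<or> (E g 1 xs \<or> E g (- 1) xs)"
  have "pr t ?bad \<le> pr t (\<lambda>xs. E (\<lambda>_. 1) 1 xs \<or> E (\<lambda>_. 1) (- 1) xs) + pr t (\<lambda>xs. E g 1 xs \<or> E g (- 1) xs)"
    by (rule pr_or)
  also have "\<dots> \<le> (exp (- \<Lambda>) + exp (- \<Lambda>)) + (exp (- \<Lambda>) + exp (- \<Lambda>))"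
    by (intro add_mono order_trans[OF pr_or] E g(2)) auto
  finally have tail: "pr t ?bad \<le> 4 * exp (- \<Lambda>)" by simp
  have "pr t (\<lambda>xs. \<not> (0 < t \<longrightarrow> (1 - 16 * \<theta>) * emp_energy g xs \<le> \<gamma> * emp_var g xs + 3 * \<Lambda> / \<theta>)) \<le> pr t ?bad"
  proof (rule pr_mono, rule ccontr)
    fix xs
    assume xs: "xs \<in> paths n t"
      and bad: "\<not> (0 < t \<longrightarrow> (1 - 16 * \<theta>) * emp_energy g xs \<le> \<gamma> * emp_var g xs + 3 * \<Lambda> / \<theta>)"
      and good: "\<not> ?bad xs"
    have t: "0 < t" using bad by simp
    define A where "A = 8 * \<theta> * emp_energy g xs + \<Lambda> / \<theta>"
    have S: "\<bar>pathsum (\<lambda>x y. a x * \<xi> x y) xs\<bar> \<le> A" if "\<not> E a 1 xs" "\<not> E a (- 1) xs" for a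
    proof -
      have split: "pathsum (\<lambda>x y. \<sigma> * \<theta> * (a x * \<xi> x y) - 4 * \<theta>\<^sup>2 * (g y - g x)\<^sup>2) xs
          = \<sigma> * \<theta> * pathsum (\<lambda>x y. a x * \<xi> x y) xs - 4 * \<theta>\<^sup>2 * (2 * emp_energy g xs)" for \<sigma>
        by (simp add: pathsum_diff pathsum_scale emp_energy_def)
      have "\<theta> * \<bar>pathsum (\<lambda>x y. a x * \<xi> x y) xs\<bar> \<le> \<theta> * A"
        using that \<theta>(1) unfolding E_def split A_def
        by (simp add: abs_if distrib_left power2_eq_square mult_ac)
      then show ?thesis using \<theta>(1) by simp
    qed
    have S1: "\<bar>pathsum \<xi> xs\<bar> \<le> A" and Sg: "\<bar>pathsum (\<lambda>x y. g x * \<xi> x y) xs\<bar> \<le> A"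
      using S[of "\<lambda>_. 1"] S[of g] good by auto
    define c where "c = pathsum (\<lambda>a b. g a) xs / real t"
    have "\<bar>pathsum (\<lambda>a b. g a) xs\<bar> \<le> pathsum (\<lambda>a b. 1) xs"
    proof -
      have "pathsum (\<lambda>a b. g a) xs \<le> pathsum (\<lambda>a b. 1) xs" "pathsum (\<lambda>a b. (- 1) * g a) xs \<le> pathsum (\<lambda>a b. 1) xs"
        using g(2) by (intro pathsum_mono[OF xs]; fastforce simp: abs_le_iff)+
      then show ?thesis unfolding pathsum_scale by linarith
    qed
    then have c1: "\<bar>c\<bar> \<le> 1" using t by (simp add: c_def pathsum_const[OF xs])
    \<comment> \<open>Summation by parts for one transition: the left side telescopes,
      \<open>(b - a)\<^sup>2\<close> sums to the energy, the terms with \<open>z\<close> to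
      martingales and the last one to \<open>\<gamma>\<close> times the variance.\<close>
    have id: "(b - c)\<^sup>2 - (a - c)\<^sup>2 = (b - a)\<^sup>2 + 2 * (a * z - c * z - \<gamma> * (a\<^sup>2 - c * a))"
      if "z = b - (1 - \<gamma>) * a" for a b z
      unfolding that by (simp add: power2_eq_square algebra_simps)
    have "(g (xs ! t) - c)\<^sup>2 - (g (xs ! 0) - c)\<^sup>2 = pathsum (\<lambda>a b. (g b - c)\<^sup>2 - (g a - c)\<^sup>2) xs"
      by (rule pathsum_telescope[OF xs, symmetric])
    also have "\<dots> = pathsum (\<lambda>a b. (g b - g a)\<^sup>2
        + 2 * (g a * \<xi> a b - c * \<xi> a b - \<gamma> * ((g a)\<^sup>2 - c * g a))) xs"
      by (intro pathsum_cong[OF xs] id) (simp add: \<xi>_def)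
    also have "\<dots> = 2 * emp_energy g xs + 2 * (pathsum (\<lambda>a b. g a * \<xi> a b) xs - c * pathsum \<xi> xs
        - \<gamma> * (pathsum (\<lambda>a b. (g a)\<^sup>2) xs - c * pathsum (\<lambda>a b. g a) xs))"
      by (simp add: pathsum_add pathsum_diff pathsum_scale emp_energy_def)
    also have "pathsum (\<lambda>a b. (g a)\<^sup>2) xs - c * pathsum (\<lambda>a b. g a) xs = emp_var g xs"
      using xs by (simp add: emp_var_def c_def paths_def power2_eq_square)
    finally have eq: "(g (xs ! t) - c)\<^sup>2 - (g (xs ! 0) - c)\<^sup>2 = 2 * emp_energy g xs
        + 2 * (pathsum (\<lambda>a b. g a * \<xi> a b) xs - c * pathsum \<xi> xs - \<gamma> * emp_var g xs)" .
    have "\<bar>g (xs ! t) - c\<bar> \<le> 2" using g(2)[OF paths_nth[OF xs, of t]] c1 by simp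
    then have "(g (xs ! t) - c)\<^sup>2 \<le> 4" using abs_le_square_iff[of "g (xs ! t) - c" 2] by simp
    moreover have "0 \<le> (g (xs ! 0) - c)\<^sup>2" by simp
    moreover have "c * pathsum \<xi> xs \<le> A"
    proof -
      have "\<bar>c * pathsum \<xi> xs\<bar> \<le> 1 * A" unfolding abs_mult using c1 S1 by (intro mult_mono) auto
      then show ?thesis by linarith
    qed
    moreover have "e \<le> 2 + 2 * A + v" if "x - y = 2 * e + 2 * (s - z - v)" "x \<le> 4" "0 \<le> y" "z \<le> A" "- s \<le> A"
      for e s v x y z
    proof -
      have "2 * (s - z - v) = 2 * s - 2 * z - 2 * v" by (simp add: right_diff_distrib)
      then show ?thesis using that by linarith
    qed
    ultimately have "emp_energy g xs \<le> 2 + 2 * A + \<gamma> * emp_var g xs"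
      using eq abs_le_D2[OF Sg] by blast
    \<comment> \<open>The boundary contribution \<open>2\<close> is the third
      \<open>\<Lambda> / \<theta>\<close>; \<open>2 * A\<close> supplies the other two and the loss
      of \<open>16 * \<theta>\<close>.\<close>
    moreover have "2 \<le> \<Lambda> / \<theta>"
      using \<theta> \<Lambda> by (simp add: le_divide_eq)
    moreover have "(1 - 16 * \<theta>) * emp_energy g xs = emp_energy g xs - 2 * (8 * \<theta> * emp_energy g xs)"
      by (simp add: algebra_simps)
    ultimately have "(1 - 16 * \<theta>) * emp_energy g xs \<le> \<gamma> * emp_var g xs + 3 * (\<Lambda> / \<theta>)"
      using A_def by linarith
    then show False using bad by simp
  qed
  then show ?thesis using tail by linarith
qed

text \<open>For \<open>\<epsilon> > 1\<close> the chain may be far from mixed, but any estimate in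
  \<open>[0, 2 * \<gamma>]\<close> is acceptable, and the guard together with the eigenfunction
  bound ensures one. For \<open>\<epsilon> \<le> 1\<close> all visit counts are controlled, the
  guard is passed and both directions are proved.\<close>

lemma gap_estimator_accurate:
  assumes n: "2 \<le> n" and m: "0 < m" "m \<le> 1" "\<And>z. z < n \<Longrightarrow> m \<le> \<pi> z"
    and g: "\<And>x. x < n \<Longrightarrow> app n p g x = (1 - \<gamma>) * g x" "\<And>x. x < n \<Longrightarrow> \<bar>g x\<bar> \<le> 1"
      "\<And>x y. x < n \<Longrightarrow> y < n \<Longrightarrow> \<bar>g y - g x\<bar> \<le> 1" "a < n" "b < n" "g b - g a = 1"
    and \<delta>: "0 < \<delta>" "\<delta> < 1" and \<epsilon>: "0 < \<epsilon>"
    and t: "1 / (m * \<gamma> * \<epsilon>\<^sup>2) * (8192 * ln (8 * real n / \<delta>) * (2 + ln (1 / m))) < real t"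
  shows "1 - \<delta> \<le> pr t (\<lambda>xs. \<bar>gap_estimator \<delta> n xs / \<gamma> - 1\<bar> < \<epsilon>)"
proof -
  define \<Lambda> where "\<Lambda> = ln (8 * real n / \<delta>)"
  have big: "16 \<le> 8 * real n / \<delta>" using n \<delta> by (simp add: le_divide_eq)
  have "exp 1 \<le> 8 * real n / \<delta>" using big exp_le by linarith
  then have \<Lambda>1: "1 \<le> \<Lambda>" using big unfolding \<Lambda>_def by (subst ln_ge_iff) auto
  have exp\<Lambda>: "exp (- \<Lambda>) = \<delta> / (8 * real n)" using big n \<delta> by (simp add: \<Lambda>_def exp_minus)
  define D where "D = 2 + ln (1 / m)"
  have D: "2 \<le> D" using m by (simp add: D_def)
  have t0: "8192 * \<Lambda> * D < \<gamma> * real t * m * \<epsilon>\<^sup>2"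
    using t m(1) gap_pos \<epsilon> by (simp add: \<Lambda>_def D_def divide_less_eq mult_ac)
  have "\<Lambda> * 2 \<le> \<Lambda> * D" using D \<Lambda>1 by (intro mult_left_mono) auto
  \<comment> \<open>The visits need \<open>64 * 64 * \<Lambda> * D\<close>, as \<open>\<eta>\<close>
    will be \<open>\<epsilon> / 8\<close>. Twice that, with \<open>D \<ge> 2\<close>, also covers
    the \<open>12288 * \<Lambda>\<close> required by the final upper bound.\<close>
  then have t1: "16384 * \<Lambda> < \<gamma> * real t * m * \<epsilon>\<^sup>2" using t0 by linarith
  have tpos: "0 < t"
  proof -
    have "0 < \<gamma> * real t * m * \<epsilon>\<^sup>2" using t1 \<Lambda>1 by linarith
    then show ?thesis by (cases "t = 0") auto
  qed
  have n0: "0 < n" using n by simp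
  have upper: "(1 - 16 * \<theta>) * emp_gap xs \<le> \<gamma> + 6 * \<Lambda> / (\<theta> * emp_min n xs)"
    if xs: "xs \<in> paths n t" and \<theta>: "0 < \<theta>" "\<theta> < 1 / 16" and pos: "0 < emp_min n xs"
      and ev: "0 < t \<longrightarrow> (1 - 16 * \<theta>) * emp_energy g xs \<le> \<gamma> * emp_var g xs + 3 * \<Lambda> / \<theta>" for xs \<theta>
  proof -
    have V: "emp_min n xs / 2 \<le> emp_var g xs" by (rule emp_min_le_emp_var[OF xs tpos g(4-6)])
    then have V0: "0 < emp_var g xs" using pos by linarith
    have "(1 - 16 * \<theta>) * emp_gap xs \<le> (1 - 16 * \<theta>) * (emp_energy g xs / emp_var g xs)"
      using \<theta> by (intro mult_left_mono emp_gap_le V0) auto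
    also have "\<dots> \<le> (\<gamma> * emp_var g xs + 3 * \<Lambda> / \<theta>) / emp_var g xs"
      using ev tpos V0 by (simp add: divide_right_mono)
    also have "\<dots> = \<gamma> + (3 * \<Lambda> / \<theta>) / emp_var g xs" using V0 by (simp add: add_divide_distrib)
    also have "\<dots> \<le> \<gamma> + (3 * \<Lambda> / \<theta>) / (emp_min n xs / 2)"
      using V pos \<Lambda>1 \<theta> by (intro add_left_mono divide_left_mono) auto
    finally show ?thesis by (simp add: mult_ac)
  qed
  show ?thesis
  proof (cases "1 < \<epsilon>")
    case True
    let ?ev = "\<lambda>xs. 0 < t \<longrightarrow> (1 - 16 * (1 / 64)) * emp_energy g xs \<le> \<gamma> * emp_var g xs + 3 * \<Lambda> / (1 / 64)"
    have "pr t (\<lambda>xs. \<not> ?ev xs) \<le> 4 * exp (- \<Lambda>)"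
      by (rule pr_eigenfunction[OF g(1-3)]) (use \<Lambda>1 in auto)
    then have "1 - 4 * exp (- \<Lambda>) \<le> pr t ?ev" unfolding pr_not by linarith
    also have "\<dots> \<le> pr t (\<lambda>xs. \<bar>gap_estimator \<delta> n xs / \<gamma> - 1\<bar> < \<epsilon>)"
    proof (rule pr_mono)
      fix xs assume xs: "xs \<in> paths n t" and ev: "?ev xs"
      show "\<bar>gap_estimator \<delta> n xs / \<gamma> - 1\<bar> < \<epsilon>"
      proof (cases "1536 * \<Lambda> \<le> emp_min n xs * emp_gap xs")
        case guard: True
        have min0: "0 \<le> emp_min n xs" using n0 visits_nonneg by (rule le_emp_min)
        have "0 < emp_min n xs * emp_gap xs" using guard \<Lambda>1 by linarith
        then have pos: "0 < emp_min n xs" "0 < emp_gap xs" using min0 by (auto simp: zero_less_mult_iff)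
        have "1536 * \<Lambda> / emp_min n xs \<le> emp_gap xs" using guard pos by (simp add: divide_le_eq mult_ac)
        \<comment> \<open>The threshold constant is \<open>4 * 6 * 64\<close>: for
          \<open>\<theta> = 1 / 64\<close> the error is a quarter of the estimate, so
          \<open>3 / 4\<close> of the estimate is at most \<open>\<gamma>\<close> plus another
          quarter of it.\<close>
        then have "6 * \<Lambda> / (1 / 64 * emp_min n xs) \<le> emp_gap xs / 4" by simp
        then have "emp_gap xs \<le> 2 * \<gamma>" using upper[OF xs _ _ pos(1) ev] by simp
        then have "emp_gap xs / \<gamma> \<le> 2" "0 < emp_gap xs / \<gamma>" using gap_pos pos by (auto simp: divide_le_eq)
        then show ?thesis using guard True by (simp add: gap_estimator_def \<Lambda>_def abs_le_iff abs_less_iff)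
      next
        case False
        then show ?thesis using True by (simp add: gap_estimator_def \<Lambda>_def)
      qed
    qed
    finally have "1 - 4 * exp (- \<Lambda>) \<le> pr t (\<lambda>xs. \<bar>gap_estimator \<delta> n xs / \<gamma> - 1\<bar> < \<epsilon>)" .
    moreover have "4 * exp (- \<Lambda>) \<le> \<delta>"
      using n \<delta> by (simp add: exp\<Lambda> divide_le_eq)
    ultimately show ?thesis by linarith
  next
    case False
    then have \<epsilon>1: "\<epsilon> \<le> 1" by simp
    \<comment> \<open>One \<open>\<eta>\<close> each is lost to the visits below, the compensator
      discount, the barrier excess and the visits above, in total
      \<open>4 * \<eta> = \<epsilon> / 2\<close>.\<close>
    define \<eta> where "\<eta> = \<epsilon> / 8"
    have \<eta>: "0 < \<eta>" "\<eta> \<le> 1 / 8" using \<epsilon> \<epsilon>1 by (auto simp: \<eta>_def)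
    have te: "\<gamma> * real t * m * \<eta>\<^sup>2 = \<gamma> * real t * m * \<epsilon>\<^sup>2 / 64" by (simp add: \<eta>_def power2_eq_square)
    let ?A = "\<lambda>xs. \<forall>x<n. \<bar>visits x xs - real t * \<pi> x\<bar> \<le> \<eta> * (real t * \<pi> x)"
    let ?B = "\<lambda>xs. \<forall>f. (1 - \<eta>) * (\<Sum>x<n. visits x xs * carre f x)
      - 8 * (\<Lambda> + ln (real n)) / (m * \<eta>) * ip f f \<le> emp_energy f xs"
    let ?\<theta> = "\<epsilon> / 128"
    let ?C = "\<lambda>xs. 0 < t \<longrightarrow> (1 - 16 * ?\<theta>) * emp_energy g xs \<le> \<gamma> * emp_var g xs + 3 * \<Lambda> / ?\<theta>"
    have A: "pr t (\<lambda>xs. \<not> ?A xs) \<le> 2 * real n * exp (- \<Lambda>)"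
    proof (rule pr_visits[OF m _ _ \<Lambda>1])
      have "0 \<le> \<Lambda> * D" using \<Lambda>1 D by simp
      then have "64 * (D * \<Lambda>) \<le> \<gamma> * real t * m * \<epsilon>\<^sup>2 / 64" using t0 by (simp add: mult_ac)
      moreover have "64 * (ln (1 / m) + 2) * \<Lambda> = 64 * (D * \<Lambda>)"
        unfolding D_def by (simp only: add.commute mult.assoc)
      ultimately show "64 * (ln (1 / m) + 2) * \<Lambda> \<le> \<gamma> * real t * m * \<eta>\<^sup>2"
        unfolding te by (simp only:)
    qed (use \<eta> in auto)
    have B: "pr t (\<lambda>xs. \<not> ?B xs) \<le> exp (- \<Lambda>)"
      using n \<eta> \<Lambda>1 by (intro pr_emp_energy_ge m) auto
    have C: "pr t (\<lambda>xs. \<not> ?C xs) \<le> 4 * exp (- \<Lambda>)"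
      using \<epsilon> \<epsilon>1 by (intro pr_eigenfunction g(1-3) \<Lambda>1) auto
    have "pr t (\<lambda>xs. \<not> ?A xs \<or> (\<not> ?B xs \<or> \<not> ?C xs)) \<le> pr t (\<lambda>xs. \<not> ?A xs) + (pr t (\<lambda>xs. \<not> ?B xs) + pr t (\<lambda>xs. \<not> ?C xs))"
      by (rule order_trans[OF pr_or add_left_mono[OF pr_or]])
    \<comment> \<open>The failure budget \<open>2 * n + 5 \<le> 8 * n\<close> explains the argument
      of the logarithm in \<open>\<Lambda>\<close>.\<close>
    also have "\<dots> \<le> (2 * real n + 5) * exp (- \<Lambda>)" using A B C by (simp add: algebra_simps)
    also have "\<dots> \<le> (8 * real n) * exp (- \<Lambda>)" using n by (intro mult_right_mono) auto
    also have "\<dots> = \<delta>" using n by (simp add: exp\<Lambda>)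
    finally have bad: "pr t (\<lambda>xs. \<not> ?A xs \<or> (\<not> ?B xs \<or> \<not> ?C xs)) \<le> \<delta>" .
    have "pr t (\<lambda>xs. \<not> \<bar>gap_estimator \<delta> n xs / \<gamma> - 1\<bar> < \<epsilon>) \<le> pr t (\<lambda>xs. \<not> ?A xs \<or> (\<not> ?B xs \<or> \<not> ?C xs))"
    proof (rule pr_mono, rule ccontr)
      fix xs assume xs: "xs \<in> paths n t" and wrong: "\<not> \<bar>gap_estimator \<delta> n xs / \<gamma> - 1\<bar> < \<epsilon>"
        and good: "\<not> (\<not> ?A xs \<or> (\<not> ?B xs \<or> \<not> ?C xs))"
      have vA: "(1 - \<eta>) * (real t * \<pi> x) \<le> visits x xs" "visits x xs \<le> (1 + \<eta>) * (real t * \<pi> x)"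
        if "x < n" for x
      proof -
        have "\<bar>visits x xs - real t * \<pi> x\<bar> \<le> \<eta> * (real t * \<pi> x)" using good that by blast
        then show "(1 - \<eta>) * (real t * \<pi> x) \<le> visits x xs" "visits x xs \<le> (1 + \<eta>) * (real t * \<pi> x)"
          by (auto simp: abs_le_iff algebra_simps)
      qed
      have vmin: "real t * m / 2 \<le> emp_min n xs"
      proof (rule le_emp_min[OF n0])
        fix x assume x: "x < n"
        have "1 / 2 * (real t * m) \<le> (1 - \<eta>) * (real t * \<pi> x)"
          using \<eta> m x by (intro mult_mono) auto
        then show "real t * m / 2 \<le> visits x xs" using vA[OF x] by simp
      qed
      have tm: "0 < real t * m" using tpos m by simp
      then have pos: "0 < emp_min n xs" using vmin by linarith
      have V0: "0 < emp_var g xs" using emp_min_le_emp_var[OF xs tpos g(4-6)] pos by linarith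
      have lower: "(1 - 4 * \<eta>) * \<gamma> \<le> emp_gap xs"
      proof (rule le_emp_gap[OF V0])
        fix f assume "0 < emp_var f xs"
        \<comment> \<open>Centring at the stationary mean is what the Poincare inequality asks. It
          leaves the empirical energy unchanged and can only enlarge the empirical second moment
          relative to the variance.\<close>
        define h where "h x = f x - mean f" for x
        define F where "F = real t * ip h h"
        have F: "0 \<le> F" using ip_nonneg[of h] by (simp add: F_def)
        have mh: "mean h = 0"
          using pi_sum by (simp add: h_def mean_def right_diff_distrib sum_subtractf flip: sum_distrib_right)
        have eh: "emp_energy h xs = emp_energy f xs" by (simp add: emp_energy_def h_def)
        have "emp_var f xs \<le> (\<Sum>x<n. visits x xs * (h x)\<^sup>2)"
          unfolding h_def by (rule emp_var_le[OF xs tpos])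
        also have "\<dots> \<le> (\<Sum>x<n. (1 + \<eta>) * (real t * \<pi> x) * (h x)\<^sup>2)"
          using vA(2) by (intro sum_mono mult_right_mono) auto
        also have "\<dots> = (1 + \<eta>) * F"
          by (simp add: F_def ip_def sum_distrib_left power2_eq_square mult_ac)
        finally have var: "emp_var f xs \<le> (1 + \<eta>) * F" .
        have "(1 - \<eta>) * \<gamma> * F \<le> (1 - \<eta>) * real t * energy h"
        proof -
          have "(1 - \<eta>) * real t * (\<gamma> * ip h h) \<le> (1 - \<eta>) * real t * energy h"
            using Poincare[OF mh] \<eta> by (intro mult_left_mono) auto
          then show ?thesis by (simp add: F_def mult_ac)
        qed
        also have "\<dots> = (\<Sum>x<n. (1 - \<eta>) * (real t * \<pi> x) * carre h x)"
          by (simp add: energy_def sum_distrib_left mult_ac)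
        also have "\<dots> \<le> (\<Sum>x<n. visits x xs * carre h x)"
          using vA(1) carre_nonneg by (intro sum_mono mult_right_mono) auto
        finally have "(1 - \<eta>) * ((1 - \<eta>) * \<gamma> * F) \<le> (1 - \<eta>) * (\<Sum>x<n. visits x xs * carre h x)"
          using \<eta> by (intro mult_left_mono) auto
        \<comment> \<open>The barrier excess has \<open>m * \<eta>\<close> in the denominator and
          must be at most \<open>\<eta> * \<gamma> * t\<close>; this is the requirement that makes
          \<open>t\<close> of order \<open>1 / (m * \<gamma> * \<epsilon>\<^sup>2)\<close>.\<close>
        moreover have "8 * (\<Lambda> + ln (real n)) / (m * \<eta>) * ip h h \<le> \<eta> * \<gamma> * F"
        proof -
          have "real n \<le> 8 * real n / \<delta>" using \<delta> n by (simp add: le_divide_eq)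
          then have "ln (real n) \<le> \<Lambda>" unfolding \<Lambda>_def using n by (subst ln_le_cancel_iff) auto
          then have "8 * (\<Lambda> + ln (real n)) \<le> 16 * \<Lambda>" by simp
          also have "\<dots> \<le> \<gamma> * real t * m * \<eta>\<^sup>2" using t1 \<Lambda>1 unfolding te by linarith
          finally have "8 * (\<Lambda> + ln (real n)) \<le> \<gamma> * real t * m * \<eta>\<^sup>2" .
          then have "8 * (\<Lambda> + ln (real n)) / (m * \<eta>) \<le> \<eta> * \<gamma> * real t"
            using m \<eta> by (simp add: divide_le_eq power2_eq_square mult_ac)
          from mult_right_mono[OF this ip_nonneg[of h]] show ?thesis by (simp add: F_def mult_ac)
        qed
        moreover have "(1 - \<eta>) * (\<Sum>x<n. visits x xs * carre h x)
            - 8 * (\<Lambda> + ln (real n)) / (m * \<eta>) * ip h h \<le> emp_energy f xs"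
          using good unfolding eh[symmetric] by blast
        ultimately have en: "((1 - \<eta>)\<^sup>2 - \<eta>) * (\<gamma> * F) \<le> emp_energy f xs"
          by (simp add: power2_eq_square algebra_simps)
        have "(1 - 4 * \<eta>) * \<gamma> * emp_var f xs \<le> (1 - 4 * \<eta>) * \<gamma> * ((1 + \<eta>) * F)"
          using var \<eta> gap_pos by (intro mult_left_mono) auto
        also have "\<dots> = ((1 - 4 * \<eta>) * (1 + \<eta>)) * (\<gamma> * F)" by simp
        also have "\<dots> \<le> ((1 - \<eta>)\<^sup>2 - \<eta>) * (\<gamma> * F)"
          using F gap_pos by (intro mult_right_mono) (auto simp: power2_eq_square algebra_simps)
        finally show "(1 - 4 * \<eta>) * \<gamma> * emp_var f xs \<le> emp_energy f xs" using en by linarith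
      qed
      have half: "\<gamma> / 2 \<le> emp_gap xs"
      proof -
        have "1 / 2 * \<gamma> \<le> (1 - 4 * \<eta>) * \<gamma>" using \<eta> gap_pos by (intro mult_right_mono) auto
        then show ?thesis using lower by simp
      qed
      \<comment> \<open>Every state is left at least \<open>t * m / 2\<close> times and the
        empirical gap is at least \<open>\<gamma> / 2\<close>, so the guard holds and the estimator
        does not fall back to \<open>0\<close>.\<close>
      have "1536 * \<Lambda> \<le> real t * m / 2 * (\<gamma> / 2)"
      proof -
        have "\<epsilon>\<^sup>2 \<le> 1" using \<epsilon> \<epsilon>1 by (simp add: power_le_one)
        then have "\<gamma> * real t * m * \<epsilon>\<^sup>2 \<le> \<gamma> * real t * m * 1"
          using m(1) gap_pos by (intro mult_left_mono) auto
        then have "16384 * \<Lambda> \<le> \<gamma> * real t * m" using t1 by linarith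
        then show ?thesis using \<Lambda>1 by (simp add: mult_ac)
      qed
      also have "\<dots> \<le> emp_min n xs * emp_gap xs"
        using vmin half tm gap_pos pos by (intro mult_mono) auto
      finally have est: "gap_estimator \<delta> n xs = emp_gap xs" by (simp add: gap_estimator_def \<Lambda>_def)
      have "6 * \<Lambda> / (?\<theta> * emp_min n xs) \<le> 6 * \<Lambda> / (?\<theta> * (real t * m / 2))"
        using vmin tm \<epsilon> \<Lambda>1 pos by (intro divide_left_mono mult_left_mono) auto
      also have "\<dots> = 1536 * \<Lambda> / (\<epsilon> * (real t * m))" by simp
      also have "\<dots> \<le> \<epsilon> / 8 * \<gamma>"
      proof -
        have "1536 * \<Lambda> \<le> \<gamma> * real t * m * \<epsilon>\<^sup>2 / 8" using t1 \<Lambda>1 by linarith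
        also have "\<dots> = \<epsilon> / 8 * \<gamma> * (\<epsilon> * (real t * m))" by (simp add: power2_eq_square)
        finally show ?thesis using \<epsilon> tm by (subst pos_divide_le_eq) auto
      qed
      finally have small: "6 * \<Lambda> / (?\<theta> * emp_min n xs) \<le> \<epsilon> / 8 * \<gamma>" .
      have "?C xs" using good by blast
      then have "(1 - 16 * ?\<theta>) * emp_gap xs \<le> \<gamma> + 6 * \<Lambda> / (?\<theta> * emp_min n xs)"
        by (rule upper[OF xs _ _ pos, rotated 2]) (use \<epsilon> \<epsilon>1 in auto)
      moreover have "1 - 16 * ?\<theta> = 1 - \<epsilon> / 8" by simp
      ultimately have "(1 - \<epsilon> / 8) * emp_gap xs \<le> \<gamma> + \<epsilon> / 8 * \<gamma>" using small by (simp only:)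
      also have "\<dots> = (1 + \<epsilon> / 8) * \<gamma>" by (simp add: distrib_right)
      finally have "(1 - \<epsilon> / 8) * emp_gap xs \<le> (1 + \<epsilon> / 8) * \<gamma>" .
      also have "(1 + \<epsilon> / 8) * \<gamma> < ((1 - \<epsilon> / 8) * (1 + \<epsilon>)) * \<gamma>"
      proof (rule mult_strict_right_mono[OF _ gap_pos])
        have "\<epsilon> * \<epsilon> \<le> \<epsilon>" using \<epsilon> \<epsilon>1 by (simp add: mult_left_le)
        moreover have "(1 - \<epsilon> / 8) * (1 + \<epsilon>) = 1 + \<epsilon> - \<epsilon> / 8 - \<epsilon> * \<epsilon> / 8"
          by (simp add: algebra_simps add_divide_distrib)
        ultimately show "1 + \<epsilon> / 8 < (1 - \<epsilon> / 8) * (1 + \<epsilon>)" using \<epsilon> by linarith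
      qed
      finally have "emp_gap xs < (1 + \<epsilon>) * \<gamma>" using \<epsilon>1 by (simp add: mult.assoc)
      moreover have "(1 - \<epsilon>) * \<gamma> < (1 - 4 * \<eta>) * \<gamma>"
        using \<epsilon> gap_pos by (intro mult_strict_right_mono) (auto simp: \<eta>_def)
      ultimately have "emp_gap xs < (1 + \<epsilon>) * \<gamma>" "(1 - \<epsilon>) * \<gamma> < emp_gap xs"
        using lower by linarith+
      then have "emp_gap xs / \<gamma> < 1 + \<epsilon>" "1 - \<epsilon> < emp_gap xs / \<gamma>"
        using gap_pos by (simp_all add: divide_less_eq less_divide_eq)
      then show False using wrong by (simp add: est abs_less_iff)
    qed
    then have "pr t (\<lambda>xs. \<not> \<bar>gap_estimator \<delta> n xs / \<gamma> - 1\<bar> < \<epsilon>) \<le> \<delta>" using bad by linarith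
    then show ?thesis unfolding pr_not by linarith
  qed
qed

end

section \<open>The spectral gap as a matrix eigenvalue\<close>

text \<open>The eigenfunctions are the columns of \<open>U\<close>. Orthonormality says that the
  weighted transpose \<open>V\<close> inverts \<open>U\<close> on the left, hence on both sides, so
  \<open>P\<close> is similar to a diagonal matrix and algebraic multiplicities are counted by the
  eigenbasis.\<close>

lemma (in weighted) proots_char_poly:
  assumes P: "P \<in> carrier_mat n n" and u: "eigenbasis (\<lambda>x y. P $$ (x, y)) u l"
  shows "proots (char_poly P) = image_mset l (mset_set {..<n})"
proof -
  define B where "B = mat_diag n l"
  define U where "U = mat n n (\<lambda>(x, i). u i x)"
  define V where "V = mat n n (\<lambda>(i, x). u i x * w x)"
  have carrier: "B \<in> carrier_mat n n" "U \<in> carrier_mat n n" "V \<in> carrier_mat n n"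
    by (simp_all add: B_def U_def V_def)
  have VU: "V * U = 1\<^sub>m n"
  proof (rule eq_matI)
    fix i j assume "i < dim_row (1\<^sub>m n)" "j < dim_col (1\<^sub>m n)"
    then have ij: "i < n" "j < n" by auto
    have "(V * U) $$ (i, j) = ip (u i) (u j)"
      using ij by (simp add: U_def V_def scalar_prod_def ip_def lessThan_atLeast0 mult_ac)
    then show "(V * U) $$ (i, j) = 1\<^sub>m n $$ (i, j)"
      using u ij by (simp add: eigenbasis_def orthonormal_def)
  qed (use carrier in auto)
  have UV: "U * V = 1\<^sub>m n" by (rule mat_mult_left_right_inverse[OF carrier(3,2) VU])
  have PU: "P * U = U * B"
  proof (rule eq_matI)
    fix x j assume "x < dim_row (U * B)" "j < dim_col (U * B)"
    then have xj: "x < n" "j < n" using carrier by auto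
    have "(P * U) $$ (x, j) = app n (\<lambda>x y. P $$ (x, y)) (u j) x"
      using xj P by (simp add: U_def scalar_prod_def app_def lessThan_atLeast0)
    also have "\<dots> = l j * u j x" using u xj by (simp add: eigenbasis_def)
    also have "\<dots> = (U * B) $$ (x, j)"
    proof -
      have "U * B = mat n n (\<lambda>(i, j). U $$ (i, j) * l j)"
        unfolding B_def by (rule mat_diag_mult_right[OF carrier(2)])
      then show ?thesis using xj by (simp add: U_def)
    qed
    finally show "(P * U) $$ (x, j) = (U * B) $$ (x, j)" .
  qed (use P carrier in auto)
  have "U * B * V = P * U * V" by (simp add: PU)
  also have "\<dots> = P" using P carrier by (simp add: assoc_mult_mat[OF P] UV)
  finally have "similar_mat P B"
    unfolding similar_mat_def using similar_mat_witI[OF UV VU _ P carrier] by metis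
  then have "char_poly P = char_poly B" by (rule char_poly_similar)
  also have "\<dots> = (\<Prod>a\<leftarrow>diag_mat B. [:- a, 1:])"
    by (rule char_poly_upper_triangular[OF carrier(1)]) (auto simp: B_def mat_diag_def)
  also have "diag_mat B = map l [0..<n]" by (auto simp: diag_mat_def B_def mat_diag_def)
  finally have "proots (char_poly P) = (\<Sum>p\<leftarrow>map (\<lambda>a. [:- a, 1:]) (map l [0..<n]). proots p)"
    using proots_prod_list[of "map (\<lambda>a. [:- a, 1:]) (map l [0..<n])"] by (simp add: o_def image_iff)
  also have "\<dots> = mset (map l [0..<n])"
    by (induction n) auto
  finally show ?thesis by (simp add: lessThan_atLeast0)
qed

text \<open>An upper bound \<open>c\<close> is sorted to the end, so index \<open>1\<close> of the
  reversed list is the last entry of the sorted \<open>R\<close>, that is its maximum, even when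
  \<open>c\<close> itself occurs in \<open>R\<close>.\<close>

lemma rev_sorted_list_of_add_max:
  fixes R :: "real multiset"
  assumes "R \<noteq> {#}" "\<And>r. r \<in># R \<Longrightarrow> r \<le> c"
  shows "rev (sorted_list_of_multiset (add_mset c R)) ! 1 \<in># R"
    and "r \<in># R \<Longrightarrow> r \<le> rev (sorted_list_of_multiset (add_mset c R)) ! 1"
proof -
  define ys where "ys = sorted_list_of_multiset R"
  have ys: "sorted ys" "mset ys = R" "ys \<noteq> []"
    using assms(1) by (auto simp: ys_def sorted_sorted_list_of_multiset) (metis mset.simps(1) mset_sorted_list_of_multiset)
  have "sorted (ys @ [c])" using ys assms(2) by (auto simp: sorted_append)
  then have "sorted_list_of_multiset (add_mset c R) = ys @ [c]"
    using ys(2) sorted_list_of_multiset_mset[of "ys @ [c]"] by (simp add: sorted_sort_id)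
  then have eq: "rev (sorted_list_of_multiset (add_mset c R)) ! 1 = last ys"
    using ys(3) by (simp add: hd_conv_nth[symmetric] hd_rev)
  show "rev (sorted_list_of_multiset (add_mset c R)) ! 1 \<in># R"
    unfolding eq using ys by auto
  show "r \<le> rev (sorted_list_of_multiset (add_mset c R)) ! 1" if "r \<in># R"
  proof -
    have "r \<in> set ys" using that unfolding ys(2)[symmetric] by simp
    then obtain i where "i < length ys" "r = ys ! i" by (auto simp: in_set_conv_nth)
    then show ?thesis unfolding eq using ys by (simp add: last_conv_nth sorted_nth_mono)
  qed
qed

context reversible
begin

text \<open>Irreducibility makes the eigenvalue \<open>1\<close> simple, so that \<open>l2\<close>, the second entry of the sorted spectrum, is
  the largest of the others.\<close>

lemma second_eigenvalue:
  assumes n: "2 \<le> n" and P: "P \<in> carrier_mat n n" "p = (\<lambda>x y. P $$ (x, y))"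
    and irr: "\<And>f x y. energy f = 0 \<Longrightarrow> x < n \<Longrightarrow> y < n \<Longrightarrow> f x = f y"
  defines "l2 \<equiv> eigenvalues_desc P ! 1"
  shows "l2 < 1" "\<And>f. mean f = 0 \<Longrightarrow> (1 - l2) * ip f f \<le> energy f"
    "\<exists>v. ip v v = 1 \<and> mean v = 0 \<and> (\<forall>x<n. app n p v x = l2 * v x)"
proof -
  obtain u l where u: "eigenbasis p u l" using spectral_theorem[OF selfadj_p] by blast
  have on: "orthonormal n u" and ev: "\<And>i x. i < n \<Longrightarrow> x < n \<Longrightarrow> app n p (u i) x = l i * u i x"
    using u by (auto simp: eigenbasis_def)
  have uu: "ip (u i) (u i) = 1" if "i < n" for i using on that by (simp add: orthonormal_def)
  have energy_u: "energy f = (\<Sum>i<n. (1 - l i) * (ip (u i) f)\<^sup>2)" for f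
  proof -
    have "energy f = (\<Sum>i<n. ip (u i) f * ip (u i) f) - (\<Sum>i<n. l i * ip (u i) f * ip (u i) f)"
      using ip_funpow[OF selfadj_p u, of f 1 f] Parseval[OF on, of f f] by (simp add: energy_eq)
    then show ?thesis by (simp add: sum_subtractf[symmetric] power2_eq_square algebra_simps)
  qed
  have energy_nonneg: "0 \<le> energy f" for f
    unfolding energy_def using w_pos carre_nonneg by (intro sum_nonneg mult_nonneg_nonneg) (auto intro: less_imp_le)
  have energy_ui: "energy (u i) = 1 - l i" if "i < n" for i
  proof -
    have "energy (u i) = (\<Sum>j<n. if j = i then 1 - l i else 0)"
      unfolding energy_u using on that by (intro sum.cong) (auto simp: orthonormal_def)
    then show ?thesis using that by simp
  qed
  have const: "u i x = u i 0" if "i < n" "l i = 1" "x < n" for i x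
    using irr[of "u i" x 0] energy_ui[OF that(1)] that n by simp
  have one: "ip (\<lambda>_. 1) (\<lambda>_. 1) = 1" using pi_sum by (simp add: ip_def)
  \<comment> \<open>Some basis function overlaps with the constants; self-adjointness forces its
    eigenvalue to be \<open>1\<close>, and irreducibility then makes it constant. All other basis
    functions are orthogonal to it, hence of mean zero.\<close>
  have "\<exists>i<n. ip (u i) (\<lambda>_. 1) \<noteq> 0"
  proof (rule ccontr)
    assume "\<not> ?thesis"
    then have "ip (\<lambda>_. 1) (\<lambda>_. 1) = 0" by (subst Parseval[OF on]) (intro sum.neutral, auto)
    then show False using one by simp
  qed
  then obtain i0 where i0: "i0 < n" "ip (u i0) (\<lambda>_. 1) \<noteq> 0" by blast
  have "l i0 * ip (u i0) (\<lambda>_. 1) = ip (u i0) (app n p (\<lambda>_. 1))"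
    using ip_eigen_funpow[OF selfadj_p u i0(1), of 1 "\<lambda>_. 1"] by simp
  also have "\<dots> = ip (u i0) (\<lambda>_. 1)" using app_const[of _ 1] by (intro ip_cong) auto
  finally have l0: "l i0 = 1" using i0(2) by simp
  have mean_u: "ip (u i0) f = u i0 0 * mean f" for f
  proof -
    have "ip (u i0) f = ip (\<lambda>x. u i0 0 * 1) f"
    proof (rule ip_cong)
      show "u i0 x = u i0 0 * 1" if "x < n" for x unfolding mult_1_right by (rule const[OF i0(1) l0 that])
    qed (rule refl)
    then show ?thesis by (simp only: ip_scale_left mean_eq_ip)
  qed
  have u00: "u i0 0 \<noteq> 0" using mean_u[of "u i0"] uu[OF i0(1)] by auto
  have mean_other: "mean (u i) = 0" if "i < n" "i \<noteq> i0" for i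
    using mean_u[of "u i"] on that i0(1) u00 by (simp add: orthonormal_def)
  have less: "l i < 1" if i: "i < n" "i \<noteq> i0" for i
  proof -
    have "l i \<noteq> 1"
    proof
      assume "l i = 1"
      then have c: "u i x = u i 0" if "x < n" for x using const i(1) that by blast
      have "mean (u i) = (\<Sum>x<n. \<pi> x * u i 0)"
        unfolding mean_def by (intro sum.cong refl arg_cong2[where f = "(*)"] c) simp
      then have "u i 0 = 0" using mean_other[OF i] pi_sum by (simp flip: sum_distrib_right)
      then have "u i x = 0" if "x < n" for x using c[OF that] by (rule trans[rotated])
      then have "ip (u i) (u i) = 0" unfolding ip_def by (intro sum.neutral) auto
      then show False using uu[OF i(1)] by simp
    qed
    then show ?thesis using energy_ui[OF i(1)] energy_nonneg[of "u i"] by linarith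
  qed
  define R where "R = image_mset l (mset_set ({..<n} - {i0}))"
  have "{..<n} = insert i0 ({..<n} - {i0})" using i0 by auto
  then have "mset_set {..<n} = add_mset i0 (mset_set ({..<n} - {i0}))"
    by (metis Diff_iff finite_Diff finite_lessThan insertI1 mset_set.insert)
  then have "proots (char_poly P) = add_mset 1 R"
    using proots_char_poly[OF P(1), of u l] u P(2) l0 by (simp add: R_def)
  then have l2: "l2 = rev (sorted_list_of_multiset (add_mset 1 R)) ! 1"
    by (simp add: l2_def eigenvalues_desc_def)
  have "\<exists>k<n. k \<noteq> i0" using n by (intro exI[of _ "if i0 = 0 then 1 else 0"]) auto
  then have "R \<noteq> {#}" by (auto simp: R_def mset_set_empty_iff)
  moreover have Rmem: "r \<in># R \<longleftrightarrow> (\<exists>i<n. i \<noteq> i0 \<and> r = l i)" for r by (auto simp: R_def)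
  then have "r \<le> 1" if "r \<in># R" for r using that less by fastforce
  ultimately have mem: "l2 \<in># R" and max: "\<And>r. r \<in># R \<Longrightarrow> r \<le> l2"
    unfolding l2 using rev_sorted_list_of_add_max by blast+
  obtain j where j: "j < n" "j \<noteq> i0" "l2 = l j" using mem Rmem by auto
  show "l2 < 1" using less[OF j(1,2)] j(3) by simp
  show "(1 - l2) * ip f f \<le> energy f" if "mean f = 0" for f
  proof -
    have "(1 - l2) * (ip (u i) f)\<^sup>2 \<le> (1 - l i) * (ip (u i) f)\<^sup>2" if "i < n" for i
    proof (cases "i = i0")
      case True
      then show ?thesis using mean_u[of f] \<open>mean f = 0\<close> by simp
    next
      case False
      then show ?thesis using max[of "l i"] Rmem that by (intro mult_right_mono) auto
    qed
    then have "(\<Sum>i<n. (1 - l2) * (ip (u i) f)\<^sup>2) \<le> energy f"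
      unfolding energy_u by (intro sum_mono) auto
    then show ?thesis using Parseval[OF on, of f f] by (simp add: sum_distrib_left power2_eq_square)
  qed
  show "\<exists>v. ip v v = 1 \<and> mean v = 0 \<and> (\<forall>x<n. app n p v x = l2 * v x)"
    using uu[OF j(1)] mean_other[OF j(1,2)] ev[OF j(1)] j(3) by blast
qed

text \<open>Division by the oscillation creates the unit difference that
  \<open>emp_min_le_emp_var\<close> needs. Mean zero places \<open>0\<close> between minimum and
  maximum, so the oscillation also bounds the absolute values, as \<open>pr_eigenfunction\<close>
  requires.\<close>

lemma normalised_oscillation:
  assumes n: "0 < n" and v: "ip v v = 1" "mean v = 0"
  shows "\<exists>s a b. a < n \<and> b < n \<and> s * v b - s * v a = 1 \<and> (\<forall>x<n. \<bar>s * v x\<bar> \<le> 1) \<and>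
    (\<forall>x<n. \<forall>y<n. \<bar>s * v y - s * v x\<bar> \<le> 1)"
proof -
  have fin: "finite (v ` {..<n})" "v ` {..<n} \<noteq> {}" using n by auto
  obtain a where a: "a < n" "v a = Min (v ` {..<n})" using Min_in[OF fin] by auto
  obtain b where b: "b < n" "v b = Max (v ` {..<n})" using Max_in[OF fin] by auto
  have lo: "v a \<le> v x" and hi: "v x \<le> v b" if "x < n" for x
    using a b that fin by auto
  have "(\<Sum>x<n. \<pi> x * v a) \<le> mean v" "mean v \<le> (\<Sum>x<n. \<pi> x * v b)"
    unfolding mean_def by (intro sum_mono mult_left_mono; use lo hi w_pos in \<open>auto intro: less_imp_le\<close>)+
  then have ab: "v a \<le> 0" "0 \<le> v b" using v(2) pi_sum by (simp_all flip: sum_distrib_right)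
  have "v a \<noteq> v b"
  proof
    assume "v a = v b"
    then have "v x = 0" if "x < n" for x using lo[OF that] hi[OF that] ab by linarith
    then have "ip v v = 0" unfolding ip_def by (intro sum.neutral) auto
    then show False using v by simp
  qed
  then have pos: "0 < v b - v a" using ab by linarith
  define s where "s = 1 / (v b - v a)"
  have s: "0 < s" "s * (v b - v a) = 1" using pos by (simp_all add: s_def)
  have bound: "\<bar>s * z\<bar> \<le> 1" if "\<bar>z\<bar> \<le> v b - v a" for z
    using mult_left_mono[OF that, of s] s by (simp add: abs_mult)
  have "\<bar>s * v x\<bar> \<le> 1" if "x < n" for x
    using lo[OF that] hi[OF that] ab by (intro bound) linarith
  moreover have "\<bar>s * v y - s * v x\<bar> \<le> 1" if "x < n" "y < n" for x y
    unfolding right_diff_distrib[symmetric] using lo[of x] hi[of x] lo[of y] hi[of y] that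
    by (intro bound) linarith
  ultimately show ?thesis
    using a(1) b(1) s(2) unfolding right_diff_distrib by blast
qed

end

section \<open>Trajectories of a Markov chain\<close>

text \<open>The time is recovered from the length of the list, so one weight function describes all
  horizons.\<close>

definition traj_law :: "'w measure \<Rightarrow> (nat \<Rightarrow> 'w \<Rightarrow> nat) \<Rightarrow> nat list \<Rightarrow> real" where
  "traj_law M X xs = measure M {\<omega> \<in> space M. trajectory X (length xs - 1) \<omega> = xs}"

lemma trajectory_eq_iff:
  "length xs = Suc t \<Longrightarrow> trajectory X t \<omega> = xs \<longleftrightarrow> (\<forall>s\<le>t. X s \<omega> = xs ! s)"
  by (auto simp: trajectory_def list_eq_iff_nth_eq less_Suc_eq_le simp del: upt_Suc)

context
  fixes M :: "'w measure" and n :: nat and P :: "real mat" and X :: "nat \<Rightarrow> 'w \<Rightarrow> nat"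
  assumes mc: "markov_chain M n P X"
begin

interpretation prob_space M using mc by (simp add: markov_chain_def)

lemma chain_measurable: "X s \<in> M \<rightarrow>\<^sub>M count_space {..<n}"
  using mc by (simp add: markov_chain_def)

lemma trajectory_paths: "\<omega> \<in> space M \<Longrightarrow> trajectory X t \<omega> \<in> paths n t"
  using measurable_space[OF chain_measurable] by (auto simp: trajectory_def paths_def simp del: upt_Suc)

lemma sets_trajectory: "{\<omega> \<in> space M. trajectory X t \<omega> = xs} \<in> sets M"
proof (cases "xs \<in> paths n t")
  case True
  have "{\<omega> \<in> space M. X s \<omega> = xs ! s} \<in> sets M" if "s \<le> t" for s
  proof -
    have "X s -` {xs ! s} \<inter> space M \<in> sets M"
      using paths_nth[OF True that] by (intro measurable_sets[OF chain_measurable]) auto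
    then show ?thesis by (simp add: vimage_def Int_def conj_commute)
  qed
  then have "{\<omega> \<in> space M. \<forall>s\<in>{..t}. X s \<omega> = xs ! s} \<in> sets M"
    by (intro sets.sets_Collect_finite_All') auto
  moreover have "length xs = Suc t" using True by (simp add: paths_def)
  then have "trajectory X t \<omega> = xs \<longleftrightarrow> (\<forall>s\<in>{..t}. X s \<omega> = xs ! s)" for \<omega>
    by (simp add: trajectory_eq_iff Ball_def)
  ultimately show ?thesis by (simp only:)
next
  case False
  then have empty: "{\<omega> \<in> space M. trajectory X t \<omega> = xs} = {}" using trajectory_paths by auto
  show ?thesis unfolding empty by (rule sets.empty_sets)
qed

text \<open>Only finitely many trajectories of a given length occur, so for arbitrary
  \<open>A\<close> the event is a finite disjoint union of measurable atoms. Any function of the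
  trajectory is therefore admissible as an estimator.\<close>

lemma prob_trajectory:
  "prob {\<omega> \<in> space M. A (trajectory X t \<omega>)} = (\<Sum>xs | xs \<in> paths n t \<and> A xs. traj_law M X xs)"
proof -
  let ?S = "{xs. xs \<in> paths n t \<and> A xs}"
  have "{\<omega> \<in> space M. A (trajectory X t \<omega>)} = (\<Union>xs\<in>?S. {\<omega> \<in> space M. trajectory X t \<omega> = xs})"
    using trajectory_paths by auto
  then have "prob {\<omega> \<in> space M. A (trajectory X t \<omega>)}
      = (\<Sum>xs\<in>?S. prob {\<omega> \<in> space M. trajectory X t \<omega> = xs})"
    using sets_trajectory by (simp only:) (rule finite_measure_finite_Union, auto simp: disjoint_family_on_def)
  also have "\<dots> = (\<Sum>xs\<in>?S. traj_law M X xs)"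
    by (intro sum.cong) (auto simp: traj_law_def paths_def)
  finally show ?thesis .
qed

lemma path_law_traj_law:
  assumes "stochastic n p" "p = (\<lambda>x y. P $$ (x, y))"
  shows "path_law n p (traj_law M X)"
proof -
  interpret stochastic n p by (rule assms(1))
  show ?thesis
  proof
    show "0 \<le> traj_law M X xs" for xs by (simp add: traj_law_def)
    have "paths n 0 = (\<lambda>x. [x]) ` {..<n}" by (auto simp: paths_def length_Suc_conv)
    then have "(\<Sum>x<n. traj_law M X [x]) = (\<Sum>xs\<in>paths n 0. traj_law M X xs)"
      by (simp add: sum.reindex inj_on_def)
    also have "\<dots> = 1" using prob_trajectory[of "\<lambda>_. True" 0] prob_space by simp
    finally show "(\<Sum>x<n. traj_law M X [x]) = 1" .
    fix xs t y assume xs: "xs \<in> paths n t" and y: "y < n"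
    have len: "length xs = Suc t" using xs by (simp add: paths_def)
    have law: "traj_law M X xs = prob {\<omega> \<in> space M. \<forall>s\<le>t. X s \<omega> = xs ! s}"
      by (simp add: traj_law_def len trajectory_eq_iff)
    have law': "traj_law M X (xs @ [y])
        = prob {\<omega> \<in> space M. X (Suc t) \<omega> = y \<and> (\<forall>s\<le>t. X s \<omega> = xs ! s)}"
      unfolding traj_law_def
      by (intro arg_cong[where f = prob] Collect_cong)
        (auto simp: len trajectory_eq_iff nth_append le_Suc_eq)
    have sets: "{\<omega> \<in> space M. \<forall>s\<le>t. X s \<omega> = xs ! s} \<in> sets M"
      using sets_trajectory[of t xs] unfolding trajectory_eq_iff[OF len] .
    show "traj_law M X (xs @ [y]) = traj_law M X xs * p (last xs) y"
    proof (cases "traj_law M X xs = 0")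
      \<comment> \<open>\<open>markov_chain\<close> prescribes conditional probabilities only after
        histories of positive probability; a null history is handled by monotonicity, its extensions
        being null too.\<close>
      case True
      have "traj_law M X (xs @ [y]) \<le> traj_law M X xs"
        unfolding law law' by (intro finite_measure_mono sets) auto
      then show ?thesis using True by (simp add: traj_law_def measure_le_0_iff)
    next
      case False
      then have "0 < prob {\<omega> \<in> space M. \<forall>s\<le>t. X s \<omega> = xs ! s}"
        unfolding law by (simp add: zero_less_measure_iff)
      then have "\<P>(\<omega> in M. X (Suc t) \<omega> = y \<bar> \<forall>s\<le>t. X s \<omega> = xs ! s) = P $$ (xs ! t, y)"
        using mc y by (simp add: markov_chain_def)
      moreover have "xs ! t = last xs" using len by (cases xs rule: rev_cases) auto
      ultimately show ?thesis
        using False by (simp add: cond_prob_def law law' assms(2) divide_eq_eq mult.commute)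
    qed
  qed
qed

end

text \<open>A nonzero entry of a power comes from a path of nonzero entries, along which
  \<open>f\<close> does not change. With irreducibility this shows that functions of zero energy are
  constant.\<close>

lemma eq_of_pow_mat_nonzero:
  assumes "P \<in> carrier_mat n n" "\<And>x y. x < n \<Longrightarrow> y < n \<Longrightarrow> P $$ (x, y) \<noteq> 0 \<Longrightarrow> f x = f y"
    "x < n" "y < n" "(P ^\<^sub>m k) $$ (x, y) \<noteq> 0"
  shows "f x = f y"
  using assms(4,5)
proof (induction k arbitrary: y)
  case 0
  then show ?case using assms(1,3) by (auto split: if_splits)
next
  case (Suc k)
  have "(P ^\<^sub>m Suc k) $$ (x, y) = (\<Sum>z<n. (P ^\<^sub>m k) $$ (x, z) * P $$ (z, y))"
    using assms(1,3) Suc.prems(1) pow_carrier_mat[OF assms(1), of k]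
    by (simp add: scalar_prod_def lessThan_atLeast0)
  then obtain z where z: "z < n" "(P ^\<^sub>m k) $$ (x, z) * P $$ (z, y) \<noteq> 0"
    using Suc.prems(2) by (metis (no_types, lifting) lessThan_iff sum.neutral)
  then have "(P ^\<^sub>m k) $$ (x, z) \<noteq> 0" "P $$ (z, y) \<noteq> 0" by auto
  then show ?case using Suc.IH[OF z(1)] assms(2)[OF z(1) Suc.prems(1)] by simp
qed

text \<open>With \<open>k = ln n\<close> and \<open>d = ln (1 / \<delta>)\<close>, the sum
  \<open>ln 8 + k + d\<close> is \<open>ln (8 * n / \<delta>)\<close>, and \<open>2 + s\<close> is
  the length in units of \<open>1 / \<gamma>\<close> from the Poisson equation.\<close>

definition sample_factor :: "real \<times> real \<times> real \<times> real \<Rightarrow> real" where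
  "sample_factor = (\<lambda>(g, s, d, k). 8192 * (ln 8 + k + d) * (2 + s))"

lemma real_polynomial_function_sample_factor: "real_polynomial_function sample_factor"
proof -
  have "bounded_linear (\<lambda>v :: real \<times> real \<times> real \<times> real. fst (snd v))"
    "bounded_linear (\<lambda>v :: real \<times> real \<times> real \<times> real. fst (snd (snd v)))"
    "bounded_linear (\<lambda>v :: real \<times> real \<times> real \<times> real. snd (snd (snd v)))"
    by (intro bounded_linear_fst_comp bounded_linear_snd_comp bounded_linear_fst bounded_linear_snd)+
  then have "real_polynomial_function (\<lambda>v :: real \<times> real \<times> real \<times> real.
      8192 * (ln 8 + snd (snd (snd v)) + fst (snd (snd v))) * (2 + fst (snd v)))"
    by (intro real_polynomial_function.intros)
  moreover have "sample_factor
      = (\<lambda>v. 8192 * (ln 8 + snd (snd (snd v)) + fst (snd (snd v))) * (2 + fst (snd v)))"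
    by (auto simp: sample_factor_def fun_eq_iff)
  ultimately show ?thesis by (simp only:)
qed

theorem theorem1:
  "\<exists>L :: real \<times> real \<times> real \<times> real \<Rightarrow> real. real_polynomial_function L \<and>
    (\<forall>\<delta>>0. \<exists>estimator :: nat \<Rightarrow> nat list \<Rightarrow> real.
      \<forall>(n::nat) (P :: real mat) (\<pi> :: real vec) (M :: 'w measure) (X :: nat \<Rightarrow> 'w \<Rightarrow> nat)
        (\<epsilon>::real) (t::nat).
        n \<ge> 2 \<longrightarrow> stochastic_mat n P \<longrightarrow> ergodic_chain n P \<longrightarrow>
        stationary_distribution n P \<pi> \<longrightarrow> reversible_chain n P \<pi> \<longrightarrow>
        positive_definite_chain n P \<pi> \<longrightarrow> markov_chain M n P X \<longrightarrow> \<epsilon> > 0 \<longrightarrow>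
        real t > 1 / (min_stationary n \<pi> * spectral_gap P * \<epsilon>\<^sup>2) *
          L (ln (1 / spectral_gap P), ln (1 / min_stationary n \<pi>), ln (1 / \<delta>), ln (real n)) \<longrightarrow>
        \<P>(\<omega> in M. \<bar>estimator n (trajectory X t \<omega>) / spectral_gap P - 1\<bar> < \<epsilon>) \<ge> 1 - \<delta>)"
proof (intro exI[of _ sample_factor] conjI real_polynomial_function_sample_factor allI impI)
  fix \<delta> :: real assume \<delta>: "\<delta> > 0"
  show "\<exists>estimator :: nat \<Rightarrow> nat list \<Rightarrow> real.
      \<forall>(n::nat) (P :: real mat) (\<pi> :: real vec) (M :: 'w measure) (X :: nat \<Rightarrow> 'w \<Rightarrow> nat)
        (\<epsilon>::real) (t::nat).
        n \<ge> 2 \<longrightarrow> stochastic_mat n P \<longrightarrow> ergodic_chain n P \<longrightarrow>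
        stationary_distribution n P \<pi> \<longrightarrow> reversible_chain n P \<pi> \<longrightarrow>
        positive_definite_chain n P \<pi> \<longrightarrow> markov_chain M n P X \<longrightarrow> \<epsilon> > 0 \<longrightarrow>
        real t > 1 / (min_stationary n \<pi> * spectral_gap P * \<epsilon>\<^sup>2) *
          sample_factor (ln (1 / spectral_gap P), ln (1 / min_stationary n \<pi>), ln (1 / \<delta>), ln (real n)) \<longrightarrow>
        \<P>(\<omega> in M. \<bar>estimator n (trajectory X t \<omega>) / spectral_gap P - 1\<bar> < \<epsilon>) \<ge> 1 - \<delta>"
  proof (intro exI[of _ "gap_estimator \<delta>"] allI impI)
    fix n t :: nat and P :: "real mat" and \<pi>v :: "real vec" and M :: "'w measure" and X \<epsilon>
    assume n: "2 \<le> n" and sto: "stochastic_mat n P" and erg: "ergodic_chain n P"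
      and sta: "stationary_distribution n P \<pi>v" and rev: "reversible_chain n P \<pi>v"
      and pd: "positive_definite_chain n P \<pi>v" and mc: "markov_chain M n P X" and \<epsilon>: "\<epsilon> > 0"
      and t: "real t > 1 / (min_stationary n \<pi>v * spectral_gap P * \<epsilon>\<^sup>2) *
          sample_factor (ln (1 / spectral_gap P), ln (1 / min_stationary n \<pi>v), ln (1 / \<delta>), ln (real n))"
    show "\<P>(\<omega> in M. \<bar>gap_estimator \<delta> n (trajectory X t \<omega>) / spectral_gap P - 1\<bar> < \<epsilon>) \<ge> 1 - \<delta>"
    proof (cases "\<delta> < 1")
      case False
      then have "1 - \<delta> \<le> 0" by simp
      then show ?thesis using measure_nonneg order_trans by blast
    next
      case True
      define p where "p = (\<lambda>x y. P $$ (x, y))"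
      define \<pi> where "\<pi> = (\<lambda>x. \<pi>v $ x)"
      define m where "m = min_stationary n \<pi>v"
      have P: "P \<in> carrier_mat n n" using sto by (simp add: stochastic_mat_def)
      have form: "0 < (\<Sum>x<n. \<pi> x * f x * app n p f x)" if "x < n" "f x \<noteq> 0" for f x
      proof -
        have "vec n f \<noteq> 0\<^sub>v n" using that by (metis index_vec index_zero_vec(1))
        then have "0 < (\<Sum>x<n. \<pi>v $ x * vec n f $ x * (P *\<^sub>v vec n f) $ x)"
          using pd vec_carrier[of n f] unfolding positive_definite_chain_def by blast
        also have "\<dots> = (\<Sum>x<n. \<pi> x * f x * app n p f x)"
          using P by (intro sum.cong) (auto simp: \<pi>_def p_def app_def scalar_prod_def lessThan_atLeast0)
        finally show ?thesis .
      qed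
      \<comment> \<open>Testing positive definiteness with the indicator of \<open>x\<close> gives
        \<open>\<pi> x * p x x > 0\<close>.\<close>
      have pi_pos: "0 < \<pi> x" if "x < n" for x
      proof -
        have "0 < (\<Sum>y<n. \<pi> y * point x y * app n p (point x) y)"
          using that by (intro form[of x]) (auto simp: point_def)
        also have "\<dots> = (\<Sum>y<n. if y = x then \<pi> x * p x x else 0)"
          unfolding app_point[OF that] by (intro sum.cong) (auto simp: point_def)
        finally have "0 < \<pi> x * p x x" using that by simp
        then have "\<pi> x \<noteq> 0" by auto
        then show ?thesis using sta that by (simp add: \<pi>_def stationary_distribution_def order_less_le)
      qed
      interpret reversible n p \<pi>
      proof
        show "0 \<le> p x y" if "x < n" "y < n" for x y using sto that by (simp add: stochastic_mat_def p_def)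
        show "(\<Sum>y<n. p x y) = 1" if "x < n" for x using sto that by (simp add: stochastic_mat_def p_def)
        show "0 < \<pi> x" if "x < n" for x using that by (rule pi_pos)
        show "(\<Sum>x<n. \<pi> x) = 1" using sta by (simp add: stationary_distribution_def \<pi>_def)
        show "\<pi> x * p x y = \<pi> y * p y x" if "x < n" "y < n" for x y
          using rev that by (simp add: reversible_chain_def \<pi>_def p_def)
      qed
      have irr: "f x = f y" if f: "energy f = 0" and xy: "x < n" "y < n" for f x y
      proof -
        obtain k where k: "0 < (P ^\<^sub>m k) $$ (x, y)"
          using erg xy unfolding ergodic_chain_def irreducible_chain_def by blast
        \<comment> \<open>Zero energy kills every term \<open>p a b * (f b - f a)\<^sup>2\<close>,
          because the stationary weights are positive.\<close>
        have edge: "f a = f b" if ab: "a < n" "b < n" "P $$ (a, b) \<noteq> 0" for a b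
        proof -
          have "\<forall>a\<in>{..<n}. \<pi> a * carre f a = 0"
            using f unfolding energy_def
            by (subst (asm) sum_nonneg_eq_0_iff)
              (auto intro: mult_nonneg_nonneg less_imp_le[OF pi_pos] carre_nonneg)
          then have "\<pi> a * carre f a = 0" using ab(1) by blast
          then have "(\<Sum>y<n. p a y * (f y - f a)\<^sup>2) = 0" using pi_pos[OF ab(1)] by (simp add: two_carre)
          then have "\<forall>y\<in>{..<n}. p a y * (f y - f a)\<^sup>2 = 0"
            using p_nonneg[OF ab(1)] by (subst (asm) sum_nonneg_eq_0_iff) auto
          then have "p a b * (f b - f a)\<^sup>2 = 0" using ab(2) by blast
          then show ?thesis using ab(3) by (simp add: p_def)
        qed
        show ?thesis by (rule eq_of_pow_mat_nonzero[where k = k, OF P edge xy]) (use k in auto)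
      qed
      note second = second_eigenvalue[OF n P p_def irr]
      define \<gamma> where "\<gamma> = spectral_gap P"
      have \<gamma>: "\<gamma> = 1 - eigenvalues_desc P ! 1" by (simp add: \<gamma>_def spectral_gap_def)
      obtain v where v: "ip v v = 1" "mean v = 0" "\<forall>x<n. app n p v x = (1 - \<gamma>) * v x"
        using second(3) by (auto simp: \<gamma>)
      have form0: "0 \<le> ip f (app n p f)" for f
      proof (cases "\<exists>x<n. f x \<noteq> 0")
        case True
        then obtain x where "x < n" "f x \<noteq> 0" by blast
        then have "0 < (\<Sum>x<n. \<pi> x * f x * app n p f x)" by (rule form)
        then show ?thesis unfolding ip_def by (rule less_imp_le)
      next
        case False
        then have "ip f (app n p f) = 0" unfolding ip_def by (intro sum.neutral) auto
        then show ?thesis by simp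
      qed
      interpret gapped_path n p \<pi> \<gamma> "traj_law M X"
      proof -
        \<comment> \<open>Positive definiteness at the second eigenfunction says that its eigenvalue
          \<open>1 - \<gamma>\<close> is positive.\<close>
        have "\<gamma> < 1"
        proof -
          obtain x where "x < n" "v x \<noteq> 0"
          proof (rule ccontr)
            assume "\<not> thesis"
            then have "\<forall>x<n. v x = 0" using that by blast
            then have "ip v v = 0" unfolding ip_def by (intro sum.neutral) auto
            then show False using v(1) by simp
          qed
          then have "0 < (\<Sum>x<n. \<pi> x * v x * app n p v x)" by (rule form)
          then have "0 < ip v (app n p v)" unfolding ip_def .
          also have "ip v (app n p v) = ip v (\<lambda>x. (1 - \<gamma>) * v x)" using v(3) by (intro ip_cong) auto
          also have "\<dots> = 1 - \<gamma>" by (simp add: ip_scale_right v)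
          finally show ?thesis by simp
        qed
        then have "gapped n p \<pi> \<gamma>"
          using second(1,2) form0 by unfold_locales (auto simp: \<gamma>)
        moreover have "path_law n p (traj_law M X)"
          by (rule path_law_traj_law[OF mc _ p_def]) unfold_locales
        ultimately show "gapped_path n p \<pi> \<gamma> (traj_law M X)" by (simp add: gapped_path_def)
      qed
      have fin: "finite (\<pi> ` {..<n})" "\<pi> ` {..<n} \<noteq> {}" using n by (auto simp: lessThan_empty_iff)
      have m_eq: "m = Min (\<pi> ` {..<n})" by (simp add: m_def min_stationary_def \<pi>_def)
      have m: "0 < m" "\<And>z. z < n \<Longrightarrow> m \<le> \<pi> z"
        unfolding m_eq using fin pi_pos by auto
      have m1: "m \<le> 1"
      proof -
        have "m \<le> \<pi> 0" using m(2) n by simp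
        also have "\<pi> 0 \<le> (\<Sum>x<n. \<pi> x)" using n pi_pos by (intro member_le_sum) (auto intro: less_imp_le)
        finally show ?thesis using pi_sum by simp
      qed
      obtain s a b where s: "a < n" "b < n" "s * v b - s * v a = 1" "\<forall>x<n. \<bar>s * v x\<bar> \<le> 1"
          "\<forall>x<n. \<forall>y<n. \<bar>s * v y - s * v x\<bar> \<le> 1"
        using normalised_oscillation[OF _ v(1,2)] n by auto
      have "1 - \<delta> \<le> pr t (\<lambda>xs. \<bar>gap_estimator \<delta> n xs / \<gamma> - 1\<bar> < \<epsilon>)"
      proof (rule gap_estimator_accurate[OF n m(1) m1 m(2), where g = "\<lambda>x. s * v x"])
        have "ln (8 * real n / \<delta>) = ln 8 + ln (real n) + ln (1 / \<delta>)"
          using n \<delta> by (simp add: ln_div ln_mult)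
        then show "1 / (m * \<gamma> * \<epsilon>\<^sup>2) * (8192 * ln (8 * real n / \<delta>) * (2 + ln (1 / m))) < real t"
          using t by (simp add: sample_factor_def m_def \<gamma>_def)
        show "app n p (\<lambda>x. s * v x) x = (1 - \<gamma>) * (s * v x)" if "x < n" for x
          unfolding app_scale using v(3) that by simp
        show "\<bar>s * v x\<bar> \<le> 1" if "x < n" for x using s(4) that by blast
        show "\<bar>s * v y - s * v x\<bar> \<le> 1" if "x < n" "y < n" for x y using s(5) that by blast
        show "s * v b - s * v a = 1" by (rule s(3))
      qed (use s(1,2) \<delta> True \<epsilon> in simp_all)
      then show ?thesis
        using prob_trajectory[OF mc, of "\<lambda>xs. \<bar>gap_estimator \<delta> n xs / \<gamma> - 1\<bar> < \<epsilon>" t]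
        unfolding pr_def \<gamma>_def by simp
    qed
  qed
qed

end
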